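(* Let $\Xi=[\boldsymbol\xi_1\ \cdots\ \boldsymbol\xi_n]$ be a real $s\times n$ matrix that corresponds to a non-degenerate box spline $M_\Xi$ (that is, the range of $\Xi$ has dimension $s$). Then the polynomial to which $M_\Xi$ is equal within each region $R$ of the box spline can be obtained as $$P_R(\boldsymbol x):=\sum_{(b,\boldsymbol p)\in S_\Xi}\ \sum_{(c,\boldsymbol\alpha)\in P_{n-s}}\frac{b\cdot c}{|\det\Xi_\alpha|}\,[\![\,(\Xi_\alpha^{-1}\boldsymbol c_R)-\boldsymbol p\,]\!]_+^{(\boldsymbol\mu_\alpha-\boldsymbol 1)}\ \big((\Xi_\alpha^{-1}\boldsymbol x)-\boldsymbol p\big)^{(\boldsymbol\mu_\alpha-\boldsymbol 1)},$$ where $\boldsymbol c_R$ is the center of the region $R$.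
   Context: Box spline: $M_{[\,]}:=\delta$ (the Dirac delta distribution) and $M_\Xi:=\int_0^1 M_{\Xi\setminus\boldsymbol\zeta}(\cdot-t\boldsymbol\zeta)\,dt$, where $\boldsymbol\zeta$ is a column of $\Xi$ and $\Xi\setminus\boldsymbol\zeta$ is $\Xi$ with that column removed. Mesh and regions: $\mathbb{H}(\Xi)$ is the set of hyperplanes defined by columns of $\Xi$ that form an $(s-1)$-dimensional subspace of $\mathbb{R}^s$, and the mesh is $\Gamma(\Xi):=\bigcup_{H\in\mathbb{H}(\Xi)}(H+\Xi\mathbb{Z}^n)$; the shifted hyperplanes in it are the knot planes. The regions $R$ are the pieces obtained by splitting the support of $M_\Xi$ (the polyhedron defined by the direction vectors) with the knot planes. Multi-set $S_\Xi$ (pairs of a scalar and a vector in $\mathbb{R}^s$): $S_{[\,]}:=\{(1,\boldsymbol 0)\}$ and $S_\Xi:=\{(-c,\boldsymbol\xi+\boldsymbol p):(c,\boldsymbol p)\in S_{\Xi\setminus\boldsymbol\xi}\}\cup S_{\Xi\setminus\boldsymbol\xi}$, where $\boldsymbol\xi$ is a column of $\Xi$. Kernel matrices: for a matrix $X$, $\ker X$ denotes the matrix whose columns form a basis of the null-space of $X$, chosen to be in column echelon form. So $\ker\Xi$ is $n\times(n-s)$. For an $n$-dimensional vector $\boldsymbol\alpha$, $\|\boldsymbol\alpha\|_0$ is the number of nonzero entries of $\boldsymbol\alpha$, and $\Xi_\alpha$ is the $s\times\|\boldsymbol\alpha\|_0$ matrix of the columns $\boldsymbol\xi_j$ of $\Xi$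 with $\alpha(j)\ne0$. Vectors $\boldsymbol\nu_\alpha$: let $s<\|\boldsymbol\alpha\|_0\le n$. If $\|\boldsymbol\alpha\|_0=n$, $\boldsymbol\nu_\alpha$ is the first column of $\ker\Xi$. Otherwise let $C_\alpha$ be the $(n-\|\boldsymbol\alpha\|_0)\times(n-s)$ matrix consisting of those rows $j$ of $\ker\Xi$ with $\alpha(j)=0$, let $\boldsymbol t_\alpha$ be the first column of $\ker C_\alpha$, and put $\boldsymbol\nu_\alpha:=(\ker\Xi)\,\boldsymbol t_\alpha$. Put $m_\alpha:=\min\{i:\nu_\alpha(i)\ne0\}$. Sets $P_k$, $0\le k\le n-s$ (of pairs of a real scalar and an $n$-dimensional vector): $P_0:=\{(1,\boldsymbol 1)\}$ and $$P_k:=\Big\{\Big(-c\,\tfrac{\nu_\alpha(j)}{\nu_\alpha(m_\alpha)},\ \boldsymbol r_j(\boldsymbol\alpha)\Big):(c,\boldsymbol\alpha)\in P_{k-1},\ m_\alpha<j\le n,\ \nu_\alpha(j)\ne0\Big\},$$ where $\boldsymbol r_j(\boldsymbol\alpha)$ is obtained from $\boldsymbol\alpha$ by increasing entry $m_\alpha$ by $1$, decreasing entry $j$ by $1$, and leaving the other entries unchanged. For $\|\boldsymbol\alpha\|_0=s$, $\boldsymbol\mu_\alpha$ is the $s$-dimensional vector obtained by retaining the nonzero entries of $\boldsymbol\alpha$. Powers: for $s$-dimensional $\boldsymbol y$ and $\boldsymbol\beta$, $\boldsymbol y^{\boldsymbol\beta}:=\prod_{j=1}^s y(j)^{\beta(j)}$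 and $[\![\boldsymbol y]\!]_+^{\boldsymbol\beta}:=\prod_{j=1}^s\frac{(y(j))_+^{\beta(j)}}{\beta(j)!}$, where $(x)_+^k:=x^kH(x)$ and $H$ is the Heaviside distribution. $\boldsymbol 0$ and $\boldsymbol 1$ are the all-zeros and all-ones vectors.
   Formalization: Corrected: columns of Ξ are assumed nonzero; only the Heaviside factors are evaluated at c_R (factorials kept); p is subtracted before Ξ_α^{-1} is applied; the P_k are multisets. M_Ξ equals P_R on R as a distribution; the center is the centroid. *)

theory Defs
  imports
    "HOL-Probability.Probability"
    "Jordan_Normal_Form.Matrix_Kernel"
begin

text \<open>
  A direction matrix is the list of its columns, vectors of \<open>real ^ 's\<close>.
  All vector and matrix entries, and the columns themselves, are numbered from 0.
  Matrices whose size depends on \<open>n\<close> are of type \<open>real mat\<close>.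
\<close>

no_notation vec_index (infixl \<open>$\<close> 100)
notation vec_index (infixl \<open>$v\<close> 100)


section \<open>Box splines\<close>

text \<open>
  The box spline is a nonnegative distribution of total mass 1, that is, a probability measure;
  \<open>return borel 0\<close> is the Dirac delta, and the measure of \<open>A\<close> under the mixture below is the
  integral over \<open>t\<close> in [0,1] of the measure of \<open>A\<close> under the translate by \<open>t \<xi>\<close>.
\<close>

primrec box_spline :: "(real ^ 's) list \<Rightarrow> (real ^ 's) measure" where
  "box_spline [] = return borel 0"
| "box_spline (\<xi> # \<Xi>) =
     uniform_measure lborel {0..1} \<bind> (\<lambda>t::real. distr (box_spline \<Xi>) borel (\<lambda>x. x + t *\<^sub>R \<xi>))"

definition support_polyhedron :: "(real ^ 's) list \<Rightarrow> (real ^ 's) set" where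
  "support_polyhedron \<Xi> =
     {(\<Sum>j<length \<Xi>. t j *\<^sub>R \<Xi> ! j) | t. \<forall>j<length \<Xi>. 0 \<le> t j \<and> t j \<le> (1::real)}"

definition lattice_points :: "(real ^ 's) list \<Rightarrow> (real ^ 's) set" where
  "lattice_points \<Xi> = {(\<Sum>j<length \<Xi>. real_of_int (z j) *\<^sub>R \<Xi> ! j) | z. True}"

definition hyperplanes :: "(real ^ 's) list \<Rightarrow> (real ^ 's) set set" where
  "hyperplanes \<Xi> =
     {Real_Vector_Spaces.span B | B.
        B \<subseteq> set \<Xi> \<and> Real_Vector_Spaces.dim B = CARD('s) - 1}"

definition mesh :: "(real ^ 's) list \<Rightarrow> (real ^ 's) set" where
  "mesh \<Xi> = (\<Union>H\<in>hyperplanes \<Xi>. {h + v | h v. h \<in> H \<and> v \<in> lattice_points \<Xi>})"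

definition regions :: "(real ^ 's) list \<Rightarrow> (real ^ 's) set set" where
  "regions \<Xi> = components (support_polyhedron \<Xi> - mesh \<Xi>)"

definition center :: "(real ^ 's) set \<Rightarrow> real ^ 's" where
  "center R = integral R (\<lambda>x. x) /\<^sub>R measure lebesgue R"

text \<open>Equality of a measure and a function on \<open>R\<close>, in the sense of distributions.\<close>

definition agrees_on :: "(real ^ 's) measure \<Rightarrow> (real ^ 's \<Rightarrow> real) \<Rightarrow> (real ^ 's) set \<Rightarrow> bool" where
  "agrees_on M f R \<longleftrightarrow> (\<forall>A\<in>sets borel. A \<subseteq> R \<longrightarrow> (f has_integral measure M A) A)"


section \<open>The multiset of differences\<close>

primrec diff_mset :: "(real ^ 's) list \<Rightarrow> (real \<times> (real ^ 's)) multiset" where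
  "diff_mset [] = {#(1, 0)#}"
| "diff_mset (\<xi> # \<Xi>) = image_mset (\<lambda>(c, p). (- c, \<xi> + p)) (diff_mset \<Xi>) + diff_mset \<Xi>"


section \<open>Kernel matrices\<close>

text \<open>The first nonzero entry of each column lies strictly below that of the preceding columns.\<close>

definition column_echelon :: "real mat \<Rightarrow> bool" where
  "column_echelon K \<longleftrightarrow>
     (\<forall>j j' i. j < j' \<and> j' < dim_col K \<and> i < dim_row K \<and> (\<forall>i'<i. K $$ (i', j) = 0)
        \<longrightarrow> K $$ (i, j') = 0)"

definition kernel_matrix :: "real mat \<Rightarrow> real mat \<Rightarrow> bool" where
  "kernel_matrix X K \<longleftrightarrow>
     dim_row K = dim_col X \<and> distinct (cols K) \<and> kernel.basis (dim_col X) X (set (cols K)) \<and>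
     column_echelon K"

text \<open>
  An arbitrary numbering of the coordinate axes; neither null-spaces nor \<open>\<bar>det\<bar>\<close> nor the
  products over coordinates below depend on it.
\<close>

definition axis_index :: "'s::finite \<Rightarrow> nat" where
  "axis_index = (SOME f. bij_betw f UNIV {..<CARD('s)})"

definition dir_mat :: "(real ^ 's) list \<Rightarrow> real mat" where
  "dir_mat \<Xi> = mat CARD('s) (length \<Xi>) (\<lambda>(i, j). \<Xi> ! j $ inv_into UNIV axis_index i)"


section \<open>The exponents\<close>

definition norm0 :: "nat list \<Rightarrow> nat" where
  "norm0 \<alpha> = length (filter (\<lambda>a. a \<noteq> 0) \<alpha>)"

text \<open>The parameter \<open>ker\<close> is the chosen kernel matrix of each matrix.\<close>

definition nu :: "(real mat \<Rightarrow> real mat) \<Rightarrow> (real ^ 's) list \<Rightarrow> nat list \<Rightarrow> real Matrix.vec" where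
  "nu ker \<Xi> \<alpha> =
     (let K = ker (dir_mat \<Xi>) in
      if norm0 \<alpha> = length \<Xi> then col K 0
      else let C = mat_of_rows (dim_col K) [row K j. j \<leftarrow> [0..<length \<Xi>], \<alpha> ! j = 0]
           in K *\<^sub>v col (ker C) 0)"

definition lead :: "real Matrix.vec \<Rightarrow> nat" where
  "lead v = Min {i. i < dim_vec v \<and> v $v i \<noteq> 0}"

text \<open>
  The entry decreased here is never 0, because \<open>nu\<close> vanishes wherever \<open>\<alpha>\<close> does; so the
  truncated subtraction is harmless.
\<close>

definition shift_exponent :: "nat \<Rightarrow> nat \<Rightarrow> nat list \<Rightarrow> nat list" where
  "shift_exponent m j \<alpha> = \<alpha>[m := \<alpha> ! m + 1, j := \<alpha> ! j - 1]"

text \<open>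
  Pairs are counted with multiplicity: different choices of \<open>(c, \<alpha>)\<close> and \<open>j\<close> can yield the
  same pair, for instance for the directions (-1,1), (-1,-1), (1,0), (0,1), and each contributes
  to the decomposition of the Green's function.
\<close>

primrec exponent_mset ::
  "(real mat \<Rightarrow> real mat) \<Rightarrow> (real ^ 's) list \<Rightarrow> nat \<Rightarrow> (real \<times> nat list) multiset" where
  "exponent_mset ker \<Xi> 0 = {#(1, replicate (length \<Xi>) 1)#}"
| "exponent_mset ker \<Xi> (Suc k) =
     (\<Sum>(c, \<alpha>)\<in>#exponent_mset ker \<Xi> k.
        let \<nu> = nu ker \<Xi> \<alpha>; m = lead \<nu> in
        image_mset (\<lambda>j. (- c * (\<nu> $v j / \<nu> $v m), shift_exponent m j \<alpha>))
          (mset_set {j. m < j \<and> j < length \<Xi> \<and> \<nu> $v j \<noteq> 0}))"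

definition nonzero_positions :: "nat list \<Rightarrow> nat list" where
  "nonzero_positions \<alpha> = filter (\<lambda>i. \<alpha> ! i \<noteq> 0) [0..<length \<alpha>]"

text \<open>The next two are meant for \<open>norm0 \<alpha> = CARD('s)\<close>.\<close>

definition sub_matrix :: "(real ^ 's) list \<Rightarrow> nat list \<Rightarrow> real ^ 's ^ 's" where
  "sub_matrix \<Xi> \<alpha> = (\<chi> i j. \<Xi> ! (nonzero_positions \<alpha> ! axis_index j) $ i)"

definition mu :: "nat list \<Rightarrow> nat ^ 's" where
  "mu \<alpha> = (\<chi> j. \<alpha> ! (nonzero_positions \<alpha> ! axis_index j))"


section \<open>Powers and the piecewise polynomial form\<close>

text \<open>The value at 0 is immaterial: the argument is never 0 inside a region.\<close>

definition heaviside :: "real \<Rightarrow> real" where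
  "heaviside x = (if x \<ge> 0 then 1 else 0)"

definition vpower :: "real ^ 's \<Rightarrow> nat ^ 's \<Rightarrow> real" where
  "vpower y \<beta> = (\<Prod>j\<in>UNIV. (y $ j) ^ (\<beta> $ j))"

definition vfact :: "nat ^ 's \<Rightarrow> real" where
  "vfact \<beta> = (\<Prod>j\<in>UNIV. fact (\<beta> $ j))"

definition truncated_power :: "real ^ 's \<Rightarrow> nat ^ 's \<Rightarrow> real" where
  "truncated_power y \<beta> =
     (\<Prod>j\<in>UNIV. ((y $ j) ^ (\<beta> $ j) * heaviside (y $ j)) / fact (\<beta> $ j))"

text \<open>
  The Green's function of a term is \<open>x \<mapsto> truncated_power (\<Xi>\<^sub>\<alpha>\<inverse> (x - p)) (\<mu>\<^sub>\<alpha> - 1)\<close>.  On a region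
  containing \<open>c\<close> its Heaviside factors are constant, so they are evaluated at \<open>c\<close> (truncated power
  of exponent 0), whereas the monomial, with its factorials, stays a function of \<open>x\<close>.  The points
  \<open>p\<close> of \<open>diff_mset\<close> live in the same space as \<open>x\<close> and are subtracted before \<open>\<Xi>\<^sub>\<alpha>\<inverse>\<close> is applied.
\<close>

definition pp_form ::
  "(real mat \<Rightarrow> real mat) \<Rightarrow> (real ^ 's) list \<Rightarrow> real ^ 's \<Rightarrow> real ^ 's \<Rightarrow> real" where
  "pp_form ker \<Xi> c\<^sub>R x =
     (\<Sum>(b, p)\<in>#diff_mset \<Xi>. \<Sum>(c, \<alpha>)\<in>#exponent_mset ker \<Xi> (length \<Xi> - CARD('s)).
        b * c / \<bar>Determinants.det (sub_matrix \<Xi> \<alpha>)\<bar>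
        * truncated_power (matrix_inv (sub_matrix \<Xi> \<alpha>) *v (c\<^sub>R - p)) 0
        * (vpower (matrix_inv (sub_matrix \<Xi> \<alpha>) *v (x - p)) (mu \<alpha> - 1) / vfact (mu \<alpha> - 1 :: nat ^ 's)))"

end

theory Submission
  imports Defs
begin

text \<open>
  The box spline is tested against continuous functions \<open>\<phi>\<close> of bounded support, which turns the
  calculus of distributions into a calculus of operators on functions.  Attached to a direction
  \<open>\<xi>\<close> are the difference \<open>\<phi> x - \<phi> (x + \<xi>)\<close>, the integral of \<open>\<phi>\<close> over the segment from \<open>x\<close> to
  \<open>x + \<xi>\<close>, and its integral over the ray from \<open>x\<close> in direction \<open>\<xi>\<close>; the derivative along \<open>- \<xi>\<close>
  undoes the ray and turns the segment into the difference.  The integral of \<open>\<phi>\<close> with respect to the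
  box spline is the value at 0 of the composition of all segment operators
  (\<open>nn_integral_box_spline\<close>).

  An exponent vector \<open>\<alpha>\<close> prescribes for each direction \<open>\<xi>\<^sub>j\<close> a difference followed by \<open>\<alpha>\<^sub>j\<close> rays, where
  a difference with one ray is a segment.  For their composition \<open>E \<alpha>\<close>, lowering \<open>\<alpha>\<^sub>j\<close> by one is
  differentiation along \<open>- \<xi>\<^sub>j\<close> (\<open>dir_deriv_spline_op\<close>).  Derivatives being additive in the direction,
  a relation \<open>\<Sum> \<nu>\<^sub>j \<xi>\<^sub>j = 0\<close> yields \<open>\<Sum> \<nu>\<^sub>j E (\<beta> - e\<^sub>j) = 0\<close>, and for \<open>\<beta> = \<alpha> + e\<^sub>m\<close> this expresses
  \<open>E \<alpha>\<close> by the vectors that the recursion of \<open>exponent_mset\<close> derives from \<open>\<alpha>\<close>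
  (\<open>spline_op_shift_exponent\<close>).  Hence \<open>\<Sum> c E \<alpha>\<close> over the exponent multiset is the same at all
  levels (\<open>sum_exponent_mset_spline_op\<close>).

  Rays in several directions can be composed only if these directions lie in an open half-space.
  This is where the echelon form enters: \<open>\<nu>\<close> has the smallest possible leading position among all
  relations still available (\<open>nu_props\<close>).  Hence leading positions never decrease, a raised
  exponent is never lowered again, and no relation is supported on the raised positions, so that the
  directions there are linearly independent (\<open>admissible_reduction\<close>).

  After \<open>n - s\<close> steps the support of \<open>\<alpha>\<close> is a basis.  Now all differences can be moved to the
  outside, where they expand into the sum over \<open>diff_mset\<close> (\<open>spline_op_eq_sum_ray_powers\<close>), and the
  rays amount to integration against a truncated power in the coordinates of the basis
  (\<open>has_bochner_integral_green\<close>).  So the double sum of shifted Green functions is a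
  density of the box spline, first weakly and then on all bounded Borel sets
  (\<open>weak_density_has_integral\<close>).

  Finally, a Heaviside factor can jump only on a shifted hyperplane of the mesh, so it is constant on
  a connected region \<open>R\<close>; the centroid of \<open>R\<close> lies on the same side of each such hyperplane, provided
  that \<open>R\<close> has positive volume (\<open>heaviside_center\<close>).  If \<open>R\<close> is a null set, which happens when the
  knot planes are dense, both sides of the claim vanish because the box spline has a density.
\<close>

section \<open>Directional derivatives\<close>

text \<open>
  Continuity of the derivative is part of the definition: it makes differentiability along single
  directions additive in the direction.
\<close>

definition dir_deriv :: "('a::euclidean_space \<Rightarrow> real) \<Rightarrow> 'a \<Rightarrow> ('a \<Rightarrow> real) \<Rightarrow> bool" where
  "dir_deriv u v g \<longleftrightarrow> continuous_on UNIV g \<and>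
     (\<forall>x. ((\<lambda>t. u (x + t *\<^sub>R v)) has_real_derivative g x) (at 0))"

lemma dir_deriv_at:
  assumes "dir_deriv u v g"
  shows "((\<lambda>t. u (x + t *\<^sub>R v)) has_real_derivative g (x + t *\<^sub>R v)) (at t)"
proof -
  have "((\<lambda>s. u ((x + t *\<^sub>R v) + s *\<^sub>R v)) has_real_derivative g (x + t *\<^sub>R v)) (at 0)"
    using assms by (auto simp: dir_deriv_def)
  then have "((\<lambda>s. u (x + (s + t) *\<^sub>R v)) has_real_derivative g (x + t *\<^sub>R v)) (at 0)"
    by (simp add: algebra_simps)
  then show ?thesis
    using DERIV_shift[of "\<lambda>t. u (x + t *\<^sub>R v)" "g (x + t *\<^sub>R v)" 0 t] by simp
qed

lemma dir_deriv_mvt: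
  assumes "dir_deriv u v g"
  obtains \<theta> where "\<bar>\<theta>\<bar> \<le> \<bar>t\<bar>" "u (x + t *\<^sub>R v) - u x = t * g (x + \<theta> *\<^sub>R v)"
proof -
  have d: "((\<lambda>t. u (x + t *\<^sub>R v)) has_real_derivative g (x + s *\<^sub>R v)) (at s)" for s
    by (rule dir_deriv_at[OF assms])
  consider "t = 0" | "0 < t" | "t < 0" by linarith
  then show ?thesis
  proof cases
    case 1 then show ?thesis using that[of 0] by simp
  next
    case 2
    from MVT2[OF this, of "\<lambda>t. u (x + t *\<^sub>R v)" "\<lambda>s. g (x + s *\<^sub>R v)"] d
    obtain z where "0 < z" "z < t" "u (x + t *\<^sub>R v) - u x = t * g (x + z *\<^sub>R v)" by auto
    then show ?thesis using that[of z] by auto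
  next
    case 3
    from MVT2[OF this, of "\<lambda>t. u (x + t *\<^sub>R v)" "\<lambda>s. g (x + s *\<^sub>R v)"] d
    obtain z where "t < z" "z < 0" "u x - u (x + t *\<^sub>R v) = - t * g (x + z *\<^sub>R v)" by auto
    then show ?thesis using that[of z] by auto
  qed
qed

lemma dir_deriv_zero: "dir_deriv u 0 (\<lambda>x. 0)"
  by (auto simp: dir_deriv_def)

lemma dir_deriv_unique:
  assumes "dir_deriv u v g" "dir_deriv u v h" shows "g x = h x"
  using assms unfolding dir_deriv_def by (metis DERIV_unique)

lemma dir_deriv_scaleR:
  assumes "dir_deriv u v g" shows "dir_deriv u (c *\<^sub>R v) (\<lambda>x. c * g x)"
  unfolding dir_deriv_def
proof safe
  show "continuous_on UNIV (\<lambda>x. c * g x)"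
    using assms by (auto simp: dir_deriv_def intro!: continuous_intros)
  fix x
  have "((\<lambda>t. u (x + t *\<^sub>R v)) has_real_derivative g x) (at (c * 0))"
    using assms by (auto simp: dir_deriv_def)
  moreover have "((\<lambda>t. c * t) has_real_derivative c) (at 0)"
    by (auto intro!: derivative_eq_intros)
  ultimately have "((\<lambda>t. u (x + (c * t) *\<^sub>R v)) has_real_derivative g x * c) (at 0)"
    by (rule DERIV_chain2)
  then show "((\<lambda>t. u (x + t *\<^sub>R c *\<^sub>R v)) has_real_derivative c * g x) (at 0)"
    by (simp add: mult.commute)
qed

text \<open>
  The increment along \<open>v + w\<close> is an increment along \<open>v\<close> followed by one along \<open>w\<close> from a moved base
  point; the mean value theorem and continuity of \<open>h\<close> control the latter.
\<close>

lemma dir_deriv_add: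
  assumes v: "dir_deriv u v g" and w: "dir_deriv u w h"
  shows "dir_deriv u (v + w) (\<lambda>x. g x + h x)"
  unfolding dir_deriv_def
proof safe
  have cg: "continuous_on UNIV g" and ch: "continuous_on UNIV h"
    using v w by (auto simp: dir_deriv_def)
  then show "continuous_on UNIV (\<lambda>x. g x + h x)" by (intro continuous_intros)
  fix x
  have "\<exists>\<theta>. \<forall>t. \<bar>\<theta> t\<bar> \<le> \<bar>t\<bar> \<and>
      u (x + t *\<^sub>R v + t *\<^sub>R w) - u (x + t *\<^sub>R v) = t * h (x + t *\<^sub>R v + \<theta> t *\<^sub>R w)"
    by (intro choice allI) (meson dir_deriv_mvt[OF w])
  then obtain \<theta> where \<theta>: "\<And>t. \<bar>\<theta> t\<bar> \<le> \<bar>t\<bar>"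
    and eq: "\<And>t. u (x + t *\<^sub>R v + t *\<^sub>R w) - u (x + t *\<^sub>R v) = t * h (x + t *\<^sub>R v + \<theta> t *\<^sub>R w)"
    by blast
  have "(\<theta> \<longlongrightarrow> 0) (at 0)"
    by (rule Lim_null_comparison[where g = "\<lambda>t. \<bar>t\<bar>"]) (use \<theta> in \<open>auto intro!: tendsto_eq_intros\<close>)
  then have "((\<lambda>t. x + t *\<^sub>R v + \<theta> t *\<^sub>R w) \<longlongrightarrow> x) (at 0)"
    by (auto intro!: tendsto_eq_intros)
  then have lim1: "((\<lambda>t. h (x + t *\<^sub>R v + \<theta> t *\<^sub>R w)) \<longlongrightarrow> h x) (at 0)"
    by (rule isCont_tendsto_compose[rotated]) (use ch in \<open>simp add: continuous_on_eq_continuous_at\<close>)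
  have lim2: "((\<lambda>t. (u (x + t *\<^sub>R v) - u x) / t) \<longlongrightarrow> g x) (at 0)"
    using v by (auto simp: dir_deriv_def DERIV_def)
  have "((\<lambda>t. (u (x + t *\<^sub>R v) - u x) / t + h (x + t *\<^sub>R v + \<theta> t *\<^sub>R w)) \<longlongrightarrow> g x + h x) (at 0)"
    by (rule tendsto_add[OF lim2 lim1])
  moreover have "\<forall>\<^sub>F t in at 0. (u (x + t *\<^sub>R v) - u x) / t + h (x + t *\<^sub>R v + \<theta> t *\<^sub>R w)
       = (u (x + t *\<^sub>R (v + w)) - u x) / t"
  proof (rule eventually_at_filter[THEN iffD2], rule always_eventually, safe)
    fix t :: real assume "t \<noteq> 0"
    then have "h (x + t *\<^sub>R v + \<theta> t *\<^sub>R w) = (u (x + t *\<^sub>R v + t *\<^sub>R w) - u (x + t *\<^sub>R v)) / t"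
      using eq[of t] by simp
    then show "(u (x + t *\<^sub>R v) - u x) / t + h (x + t *\<^sub>R v + \<theta> t *\<^sub>R w)
       = (u (x + t *\<^sub>R (v + w)) - u x) / t"
      by (simp add: scaleR_add_right add.assoc flip: add_divide_distrib)
  qed
  ultimately have "((\<lambda>t. (u (x + t *\<^sub>R (v + w)) - u x) / t) \<longlongrightarrow> g x + h x) (at 0)"
    by (rule Lim_transform_eventually)
  then show "((\<lambda>t. u (x + t *\<^sub>R (v + w))) has_real_derivative g x + h x) (at 0)"
    by (simp add: DERIV_def)
qed

lemma dir_deriv_sum:
  assumes "finite J" "\<And>j. j \<in> J \<Longrightarrow> c j \<noteq> 0 \<Longrightarrow> dir_deriv u (v j) (g j)"
  shows "dir_deriv u (\<Sum>j\<in>J. c j *\<^sub>R v j) (\<lambda>x. \<Sum>j\<in>J. c j * g j x)"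
  using assms
proof (induction J)
  case empty
  then show ?case by (simp add: dir_deriv_zero)
next
  case (insert i J)
  have "dir_deriv u (c i *\<^sub>R v i) (\<lambda>x. c i * g i x)"
    using insert.prems[of i] by (cases "c i = 0") (auto simp: dir_deriv_zero intro: dir_deriv_scaleR)
  from dir_deriv_add[OF this insert.IH] insert show ?case by simp
qed

section \<open>Differences, segments and rays\<close>

definition diff_op :: "'a::euclidean_space \<Rightarrow> ('a \<Rightarrow> real) \<Rightarrow> 'a \<Rightarrow> real" where
  "diff_op \<xi> \<phi> x = \<phi> x - \<phi> (x + \<xi>)"

definition seg_op :: "real \<Rightarrow> 'a::euclidean_space \<Rightarrow> ('a \<Rightarrow> real) \<Rightarrow> 'a \<Rightarrow> real" where
  "seg_op L \<xi> \<phi> x = integral {0..L} (\<lambda>t. \<phi> (x + t *\<^sub>R \<xi>))"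

definition ray_op :: "'a::euclidean_space \<Rightarrow> ('a \<Rightarrow> real) \<Rightarrow> 'a \<Rightarrow> real" where
  "ray_op \<xi> \<phi> x = integral {0..} (\<lambda>t. \<phi> (x + t *\<^sub>R \<xi>))"

lemma integrable_on_line:
  fixes \<phi> :: "'a::euclidean_space \<Rightarrow> real"
  assumes "continuous_on UNIV \<phi>"
  shows "(\<lambda>t. \<phi> (x + t *\<^sub>R \<xi>)) integrable_on {a..b}"
  by (intro integrable_continuous_interval continuous_on_compose2[OF assms] continuous_intros) auto

lemma continuous_seg_op:
  assumes "continuous_on UNIV \<phi>" shows "continuous_on UNIV (seg_op L \<xi> \<phi>)"
proof -
  have "continuous_on UNIV (\<lambda>x. integral (cbox 0 L) (\<lambda>t. \<phi> (x + t *\<^sub>R \<xi>)))"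
    unfolding split_beta
    by (rule integral_continuous_on_param)
      (auto simp: split_beta intro!: continuous_on_compose2[OF assms] continuous_intros)
  then show ?thesis by (simp add: seg_op_def[abs_def])
qed

lemma dir_deriv_seg_op:
  assumes u: "dir_deriv u v g" and cu: "continuous_on UNIV u"
  shows "dir_deriv (seg_op L \<xi> u) v (seg_op L \<xi> g)"
  unfolding dir_deriv_def
proof safe
  have cg: "continuous_on UNIV g" using u by (auto simp: dir_deriv_def)
  then show "continuous_on UNIV (seg_op L \<xi> g)" by (rule continuous_seg_op)
  fix x
  have "((\<lambda>s. integral (cbox 0 L) (\<lambda>t. u (x + t *\<^sub>R \<xi> + s *\<^sub>R v))) has_field_derivative
     integral (cbox 0 L) (\<lambda>t. g (x + t *\<^sub>R \<xi> + 0 *\<^sub>R v))) (at 0 within UNIV)"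
  proof (rule leibniz_rule_field_derivative[where fx = "\<lambda>s t. g (x + t *\<^sub>R \<xi> + s *\<^sub>R v)"])
    fix s t
    show "((\<lambda>s. u (x + t *\<^sub>R \<xi> + s *\<^sub>R v)) has_real_derivative g (x + t *\<^sub>R \<xi> + s *\<^sub>R v)) (at s within UNIV)"
      using dir_deriv_at[OF u] by simp
  next
    fix s show "(\<lambda>t. u (x + t *\<^sub>R \<xi> + s *\<^sub>R v)) integrable_on cbox 0 L"
      by (intro integrable_continuous continuous_on_compose2[OF cu] continuous_intros) auto
  qed (auto simp: split_beta intro!: continuous_on_compose2[OF cg] continuous_intros)
  then show "((\<lambda>t. seg_op L \<xi> u (x + t *\<^sub>R v)) has_real_derivative seg_op L \<xi> g x) (at 0)"
    by (simp add: seg_op_def add.commute add.left_commute)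
qed

text \<open>
  Moving \<open>x\<close> along \<open>\<xi>\<close> moves both end points of the interval of integration of a single function.
\<close>

lemma dir_deriv_seg_op_self:
  assumes c: "continuous_on UNIV \<phi>" and L: "L \<ge> 0"
  shows "dir_deriv (seg_op L \<xi> \<phi>) \<xi> (\<lambda>x. \<phi> (x + L *\<^sub>R \<xi>) - \<phi> x)"
  unfolding dir_deriv_def
proof safe
  show "continuous_on UNIV (\<lambda>x. \<phi> (x + L *\<^sub>R \<xi>) - \<phi> x)"
    by (intro continuous_intros continuous_on_compose2[OF c]) auto
  fix x
  define f where "f t = \<phi> (x + t *\<^sub>R \<xi>)" for t
  have cf: "continuous_on A f" for A
    unfolding f_def by (intro continuous_on_compose2[OF c] continuous_intros) auto
  have int: "f integrable_on {a..b}" for a b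
    by (rule integrable_continuous_interval[OF cf])
  define F where "F s = integral {-1..s} f" for s
  have F: "(F has_real_derivative f s) (at s)" if "s > -1" for s
  proof -
    have "(F has_real_derivative f s) (at s within {-1..s+1})"
      unfolding F_def by (rule integral_has_real_derivative[OF cf]) (use that in auto)
    then show ?thesis using that by (simp add: at_within_Icc_at)
  qed
  have "((\<lambda>s. F (L + s) - F s) has_real_derivative f L - f 0) (at 0)"
    using F[of L] F[of 0] L
    by (auto intro!: derivative_eq_intros DERIV_chain2[where f = F] simp: )
  moreover have "\<forall>\<^sub>F s in nhds 0. F (L + s) - F s = seg_op L \<xi> \<phi> (x + s *\<^sub>R \<xi>)"
  proof -
    have "\<forall>\<^sub>F s in nhds (0::real). s > -1" by (rule order_tendstoD(1)[OF filterlim_ident]) auto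
    then show ?thesis
    proof eventually_elim
      case (elim s)
      have "F s + integral {s..L+s} f = F (L + s)"
        unfolding F_def by (rule Henstock_Kurzweil_Integration.integral_combine) (use elim L int in auto)
      moreover have "integral {0..L} (f \<circ> (\<lambda>t. t + s)) = integral {0+s..L+s} f"
        by (rule integral_shift[OF cf])
      ultimately show ?case by (simp add: seg_op_def f_def o_def algebra_simps)
    qed
  qed
  ultimately have "((\<lambda>s. seg_op L \<xi> \<phi> (x + s *\<^sub>R \<xi>)) has_real_derivative f L - f 0) (at 0)"
    by (subst (asm) DERIV_cong_ev[OF refl _ refl])
  then show "((\<lambda>t. seg_op L \<xi> \<phi> (x + t *\<^sub>R \<xi>)) has_real_derivative \<phi> (x + L *\<^sub>R \<xi>) - \<phi> x) (at 0)"
    by (simp add: f_def)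
qed

text \<open>
  The class of test functions that rays preserve: after integration along a ray in direction \<open>\<xi>\<close>
  the support is unbounded in direction \<open>- \<xi>\<close>, but still bounded above in terms of any linear \<open>l\<close> with
  \<open>l \<xi> > 0\<close>.
\<close>

definition vanishes_above :: "('a::euclidean_space \<Rightarrow> real) \<Rightarrow> ('a \<Rightarrow> real) \<Rightarrow> bool" where
  "vanishes_above l \<phi> \<longleftrightarrow> continuous_on UNIV \<phi> \<and> (\<exists>C. \<forall>x. l x > C \<longrightarrow> \<phi> x = 0)"

lemma vanishes_aboveD: "vanishes_above l \<phi> \<Longrightarrow> continuous_on UNIV \<phi>"
  by (simp add: vanishes_above_def)

lemma has_integral_ray:
  assumes l: "linear l" "l \<xi> > 0" and c: "continuous_on UNIV \<phi>" and C: "\<And>x. l x > C \<Longrightarrow> \<phi> x = 0"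
    and L: "L \<ge> (C - l x) / l \<xi>"
  shows "((\<lambda>t. \<phi> (x + t *\<^sub>R \<xi>)) has_integral seg_op L \<xi> \<phi> x) {0..}"
proof -
  have z: "\<phi> (x + t *\<^sub>R \<xi>) = 0" if "t > L" for t
  proof (rule C)
    have "t * l \<xi> > ((C - l x) / l \<xi>) * l \<xi>" using that L l by (intro mult_strict_right_mono) auto
    then show "l (x + t *\<^sub>R \<xi>) > C" using l by (simp add: linear_add linear_scale)
  qed
  have "((\<lambda>t. \<phi> (x + t *\<^sub>R \<xi>)) has_integral seg_op L \<xi> \<phi> x) {0..L}"
    unfolding seg_op_def by (rule integrable_integral[OF integrable_on_line[OF c]])
  then have "((\<lambda>t. if t \<in> {0..L} then \<phi> (x + t *\<^sub>R \<xi>) else 0) has_integral seg_op L \<xi> \<phi> x) {0..}"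
    by (subst has_integral_restrict) auto
  then show ?thesis
    by (rule has_integral_eq[rotated]) (use z in auto)
qed

lemma ray_op_eq_seg_op:
  assumes l: "linear l" "l \<xi> > 0" and c: "continuous_on UNIV \<phi>" and C: "\<And>x. l x > C \<Longrightarrow> \<phi> x = 0"
    and L: "L \<ge> (C - l x) / l \<xi>"
  shows "ray_op \<xi> \<phi> x = seg_op L \<xi> \<phi> x"
  unfolding ray_op_def by (rule integral_unique[OF has_integral_ray[OF assms]])

text \<open>
  Near a point a ray may be cut off at a fixed length, so that continuity and differentiability of ray
  integrals are inherited from segments.
\<close>

lemma ray_op_local:
  assumes l: "linear l" "l \<xi> > 0" and u: "vanishes_above l u" and g: "vanishes_above l g"
  obtains L S where "open S" "x \<in> S" "L \<ge> 0" "\<And>y. y \<in> S \<Longrightarrow> ray_op \<xi> u y = seg_op L \<xi> u y"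
    "\<And>y. y \<in> S \<Longrightarrow> ray_op \<xi> g y = seg_op L \<xi> g y" "\<And>y. y \<in> S \<Longrightarrow> u (y + L *\<^sub>R \<xi>) = 0"
proof -
  from u obtain C1 where C1: "\<And>x. l x > C1 \<Longrightarrow> u x = 0" by (auto simp: vanishes_above_def)
  from g obtain C2 where C2: "\<And>x. l x > C2 \<Longrightarrow> g x = 0" by (auto simp: vanishes_above_def)
  define S where "S = {y. l y > l x - 1}"
  define C where "C = max C1 C2"
  define L where "L = max 0 ((C - l x + 1) / l \<xi>)"
  have "continuous_on UNIV l" using l by (simp add: linear_continuous_on linear_conv_bounded_linear)
  then have "open S" unfolding S_def by (intro open_Collect_less continuous_intros)
  have *: "L \<ge> (C - l y) / l \<xi>" if "y \<in> S" for y
  proof -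
    have "(C - l y) / l \<xi> \<le> (C - l x + 1) / l \<xi>"
      using that l by (intro divide_right_mono) (auto simp: S_def)
    then show ?thesis by (simp add: L_def)
  qed
  show ?thesis
  proof (rule that[of S L])
    show "ray_op \<xi> u y = seg_op L \<xi> u y" if "y \<in> S" for y
      by (rule ray_op_eq_seg_op[where l = l and C = C]) (use l u C1 *[OF that] in \<open>auto simp: vanishes_above_def C_def\<close>)
    show "ray_op \<xi> g y = seg_op L \<xi> g y" if "y \<in> S" for y
      by (rule ray_op_eq_seg_op[where l = l and C = C]) (use l g C2 *[OF that] in \<open>auto simp: vanishes_above_def C_def\<close>)
    show "u (y + L *\<^sub>R \<xi>) = 0" if "y \<in> S" for y
    proof (rule C1)
      have "C - l x + 1 \<le> L * l \<xi>" using l by (simp add: L_def max_def field_simps)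
      then show "l (y + L *\<^sub>R \<xi>) > C1" using that l by (simp add: linear_add linear_scale S_def C_def)
    qed
  qed (use \<open>open S\<close> in \<open>auto simp: S_def L_def\<close>)
qed

lemma continuous_ray_op:
  assumes l: "linear l" "l \<xi> > 0" and u: "vanishes_above l u"
  shows "continuous_on UNIV (ray_op \<xi> u)"
proof -
  have "isCont (ray_op \<xi> u) x" for x
  proof -
    obtain L S where S: "open S" "x \<in> S" "\<And>y. y \<in> S \<Longrightarrow> ray_op \<xi> u y = seg_op L \<xi> u y"
      using ray_op_local[OF l u u] by metis
    have "isCont (seg_op L \<xi> u) x"
      using continuous_seg_op[OF vanishes_aboveD[OF u]] by (simp add: continuous_on_eq_continuous_at)
    moreover have "\<forall>\<^sub>F y in nhds x. ray_op \<xi> u y = seg_op L \<xi> u y"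
      using S by (auto simp: eventually_nhds)
    ultimately show ?thesis by (subst isCont_cong)
  qed
  then show ?thesis by (simp add: continuous_on_eq_continuous_at)
qed

lemma dir_deriv_cong_local:
  assumes "continuous_on UNIV h"
  and "\<And>x. \<exists>u' g' S. open S \<and> x \<in> S \<and> (\<forall>y\<in>S. u y = u' y) \<and> h x = g' x \<and> dir_deriv u' v g'"
  shows "dir_deriv u v h"
  unfolding dir_deriv_def
proof safe
  fix x
  obtain u' g' S where S: "open S" "x \<in> S" "\<And>y. y\<in>S \<Longrightarrow> u y = u' y" "h x = g' x" "dir_deriv u' v g'"
    using assms(2)[of x] by blast
  have "((\<lambda>t. x + t *\<^sub>R v) \<longlongrightarrow> x) (nhds 0)"
    by (rule tendsto_eq_intros refl filterlim_ident| simp)+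
  then have "\<forall>\<^sub>F t in nhds 0. x + t *\<^sub>R v \<in> S"
    using S(1,2) by (rule topological_tendstoD)
  then have ev: "\<forall>\<^sub>F t in nhds 0. u (x + t *\<^sub>R v) = u' (x + t *\<^sub>R v)"
    by eventually_elim (rule S)
  show "((\<lambda>t. u (x + t *\<^sub>R v)) has_real_derivative h x) (at 0)"
    using DERIV_cong_ev[OF refl ev refl] S by (auto simp: dir_deriv_def)
qed fact

lemma dir_deriv_ray_op:
  assumes l: "linear l" "l \<xi> > 0" and u: "vanishes_above l u" and g: "vanishes_above l g"
    and d: "dir_deriv u v g"
  shows "dir_deriv (ray_op \<xi> u) v (ray_op \<xi> g)"
proof (rule dir_deriv_cong_local)
  show "continuous_on UNIV (ray_op \<xi> g)" by (rule continuous_ray_op[OF l g])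
  fix x
  obtain L S where S: "open S" "x \<in> S" "\<And>y. y \<in> S \<Longrightarrow> ray_op \<xi> u y = seg_op L \<xi> u y"
    "\<And>y. y \<in> S \<Longrightarrow> ray_op \<xi> g y = seg_op L \<xi> g y"
    using ray_op_local[OF l u g] by metis
  then show "\<exists>u' g' S. open S \<and> x \<in> S \<and> (\<forall>y\<in>S. ray_op \<xi> u y = u' y) \<and> ray_op \<xi> g x = g' x \<and> dir_deriv u' v g'"
    using dir_deriv_seg_op[OF d vanishes_aboveD[OF u], of L \<xi>] by blast
qed

lemma dir_deriv_ray_op_self:
  assumes l: "linear l" "l \<xi> > 0" and u: "vanishes_above l u"
  shows "dir_deriv (ray_op \<xi> u) \<xi> (\<lambda>x. - u x)"
proof (rule dir_deriv_cong_local)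
  show "continuous_on UNIV (\<lambda>x. - u x)" using u by (auto simp: vanishes_above_def intro!: continuous_intros)
  fix x
  obtain L S where S: "open S" "x \<in> S" "L \<ge> 0" "\<And>y. y \<in> S \<Longrightarrow> ray_op \<xi> u y = seg_op L \<xi> u y"
    "\<And>y. y \<in> S \<Longrightarrow> u (y + L *\<^sub>R \<xi>) = 0"
    using ray_op_local[OF l u u] by metis
  then show "\<exists>u' g' S. open S \<and> x \<in> S \<and> (\<forall>y\<in>S. ray_op \<xi> u y = u' y) \<and> - u x = g' x \<and> dir_deriv u' \<xi> g'"
    using dir_deriv_seg_op_self[OF vanishes_aboveD[OF u] S(3), of \<xi>] 
    by (intro exI[of _ "seg_op L \<xi> u"] exI[of _ "\<lambda>x. u (x + L *\<^sub>R \<xi>) - u x"] exI[of _ S]) auto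
qed

lemma vanishes_above_diff_op:
  assumes l: "linear l" and "vanishes_above l u"
  shows "vanishes_above l (diff_op \<xi> u)"
proof -
  from assms obtain C where C: "\<And>x. l x > C \<Longrightarrow> u x = 0" and c: "continuous_on UNIV u"
    by (auto simp: vanishes_above_def)
  have "continuous_on UNIV (diff_op \<xi> u)" unfolding diff_op_def[abs_def]
    by (intro continuous_intros continuous_on_compose2[OF c]) auto
  moreover have "diff_op \<xi> u x = 0" if "l x > max C (C - l \<xi>)" for x
    using that C[of x] C[of "x + \<xi>"] l by (auto simp: diff_op_def linear_add)
  ultimately show ?thesis unfolding vanishes_above_def by blast
qed

lemma vanishes_above_seg_op:
  assumes l: "linear l" and "vanishes_above l u"
  shows "vanishes_above l (seg_op L \<xi> u)"
proof -
  from assms obtain C where C: "\<And>x. l x > C \<Longrightarrow> u x = 0" and c: "continuous_on UNIV u"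
    by (auto simp: vanishes_above_def)
  have "seg_op L \<xi> u x = 0" if "l x > C + \<bar>L\<bar> * \<bar>l \<xi>\<bar>" for x
  proof -
    have "u (x + t *\<^sub>R \<xi>) = 0" if "t \<in> {0..L}" for t
    proof (rule C)
      have "\<bar>t\<bar> * \<bar>l \<xi>\<bar> \<le> \<bar>L\<bar> * \<bar>l \<xi>\<bar>" using that by (intro mult_right_mono) auto
      then have "t * l \<xi> \<ge> - (\<bar>L\<bar> * \<bar>l \<xi>\<bar>)" using abs_ge_minus_self[of "t * l \<xi>"] by (simp add: abs_mult)
      then show "C < l (x + t *\<^sub>R \<xi>)" using \<open>l x > _\<close> l by (simp add: linear_add linear_scale)
    qed
    then have "integral {0..L} (\<lambda>t. u (x + t *\<^sub>R \<xi>)) = integral {0..L} (\<lambda>t. 0)"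
      by (intro integral_cong)
    then show ?thesis by (simp add: seg_op_def)
  qed
  then show ?thesis using continuous_seg_op[OF c] unfolding vanishes_above_def by blast
qed

lemma vanishes_above_ray_op:
  assumes l: "linear l" "l \<xi> > 0" and u: "vanishes_above l u"
  shows "vanishes_above l (ray_op \<xi> u)"
proof -
  from u obtain C where C: "\<And>x. l x > C \<Longrightarrow> u x = 0" and c: "continuous_on UNIV u"
    by (auto simp: vanishes_above_def)
  have "ray_op \<xi> u x = 0" if "l x > C" for x
  proof -
    have "u (x + t *\<^sub>R \<xi>) = 0" if "t \<in> {0..}" for t
    proof (rule C)
      have "0 \<le> t * l \<xi>" using that l by simp
      then show "C < l (x + t *\<^sub>R \<xi>)" using \<open>l x > C\<close> l by (simp add: linear_add linear_scale)
    qed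
    then have "integral {0..} (\<lambda>t. u (x + t *\<^sub>R \<xi>)) = integral {0::real..} (\<lambda>t. 0)"
      by (intro integral_cong)
    then show ?thesis by (simp add: ray_op_def)
  qed
  then show ?thesis using continuous_ray_op[OF l u] unfolding vanishes_above_def by blast
qed

lemma dir_deriv_diff_op:
  assumes "dir_deriv u v g" shows "dir_deriv (diff_op \<xi> u) v (diff_op \<xi> g)"
  unfolding dir_deriv_def
proof safe
  have cg: "continuous_on UNIV g" using assms by (auto simp: dir_deriv_def)
  show "continuous_on UNIV (diff_op \<xi> g)" unfolding diff_op_def[abs_def]
    by (intro continuous_intros continuous_on_compose2[OF cg]) auto
  fix x
  have "((\<lambda>t. u (x + t *\<^sub>R v) - u (x + \<xi> + t *\<^sub>R v)) has_real_derivative g x - g (x + \<xi>)) (at 0)"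
    using assms by (intro DERIV_diff) (auto simp: dir_deriv_def)
  then show "((\<lambda>t. diff_op \<xi> u (x + t *\<^sub>R v)) has_real_derivative diff_op \<xi> g x) (at 0)"
    by (simp add: diff_op_def algebra_simps)
qed

lemma dir_deriv_box_op:
  assumes "continuous_on UNIV u" shows "dir_deriv (seg_op 1 \<xi> u) \<xi> (\<lambda>x. - diff_op \<xi> u x)"
  using dir_deriv_seg_op_self[OF assms, of 1 \<xi>] by (simp add: diff_op_def)

section \<open>Composite operators and syzygies\<close>

text \<open>
  Formally this is a difference followed by \<open>a\<close> rays.  For \<open>a = 1\<close> it is the segment integral, which
  needs no half-space condition on \<open>\<xi>\<close>, and the other rays are applied to that.
\<close>

definition factor_op :: "'a::euclidean_space \<Rightarrow> nat \<Rightarrow> ('a \<Rightarrow> real) \<Rightarrow> 'a \<Rightarrow> real" where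
  "factor_op \<xi> a = (if a = 0 then diff_op \<xi> else (ray_op \<xi> ^^ (a - 1)) \<circ> seg_op 1 \<xi>)"

primrec spline_op :: "'a::euclidean_space list \<Rightarrow> nat list \<Rightarrow> ('a \<Rightarrow> real) \<Rightarrow> 'a \<Rightarrow> real" where
  "spline_op [] \<alpha> \<phi> = \<phi>"
| "spline_op (\<xi> # \<Xi>) \<alpha> \<phi> = factor_op \<xi> (hd \<alpha>) (spline_op \<Xi> (tl \<alpha>) \<phi>)"

text \<open>
  Exactly the factors with exponent at least 2 contain genuine rays; \<open>l\<close> witnesses that their
  directions lie in an open half-space.
\<close>

definition admissible :: "('a::euclidean_space \<Rightarrow> real) \<Rightarrow> 'a list \<Rightarrow> nat list \<Rightarrow> bool" where
  "admissible l \<Xi> \<alpha> \<longleftrightarrow> linear l \<and> length \<alpha> = length \<Xi> \<and> (\<forall>i<length \<Xi>. 2 \<le> \<alpha> ! i \<longrightarrow> 0 < l (\<Xi> ! i))"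

lemma vanishes_above_ray_funpow:
  assumes "linear l" "k > 0 \<Longrightarrow> l \<xi> > 0" "vanishes_above l u"
  shows "vanishes_above l ((ray_op \<xi> ^^ k) u)"
  using assms by (induction k) (auto intro: vanishes_above_ray_op)

lemma vanishes_above_factor_op:
  assumes "linear l" "2 \<le> a \<Longrightarrow> l \<xi> > 0" "vanishes_above l u"
  shows "vanishes_above l (factor_op \<xi> a u)"
  using assms by (auto simp: factor_op_def intro!: vanishes_above_diff_op vanishes_above_ray_funpow vanishes_above_seg_op)

lemma dir_deriv_ray_funpow:
  assumes "linear l" "k > 0 \<Longrightarrow> l \<xi> > 0" "vanishes_above l u" "vanishes_above l g" "dir_deriv u v g"
  shows "dir_deriv ((ray_op \<xi> ^^ k) u) v ((ray_op \<xi> ^^ k) g)"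
  using assms
proof (induction k)
  case (Suc k)
  show ?case
    using Suc by (auto intro!: dir_deriv_ray_op[of l] vanishes_above_ray_funpow)
qed simp

lemma dir_deriv_factor_op:
  assumes "linear l" "2 \<le> a \<Longrightarrow> l \<xi> > 0" "vanishes_above l u" "vanishes_above l g" "dir_deriv u v g"
  shows "dir_deriv (factor_op \<xi> a u) v (factor_op \<xi> a g)"
  using assms
  by (auto simp: factor_op_def intro!: dir_deriv_diff_op dir_deriv_ray_funpow[of l] vanishes_above_seg_op
      dir_deriv_seg_op vanishes_aboveD)

text \<open>
  Differentiation along \<open>- \<xi>\<close> removes the outermost ray; if there is none, it turns the segment into
  the difference.
\<close>

lemma dir_deriv_factor_op_self:
  assumes "linear l" "2 \<le> a \<Longrightarrow> l \<xi> > 0" "vanishes_above l u" "a \<ge> 1"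
  shows "dir_deriv (factor_op \<xi> a u) (- \<xi>) (factor_op \<xi> (a - 1) u)"
proof -
  have "dir_deriv (factor_op \<xi> a u) \<xi> (\<lambda>x. - factor_op \<xi> (a - 1) u x)"
  proof (cases "a = 1")
    case True
    then show ?thesis using assms by (simp add: factor_op_def dir_deriv_box_op vanishes_aboveD)
  next
    case False
    define k where "k = a - 2"
    have a: "a = Suc (Suc k)" using False assms(4) by (simp add: k_def)
    show ?thesis unfolding a using assms a
      by (auto simp: factor_op_def intro!: dir_deriv_ray_op_self[of l] vanishes_above_ray_funpow vanishes_above_seg_op)
  qed
  from dir_deriv_scaleR[OF this, of "-1"] show ?thesis by simp
qed

lemma admissible_Cons:
  "admissible l (\<xi> # \<Xi>) (a # \<alpha>) \<longleftrightarrow> (2 \<le> a \<longrightarrow> 0 < l \<xi>) \<and> admissible l \<Xi> \<alpha>"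
  by (simp add: admissible_def All_less_Suc2) blast

lemma vanishes_above_spline_op:
  assumes "admissible l \<Xi> \<alpha>" "vanishes_above l \<phi>"
  shows "vanishes_above l (spline_op \<Xi> \<alpha> \<phi>)"
  using assms
proof (induction \<Xi> arbitrary: \<alpha>)
  case (Cons \<xi> \<Xi>)
  then obtain a \<alpha>' where \<alpha>: "\<alpha> = a # \<alpha>'" by (cases \<alpha>) (auto simp: admissible_def)
  from Cons.prems have "2 \<le> a \<Longrightarrow> l \<xi> > 0" "admissible l \<Xi> \<alpha>'"
    by (simp_all add: \<alpha> admissible_Cons)
  moreover then have "linear l" by (simp add: admissible_def)
  ultimately show ?case using Cons by (simp add: \<alpha> vanishes_above_factor_op)
qed simp

lemma admissible_decrease:
  "admissible l \<Xi> \<alpha> \<Longrightarrow> admissible l \<Xi> (\<alpha>[j := \<alpha> ! j - 1])"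
  by (cases "j < length \<alpha>") (auto simp: admissible_def nth_list_update split: if_splits)

text \<open>
  Only the factor of \<open>\<Xi> ! j\<close> is affected, because the outer factors commute with differentiation.
\<close>

lemma dir_deriv_spline_op:
  assumes "admissible l \<Xi> \<alpha>" "vanishes_above l \<phi>" "j < length \<Xi>" "\<alpha> ! j \<ge> 1"
  shows "dir_deriv (spline_op \<Xi> \<alpha> \<phi>) (- (\<Xi> ! j)) (spline_op \<Xi> (\<alpha>[j := \<alpha> ! j - 1]) \<phi>)"
  using assms
proof (induction \<Xi> arbitrary: \<alpha> j)
  case (Cons \<xi> \<Xi>)
  then obtain a \<alpha>' where \<alpha>: "\<alpha> = a # \<alpha>'" by (cases \<alpha>) (auto simp: admissible_def)
  from Cons.prems have l: "linear l" "2 \<le> a \<Longrightarrow> l \<xi> > 0" "admissible l \<Xi> \<alpha>'"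
    using admissible_def[of l] by (simp_all add: \<alpha> admissible_Cons)
  show ?case
  proof (cases j)
    case 0
    then show ?thesis
      using dir_deriv_factor_op_self[OF l(1,2) vanishes_above_spline_op[OF l(3) Cons.prems(2)]] Cons.prems
      by (simp add: \<alpha>)
  next
    case (Suc i)
    have "dir_deriv (spline_op \<Xi> \<alpha>' \<phi>) (- (\<Xi> ! i)) (spline_op \<Xi> (\<alpha>'[i := \<alpha>' ! i - 1]) \<phi>)"
      using Cons.prems by (intro Cons.IH l) (auto simp: \<alpha> Suc)
    then show ?thesis
      using dir_deriv_factor_op[OF l(1,2) vanishes_above_spline_op vanishes_above_spline_op]
        admissible_decrease[OF l(3)] l(3) Cons.prems(2)
      by (simp add: \<alpha> Suc)
  qed
qed simp

text \<open>
  The sum is the derivative along \<open>\<Sum> \<nu>\<^sub>j (- \<xi>\<^sub>j) = 0\<close>.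
\<close>

lemma spline_op_relation:
  assumes "admissible l \<Xi> \<beta>" "vanishes_above l \<phi>"
    and "(\<Sum>j<length \<Xi>. \<nu> j *\<^sub>R \<Xi> ! j) = 0"
    and "\<And>j. j < length \<Xi> \<Longrightarrow> \<nu> j \<noteq> 0 \<Longrightarrow> \<beta> ! j \<ge> 1"
  shows "(\<Sum>j<length \<Xi>. \<nu> j * spline_op \<Xi> (\<beta>[j := \<beta> ! j - 1]) \<phi> x) = 0"
proof -
  have "dir_deriv (spline_op \<Xi> \<beta> \<phi>) (\<Sum>j<length \<Xi>. \<nu> j *\<^sub>R - (\<Xi> ! j))
     (\<lambda>x. \<Sum>j<length \<Xi>. \<nu> j * spline_op \<Xi> (\<beta>[j := \<beta> ! j - 1]) \<phi> x)"
    using assms by (intro dir_deriv_sum) (auto intro!: dir_deriv_spline_op simp del: One_nat_def)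
  moreover have "(\<Sum>j<length \<Xi>. \<nu> j *\<^sub>R - (\<Xi> ! j)) = 0"
    using assms(3) by (simp add: sum_negf)
  ultimately show ?thesis using dir_deriv_unique[OF _ dir_deriv_zero] by metis
qed

text \<open>
  The partial fraction step \<open>D\<^sub>m = - \<Sum> (\<nu>\<^sub>j / \<nu>\<^sub>m) D\<^sub>j\<close>, obtained by applying the relation to \<open>\<alpha>\<close> with
  entry \<open>m\<close> raised, and solving for the term \<open>j = m\<close>.
\<close>

lemma spline_op_shift_exponent:
  assumes l: "admissible l \<Xi> (\<alpha>[m := \<alpha> ! m + 1])" and "vanishes_above l \<phi>"
    and "(\<Sum>j<length \<Xi>. \<nu> j *\<^sub>R \<Xi> ! j) = 0"
    and "\<And>j. j < length \<Xi> \<Longrightarrow> \<nu> j \<noteq> 0 \<Longrightarrow> \<alpha> ! j \<ge> 1"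
    and m: "m < length \<Xi>" "\<nu> m \<noteq> 0"
  shows "spline_op \<Xi> \<alpha> \<phi> x =
    (\<Sum>j | j < length \<Xi> \<and> j \<noteq> m \<and> \<nu> j \<noteq> 0. - (\<nu> j / \<nu> m) * spline_op \<Xi> (shift_exponent m j \<alpha>) \<phi> x)"
proof -
  let ?\<beta> = "\<alpha>[m := \<alpha> ! m + 1]"
  let ?f = "\<lambda>j. \<nu> j * spline_op \<Xi> (?\<beta>[j := ?\<beta> ! j - 1]) \<phi> x"
  have len: "length \<alpha> = length \<Xi>" using l by (simp add: admissible_def)
  have "?\<beta> ! j \<ge> 1" if "j < length \<Xi>" "\<nu> j \<noteq> 0" for j
    using assms(4)[OF that] that len by (cases "m = j") auto
  then have "0 = (\<Sum>j<length \<Xi>. ?f j)"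
    using spline_op_relation[OF l assms(2,3)] by simp
  also have "\<dots> = ?f m + (\<Sum>j\<in>{..<length \<Xi>} - {m}. ?f j)"
    using m by (intro sum.remove) auto
  also have "?\<beta>[m := ?\<beta> ! m - 1] = \<alpha>" using m len by simp
  also have "(\<Sum>j\<in>{..<length \<Xi>} - {m}. ?f j) =
     (\<Sum>j | j < length \<Xi> \<and> j \<noteq> m \<and> \<nu> j \<noteq> 0. \<nu> j * spline_op \<Xi> (shift_exponent m j \<alpha>) \<phi> x)"
    by (rule sum.mono_neutral_cong_right) (auto simp: shift_exponent_def)
  finally have "spline_op \<Xi> \<alpha> \<phi> x =
    - (\<Sum>j | j < length \<Xi> \<and> j \<noteq> m \<and> \<nu> j \<noteq> 0. \<nu> j * spline_op \<Xi> (shift_exponent m j \<alpha>) \<phi> x) / \<nu> m"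
    using m by (simp add: field_simps)
  then show ?thesis by (simp add: sum_divide_distrib sum_negf)
qed

section \<open>The box spline as a functional\<close>

lemma box_spline_kernel_measurable:
  fixes \<xi> :: "real ^ 's"
  assumes "M \<in> space (prob_algebra borel)"
  shows "(\<lambda>t::real. distr M borel (\<lambda>x. x + t *\<^sub>R \<xi>)) \<in> borel \<rightarrow>\<^sub>M prob_algebra borel"
proof (rule measurable_distr_prob_space2)
  show "(\<lambda>t. M) \<in> borel \<rightarrow>\<^sub>M prob_algebra borel" using assms by simp
  show "(\<lambda>(t, x). x + t *\<^sub>R \<xi>) \<in> borel \<Otimes>\<^sub>M borel \<rightarrow>\<^sub>M borel" by measurable
qed

lemma uniform_measure_in_prob_algebra:
  "uniform_measure lborel {0..1::real} \<in> space (prob_algebra borel)"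
  by (auto simp: space_prob_algebra intro!: prob_space_uniform_measure)

lemma box_spline_in_prob_algebra: "box_spline \<Xi> \<in> space (prob_algebra borel)"
proof (induction \<Xi>)
  case Nil
  then show ?case by (auto simp: space_prob_algebra intro!: prob_space_return)
next
  case (Cons \<xi> \<Xi>)
  from measurable_bind_prob_space[OF measurable_const[OF uniform_measure_in_prob_algebra] box_spline_kernel_measurable[OF Cons]]
  have "(\<lambda>_. box_spline (\<xi> # \<Xi>)) \<in> count_space UNIV \<rightarrow>\<^sub>M prob_algebra borel"
    unfolding box_spline.simps .
  from measurable_space[OF this, of undefined] show ?case by simp
qed

lemma sets_box_spline [simp, measurable_cong]: "sets (box_spline \<Xi>) = sets borel"
  and prob_space_box_spline: "prob_space (box_spline \<Xi>)"
  using box_spline_in_prob_algebra[of \<Xi>] by (auto simp: space_prob_algebra)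

lemma nn_integral_box_spline_Cons:
  assumes [measurable]: "f \<in> borel_measurable borel"
  shows "(\<integral>\<^sup>+ y. f y \<partial>box_spline (\<xi> # \<Xi>)) = (\<integral>\<^sup>+ t. (\<integral>\<^sup>+ y. f (y + t *\<^sub>R \<xi>) \<partial>box_spline \<Xi>) * indicator {0..1::real} t \<partial>lborel)"
proof -
  let ?N = "\<lambda>t::real. distr (box_spline \<Xi>) borel (\<lambda>x. x + t *\<^sub>R \<xi>)"
  have N: "?N \<in> borel \<rightarrow>\<^sub>M subprob_algebra borel"
    by (intro measurable_prob_algebraD box_spline_kernel_measurable box_spline_in_prob_algebra)
  have N': "?N \<in> uniform_measure lborel {0..1} \<rightarrow>\<^sub>M subprob_algebra borel"
    using N by (subst measurable_cong_sets[OF _ refl, of _ borel]) auto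
  have m: "(\<lambda>t. \<integral>\<^sup>+ y. f y \<partial>?N t) \<in> borel_measurable lborel"
    using measurable_compose[OF N nn_integral_measurable_subprob_algebra[OF assms]] by simp
  have "(\<integral>\<^sup>+ y. f y \<partial>box_spline (\<xi> # \<Xi>)) = (\<integral>\<^sup>+ t. (\<integral>\<^sup>+ y. f y \<partial>?N t) \<partial>uniform_measure lborel {0..1})"
    by (simp add: nn_integral_bind[OF assms N'])
  also have "\<dots> = (\<integral>\<^sup>+ t. (\<integral>\<^sup>+ y. f y \<partial>?N t) * indicator {0..1} t \<partial>lborel)"
    using m by (subst nn_integral_uniform_measure) (auto simp: divide_ennreal_def)
  also have "\<dots> = (\<integral>\<^sup>+ t. (\<integral>\<^sup>+ y. f (y + t *\<^sub>R \<xi>) \<partial>box_spline \<Xi>) * indicator {0..1::real} t \<partial>lborel)"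
    by (subst nn_integral_distr) auto
  finally show ?thesis .
qed

lemma seg_op_nonneg: "(\<And>x. 0 \<le> \<phi> x) \<Longrightarrow> 0 \<le> seg_op L \<xi> \<phi> x"
  unfolding seg_op_def by (cases "(\<lambda>t. \<phi> (x + t *\<^sub>R \<xi>)) integrable_on {0..L}")
    (auto intro: integral_nonneg simp: not_integrable_integral)

lemma nn_integral_box_spline:
  assumes "continuous_on UNIV \<phi>" "\<And>x. 0 \<le> \<phi> x"
  shows "(\<integral>\<^sup>+ y. ennreal (\<phi> (x + y)) \<partial>box_spline \<Xi>) = ennreal (spline_op \<Xi> (replicate (length \<Xi>) 1) \<phi> x)
    \<and> 0 \<le> spline_op \<Xi> (replicate (length \<Xi>) 1) \<phi> x \<and> continuous_on UNIV (spline_op \<Xi> (replicate (length \<Xi>) 1) \<phi>)"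
proof (induction \<Xi> arbitrary: x)
  case Nil
  have "(\<lambda>y. ennreal (\<phi> (x + y))) \<in> borel_measurable borel"
    by (intro measurable_compose[OF _ measurable_ennreal] borel_measurable_continuous_onI
      continuous_on_compose2[OF assms(1)] continuous_intros) auto
  then show ?case using assms by (simp add: nn_integral_return)
next
  case (Cons \<xi> \<Xi>)
  let ?u = "spline_op \<Xi> (replicate (length \<Xi>) 1) \<phi>"
  have c: "continuous_on UNIV ?u" and nn: "\<And>x. 0 \<le> ?u x" using Cons.IH by auto
  have [measurable]: "(\<lambda>y. ennreal (\<phi> (x + y))) \<in> borel_measurable borel"
    by (intro measurable_compose[OF _ measurable_ennreal] borel_measurable_continuous_onI
      continuous_on_compose2[OF assms(1)] continuous_intros) auto
  have "(\<integral>\<^sup>+ y. ennreal (\<phi> (x + y)) \<partial>box_spline (\<xi> # \<Xi>)) =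
    (\<integral>\<^sup>+ t. (\<integral>\<^sup>+ y. ennreal (\<phi> (x + (y + t *\<^sub>R \<xi>))) \<partial>box_spline \<Xi>) * indicator {0..1} t \<partial>lborel)"
    by (rule nn_integral_box_spline_Cons) fact
  also have "\<dots> = (\<integral>\<^sup>+ t. ennreal (?u (x + t *\<^sub>R \<xi>)) * indicator {0..1} t \<partial>lborel)"
    using Cons.IH[of "x + _ *\<^sub>R \<xi>"] by (intro nn_integral_cong) (simp add: add_ac)
  also have "\<dots> = ennreal (seg_op 1 \<xi> ?u x)"
    using nn_integral_has_integral_lebesgue[OF _ integrable_integral[OF integrable_on_line[OF c, of x \<xi> 0 1]]] nn
    by (simp add: seg_op_def mult.commute ennreal_mult' ennreal_indicator del: One_nat_def)
  finally show ?case
    using nn by (simp add: factor_op_def continuous_seg_op[OF c] seg_op_nonneg del: One_nat_def box_spline.simps)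
qed

section \<open>Linear change of variables\<close>

interpretation lborel_PiM: product_sigma_finite "\<lambda>_::'i. lborel :: real measure"
  by standard

lemma measurable_vec_lambda:
  assumes "\<And>i. (\<lambda>x. f x i) \<in> borel_measurable M"
  shows "(\<lambda>x. (\<chi> i. f x i) :: real ^ 's) \<in> borel_measurable M"
  using assms by (subst borel_measurable_euclidean_space) (auto simp: Basis_vec_def inner_axis)

lemma measurable_vec_PiM [measurable]:
  "(\<lambda>t. \<chi> i. t i) \<in> (\<Pi>\<^sub>M i\<in>(UNIV :: 's::finite set). lborel :: real measure) \<rightarrow>\<^sub>M (borel :: (real ^ 's) measure)"
    by (rule measurable_vec_lambda) measurable

lemma lborel_vec_eq_distr_PiM:
  "(lborel :: (real ^ 's) measure) = distr (\<Pi>\<^sub>M i\<in>UNIV. lborel) borel (\<lambda>t. \<chi> i. t i)"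
proof (rule lborel_eqI)
  fix l u :: "real ^ 's"
  assume lu: "\<And>b. b \<in> Basis \<Longrightarrow> l \<bullet> b \<le> u \<bullet> b"
  have le: "l $ i \<le> u $ i" for i
    using lu[of "axis i 1"] by (simp add: inner_axis)
  have "(\<lambda>t. \<chi> i. t i) -` box l u \<inter> space (\<Pi>\<^sub>M i\<in>(UNIV :: 's set). lborel) = (\<Pi>\<^sub>E i\<in>UNIV. {l $ i<..<u $ i})"
    by (auto simp: mem_box_cart space_PiM PiE_iff)
  then have "emeasure (distr (\<Pi>\<^sub>M i\<in>UNIV. lborel) borel (\<lambda>t. \<chi> i. t i)) (box l u) =
     (\<Prod>i\<in>UNIV. emeasure lborel {l $ i<..<u $ i})"
    by (subst emeasure_distr) (auto simp: lborel_PiM.emeasure_PiM)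
  also have "\<dots> = ennreal (\<Prod>i\<in>UNIV. u $ i - l $ i)"
    using le by (simp add: prod_ennreal)
  also have "(\<Prod>i\<in>UNIV. u $ i - l $ i) = (\<Prod>b\<in>Basis. (u - l) \<bullet> b)"
    by (simp add: Basis_vec_def UNION_singleton_eq_range prod.reindex inj_on_def axis_eq_axis inner_axis)
  finally show "emeasure (distr (\<Pi>\<^sub>M i\<in>UNIV. lborel) borel (\<lambda>t. \<chi> i. t i)) (box l u) =
     ennreal (\<Prod>b\<in>Basis. (u - l) \<bullet> b)" .
qed simp

lemma nn_integral_lborel_vec:
  fixes f :: "real ^ 's \<Rightarrow> ennreal"
  assumes [measurable]: "f \<in> borel_measurable borel"
  shows "(\<integral>\<^sup>+ x. f x \<partial>lborel) = (\<integral>\<^sup>+ t. f (\<chi> i. t i) \<partial>(\<Pi>\<^sub>M i\<in>UNIV. lborel))"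
  by (subst lborel_vec_eq_distr_PiM) (simp add: nn_integral_distr)

lemma measurable_matrix_vector_mult [measurable]:
  fixes A :: "real ^ 'n ^ 'm" shows "(\<lambda>x. A *v x) \<in> borel_measurable borel"
  by (intro borel_measurable_continuous_onI linear_continuous_on matrix_vector_mul_bounded_linear)

text \<open>
  The change of variables formula for a fixed matrix.  It is proved for an index type that is merely
  finite, by reduction to matrices that differ from the identity in one column.
\<close>

definition scales_volume_by_det :: "real ^ 's ^ 's \<Rightarrow> bool" where
  "scales_volume_by_det A \<longleftrightarrow> (\<forall>\<phi>\<in>borel_measurable borel.
     (\<integral>\<^sup>+ x. \<phi> (A *v x) \<partial>lborel) * ennreal \<bar>Determinants.det A\<bar> = (\<integral>\<^sup>+ x. \<phi> x \<partial>lborel))"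

lemma scales_volume_by_det_mult:
  assumes "scales_volume_by_det A" "scales_volume_by_det B"
  shows "scales_volume_by_det (A ** B)"
  unfolding scales_volume_by_det_def
proof safe
  fix \<phi> :: "real ^ 'a \<Rightarrow> ennreal" assume [measurable]: "\<phi> \<in> borel_measurable borel"
  have "(\<lambda>x. \<phi> (A *v x)) \<in> borel_measurable borel" by measurable
  then have "(\<integral>\<^sup>+ x. \<phi> (A *v (B *v x)) \<partial>lborel) * ennreal \<bar>Determinants.det B\<bar> = (\<integral>\<^sup>+ x. \<phi> (A *v x) \<partial>lborel)"
    using assms(2) by (auto simp: scales_volume_by_det_def)
  moreover have "(\<integral>\<^sup>+ x. \<phi> (A *v x) \<partial>lborel) * ennreal \<bar>Determinants.det A\<bar> = (\<integral>\<^sup>+ x. \<phi> x \<partial>lborel)"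
    using assms(1) by (auto simp: scales_volume_by_det_def)
  ultimately show "(\<integral>\<^sup>+ x. \<phi> (A ** B *v x) \<partial>lborel) * ennreal \<bar>Determinants.det (A ** B)\<bar> = (\<integral>\<^sup>+ x. \<phi> x \<partial>lborel)"
    by (simp add: matrix_vector_mul_assoc[symmetric] det_mul abs_mult ennreal_mult) (metis mult.assoc mult.commute)
qed

definition replace_column :: "'s \<Rightarrow> real ^ 's \<Rightarrow> real ^ 's ^ 's" where
  "replace_column k v = (\<chi> i j. if j = k then v $ i else (if i = j then 1 else 0))"

lemma det_replace_column: "Determinants.det (replace_column k v) = v $ k"
proof -
  have "replace_column k v = (\<chi> i j. if j = k then (Finite_Cartesian_Product.mat 1 *v v) $ i else Finite_Cartesian_Product.mat 1 $ i $ j)"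
    unfolding matrix_vector_mul_lid by (simp add: replace_column_def Finite_Cartesian_Product.mat_def Finite_Cartesian_Product.vec_eq_iff)
  also have "Determinants.det \<dots> = v $ k"
    by (subst cramer_lemma) simp
  finally show ?thesis .
qed

lemma replace_column_mult:
  "replace_column k v *v x = x + x $ k *\<^sub>R (v - axis k 1)"
proof -
  have *: "(\<Sum>j\<in>UNIV. (if j = k then v $ i else if i = j then 1 else 0) * x $ j) = x $ i + x $ k * (v $ i - (if i = k then 1 else 0))" for i
  proof -
    have "(\<Sum>j\<in>UNIV. (if j = k then v $ i else if i = j then 1 else 0) * x $ j)
      = (\<Sum>j\<in>UNIV. (if j = k then (v $ i - (if i = k then 1 else 0)) * x $ j else 0) + (if i = j then x $ j else 0))"
      by (rule sum.cong) (auto simp: algebra_simps)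
    also have "\<dots> = (v $ i - (if i = k then 1 else 0)) * x $ k + x $ i"
      by (simp add: sum.distrib)
    finally show ?thesis by (simp add: algebra_simps split: if_splits)
  qed
  show ?thesis
    by (simp add: Finite_Cartesian_Product.vec_eq_iff replace_column_def matrix_vector_mult_def axis_def * del: mult_if_delta)
qed

text \<open>
  Such a matrix changes only coordinate \<open>i\<close>, by an affine map once the other coordinates are fixed, so
  that Fubini reduces the claim to the real line.
\<close>

lemma scales_volume_elementary:
  assumes "v $ k \<noteq> 0" "\<And>j. j \<noteq> k \<Longrightarrow> j \<noteq> i \<Longrightarrow> v $ j = 0" "i \<noteq> k \<Longrightarrow> v $ k = 1"
  shows "scales_volume_by_det (replace_column k v)"
  unfolding scales_volume_by_det_def
proof safe
  fix \<phi> :: "real ^ 'a \<Rightarrow> ennreal" assume [measurable]: "\<phi> \<in> borel_measurable borel"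
  define c where "c = (if i = k then v $ k else 1)"
  define I where "I = UNIV - {i}"
  have I: "finite I" "i \<notin> I" "UNIV = insert i I" by (auto simp: I_def)
  have c: "c \<noteq> 0" "v $ k = c" using assms by (auto simp: c_def)
  have meas: "(\<lambda>t. replace_column k v *v (\<chi> i. t i)) \<in> (\<Pi>\<^sub>M i\<in>insert i I. lborel) \<rightarrow>\<^sub>M borel"
    unfolding I(3)[symmetric] by measurable
  have meas2: "(\<lambda>t. \<chi> i. t i) \<in> (\<Pi>\<^sub>M i\<in>insert i I. lborel) \<rightarrow>\<^sub>M (borel :: (real ^ 'a) measure)"
    unfolding I(3)[symmetric] by measurable
  have "(\<integral>\<^sup>+ x. \<phi> (replace_column k v *v x) \<partial>lborel) * ennreal \<bar>c\<bar> =
    (\<integral>\<^sup>+ t. \<phi> (replace_column k v *v (\<chi> i. t i)) \<partial>(\<Pi>\<^sub>M i\<in>insert i I. lborel)) * ennreal \<bar>c\<bar>"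
    by (simp add: nn_integral_lborel_vec I(3)[symmetric])
  also have "\<dots> = (\<integral>\<^sup>+ t. (\<integral>\<^sup>+ y. \<phi> (replace_column k v *v (\<chi> j. (t(i := y)) j)) \<partial>lborel) \<partial>(\<Pi>\<^sub>M i\<in>I. lborel)) * ennreal \<bar>c\<bar>"
    by (subst lborel_PiM.product_nn_integral_insert[OF I(1,2)])
      (auto intro!: measurable_compose[OF meas])
  also have "\<dots> = (\<integral>\<^sup>+ t. (\<integral>\<^sup>+ y. \<phi> (replace_column k v *v (\<chi> j. (t(i := y)) j)) \<partial>lborel) * ennreal \<bar>c\<bar> \<partial>(\<Pi>\<^sub>M i\<in>I. lborel))"
  proof (rule nn_integral_multc[symmetric])
    have "(\<lambda>(t, y). t(i := y)) \<in> (\<Pi>\<^sub>M i\<in>I. lborel) \<Otimes>\<^sub>M lborel \<rightarrow>\<^sub>M (\<Pi>\<^sub>M i\<in>insert i I. lborel :: real measure)"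
      by (rule measurable_add_dim)
    from measurable_compose[OF this meas]
    have "(\<lambda>(t, y). \<phi> (replace_column k v *v (\<chi> j. (t(i := y)) j))) \<in> borel_measurable ((\<Pi>\<^sub>M i\<in>I. lborel) \<Otimes>\<^sub>M lborel)"
      by (auto simp: split_beta' intro: measurable_compose)
    then show "(\<lambda>t. \<integral>\<^sup>+ y. \<phi> (replace_column k v *v (\<chi> j. (t(i := y)) j)) \<partial>lborel) \<in> borel_measurable (\<Pi>\<^sub>M i\<in>I. lborel)"
      by (rule lborel.borel_measurable_nn_integral)
  qed
  also have "\<dots> = (\<integral>\<^sup>+ t. (\<integral>\<^sup>+ y. \<phi> (\<chi> j. (t(i := y)) j) \<partial>lborel) \<partial>(\<Pi>\<^sub>M i\<in>I. lborel))"
  proof (rule nn_integral_cong)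
    fix t
    define b where "b = (if i = k then 0 else t k * v $ i)"
    have "replace_column k v *v (\<chi> j. (t(i := y)) j) = (\<chi> j. (t(i := b + c * y)) j)" for y
      unfolding replace_column_mult using assms
      by (auto simp: Finite_Cartesian_Product.vec_eq_iff axis_def b_def c_def algebra_simps)
    moreover have "(\<lambda>y. \<chi> j. (t(i := y)) j) \<in> borel_measurable borel"
      by (rule measurable_vec_lambda) (auto simp: fun_upd_def)
    then have "(\<lambda>y. \<phi> (\<chi> j. (t(i := y)) j)) \<in> borel_measurable borel"
      by (rule measurable_compose) measurable
    ultimately show "(\<integral>\<^sup>+ y. \<phi> (replace_column k v *v (\<chi> j. (t(i := y)) j)) \<partial>lborel) * ennreal \<bar>c\<bar>
      = (\<integral>\<^sup>+ y. \<phi> (\<chi> j. (t(i := y)) j) \<partial>lborel)"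
      using nn_integral_real_affine[of "\<lambda>y. \<phi> (\<chi> j. (t(i := y)) j)" c b] c by (simp add: mult.commute)
  qed
  also have "\<dots> = (\<integral>\<^sup>+ t. \<phi> (\<chi> i. t i) \<partial>(\<Pi>\<^sub>M i\<in>insert i I. lborel))"
    by (subst lborel_PiM.product_nn_integral_insert[OF I(1,2)])
      (auto intro!: measurable_compose[OF meas2])
  also have "\<dots> = (\<integral>\<^sup>+ x. \<phi> x \<partial>lborel)"
    by (simp add: nn_integral_lborel_vec I(3)[symmetric])
  finally show "(\<integral>\<^sup>+ x. \<phi> (replace_column k v *v x) \<partial>lborel) * ennreal \<bar>Determinants.det (replace_column k v)\<bar>
     = (\<integral>\<^sup>+ x. \<phi> x \<partial>lborel)" by (simp add: det_replace_column c)
qed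

text \<open>
  The nonzero off-diagonal entries of the replaced column are split off one at a time.
\<close>

lemma scales_volume_replace_column:
  assumes "v $ k \<noteq> 0" shows "scales_volume_by_det (replace_column k v)"
proof -
  have "scales_volume_by_det (replace_column k v)"
    if "finite J" "v $ k \<noteq> 0" "\<And>j. j \<noteq> k \<Longrightarrow> j \<notin> J \<Longrightarrow> v $ j = 0" for J and v
    using that
  proof (induction J arbitrary: v)
    case empty
    then show ?case by (intro scales_volume_elementary[where i = k]) auto
  next
    case (insert i J)
    show ?case
    proof (cases "i = k")
      case True
      then show ?thesis using insert.prems by (intro insert.IH) auto
    next
      case False
      define w where "w = (\<chi> j. if j = i then 0 else v $ j)"
      define e where "e = axis k 1 + axis i (v $ i / v $ k)"
      have "replace_column k v *v x = replace_column k e *v (replace_column k w *v x)" for x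
        using False insert.prems
        by (auto simp: replace_column_mult Finite_Cartesian_Product.vec_eq_iff w_def e_def axis_def algebra_simps)
      then have "replace_column k v = replace_column k e ** replace_column k w"
        by (simp add: matrix_eq matrix_vector_mul_assoc[symmetric])
      moreover have "scales_volume_by_det (replace_column k w)"
        using False insert.prems by (intro insert.IH) (auto simp: w_def)
      moreover have "scales_volume_by_det (replace_column k e)"
        using False by (intro scales_volume_elementary[where i = i]) (auto simp: e_def axis_def)
      ultimately show ?thesis by (auto intro: scales_volume_by_det_mult)
    qed
  qed
  from this[of UNIV v] show ?thesis using assms by simp
qed

lemma sum_scaleR_axis: "(\<Sum>j\<in>UNIV. x $ j *\<^sub>R axis j 1) = (x :: real ^ 'n)"
  by (simp add: Finite_Cartesian_Product.vec_eq_iff axis_def if_distrib cong: if_cong)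

lemma matrix_vector_mult_eq_sum_axis:
  fixes A :: "real ^ 'n ^ 'm"
  shows "A *v x = (\<Sum>j\<in>UNIV. x $ j *\<^sub>R (A *v axis j 1))"
proof -
  have "A *v x = A *v (\<Sum>j\<in>UNIV. x $ j *\<^sub>R axis j 1)" by (simp add: sum_scaleR_axis)
  then show ?thesis
    by (simp add: linear_sum[OF matrix_vector_mul_linear] matrix_vector_mult_scaleR)
qed

text \<open>
  Gaussian elimination: induction on the set of columns that may differ from those of the identity.
\<close>

lemma scales_volume_if_invertible:
  assumes "Determinants.det A \<noteq> 0"
  shows "scales_volume_by_det (A :: real ^ 's ^ 's)"
proof -
  have "scales_volume_by_det A"
    if "finite S" "Determinants.det A \<noteq> 0" "\<And>j. j \<notin> S \<Longrightarrow> A *v axis j 1 = axis j 1" for S and A :: "real ^ 's ^ 's"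
    using that
  proof (induction S arbitrary: A)
    case empty
    have "A *v x = Finite_Cartesian_Product.mat 1 *v x" for x
      using empty by (subst matrix_vector_mult_eq_sum_axis) (simp add: sum_scaleR_axis)
    then have "A = Finite_Cartesian_Product.mat 1" by (simp add: matrix_eq)
    then show ?case by (simp add: scales_volume_by_det_def)
  next
    case (insert k S)
    \<comment> \<open>With a nonzero pivot one replaced column can be split off; a vanishing pivot is repaired by
      adding some row of \<open>S\<close> to row \<open>k\<close>.\<close>
    have pivot: "scales_volume_by_det A"
      if det: "Determinants.det A \<noteq> 0" and ax: "\<And>j. j \<notin> insert k S \<Longrightarrow> A *v axis j 1 = axis j 1"
      and v: "(A *v axis k 1) $ k \<noteq> 0" for A :: "real ^ 's ^ 's"
    proof -
      let ?C = "replace_column k (A *v axis k 1)"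
      have detC: "Determinants.det ?C \<noteq> 0" using v by (simp add: det_replace_column)
      then obtain D where D: "?C ** D = Finite_Cartesian_Product.mat 1" "D ** ?C = Finite_Cartesian_Product.mat 1"
        by (metis invertible_def invertible_det_nz)
      define B where "B = D ** A"
      have A: "A = ?C ** B" by (simp add: B_def matrix_mul_assoc D)
      have "Determinants.det B \<noteq> 0" using det A by (metis det_mul mult_zero_right)
      moreover have "B *v axis j 1 = axis j 1" if "j \<notin> S" for j
      proof -
        have "A *v axis j 1 = ?C *v axis j 1"
        proof (cases "j = k")
          case True
          then show ?thesis by (simp add: replace_column_mult axis_def)
        next
          case False
          then show ?thesis using ax[of j] that by (simp add: replace_column_mult axis_def)
        qed
        then show ?thesis by (simp add: B_def matrix_vector_mul_assoc[symmetric]) (simp add: matrix_vector_mul_assoc D)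
      qed
      ultimately have "scales_volume_by_det B" by (rule insert.IH)
      with scales_volume_replace_column[OF v] A show ?thesis by (metis scales_volume_by_det_mult)
    qed
    show ?case
    proof (cases "(A *v axis k 1) $ k = 0")
      case False
      then show ?thesis using insert.prems by (intro pivot) auto
    next
      case True
      have "\<exists>i\<in>S. (A *v axis k 1) $ i \<noteq> 0"
      proof (rule ccontr)
        assume "\<not> ?thesis"
        then have z: "(A *v axis k 1) $ i = 0" if "i \<in> insert k S" for i using that True by auto
        define w where "w = axis k 1 - (A *v axis k 1)"
        have "A *v (A *v axis k 1) = (\<Sum>j\<in>UNIV. (A *v axis k 1) $ j *\<^sub>R (A *v axis j 1))"
          by (rule matrix_vector_mult_eq_sum_axis)
        also have "\<dots> = (\<Sum>j\<in>UNIV. (A *v axis k 1) $ j *\<^sub>R axis j 1)"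
          by (rule sum.cong) (use z insert.prems in auto)
        also have "\<dots> = A *v axis k 1" by (rule sum_scaleR_axis)
        finally have "A *v w = 0" by (simp add: w_def matrix_vector_mult_diff_distrib)
        then have "w = 0"
          using insert.prems(1) by (metis invertible_det_nz invertible_def matrix_vector_mul_assoc matrix_vector_mul_lid matrix_vector_mult_0_right)
        then have "w $ k = 0" by simp
        then show False using True by (simp add: w_def axis_def)
      qed
      then obtain i where i: "i \<in> S" "(A *v axis k 1) $ i \<noteq> 0" by blast
      then have ik: "i \<noteq> k" using insert.hyps by auto
      \<comment> \<open>\<open>?E\<close> adds row \<open>i\<close> to row \<open>k\<close>, and \<open>?D\<close> is its inverse\<close>
      let ?E = "replace_column i (axis i 1 + axis k 1)"
      let ?D = "replace_column i (axis i 1 - axis k 1)"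
      have "?D *v (?E *v x) = x" for x
        using ik by (auto simp: replace_column_mult Finite_Cartesian_Product.vec_eq_iff axis_def)
      then have DE: "?D ** ?E = Finite_Cartesian_Product.mat 1" by (simp add: matrix_eq matrix_vector_mul_assoc[symmetric])
      have "scales_volume_by_det (?E ** A)"
      proof (rule pivot)
        show "Determinants.det (?E ** A) \<noteq> 0"
          using insert.prems(1) ik by (simp add: det_mul det_replace_column axis_def)
        show "?E ** A *v axis j 1 = axis j 1" if "j \<notin> insert k S" for j
          using insert.prems(2)[OF that] that i by (auto simp: matrix_vector_mul_assoc[symmetric] replace_column_mult axis_def)
        show "(?E ** A *v axis k 1) $ k \<noteq> 0"
          using i ik True by (auto simp: matrix_vector_mul_assoc[symmetric] replace_column_mult axis_def)
      qed
      moreover have "scales_volume_by_det ?D"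
        using ik by (intro scales_volume_replace_column) (auto simp: axis_def)
      moreover note scales_volume_by_det_mult[of ?D "?E ** A"]
      ultimately have "scales_volume_by_det (?D ** (?E ** A))" by blast
      then show ?thesis by (simp add: matrix_mul_assoc DE)
    qed
  qed
  from this[of UNIV A] show ?thesis using assms by simp
qed

section \<open>Iterated rays and truncated powers\<close>

text \<open>
  The density of \<open>a\<close> successive rays, normalised as in \<open>truncated_power\<close>, whose exponent is \<open>a - 1\<close>.
\<close>

definition power_kernel :: "nat \<Rightarrow> real \<Rightarrow> real" where
  "power_kernel a t = t ^ (a - 1) * heaviside t / fact (a - 1)"

lemma power_kernel_nonneg: "0 \<le> power_kernel a t"
  by (simp add: power_kernel_def heaviside_def)

lemma measurable_power_kernel [measurable]: "power_kernel a \<in> borel_measurable borel"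
proof -
  have "heaviside \<in> borel_measurable borel" unfolding heaviside_def[abs_def] by measurable
  then show ?thesis unfolding power_kernel_def[abs_def] by measurable
qed

lemma ray_op_nonneg: "(\<And>x. 0 \<le> \<phi> x) \<Longrightarrow> 0 \<le> ray_op \<xi> \<phi> x"
  unfolding ray_op_def by (cases "(\<lambda>t. \<phi> (x + t *\<^sub>R \<xi>)) integrable_on {0..}")
    (auto intro: integral_nonneg simp: not_integrable_integral)

lemma ray_funpow_nonneg: "(\<And>x. 0 \<le> \<phi> x) \<Longrightarrow> 0 \<le> (ray_op \<xi> ^^ k) \<phi> x"
  by (induction k arbitrary: x) (auto intro: ray_op_nonneg)

text \<open>
  Cauchy's formula for repeated integration: as the derivative of \<open>ray_op \<xi> u\<close> along \<open>\<xi>\<close> is \<open>- u\<close>,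
  integration by parts trades one ray for one power of \<open>t\<close>, and the boundary terms vanish.
\<close>

lemma has_integral_ray_funpow:
  assumes l: "linear l" "l \<xi> > 0" and u: "vanishes_above l u"
  shows "((\<lambda>t. t ^ k / fact k * u (x + t *\<^sub>R \<xi>)) has_integral (ray_op \<xi> ^^ Suc k) u x) {0..}"
  using u
proof (induction k arbitrary: u)
  case 0
  then obtain C where C: "\<And>x. l x > C \<Longrightarrow> u x = 0" and c: "continuous_on UNIV u"
    by (auto simp: vanishes_above_def)
  have "((\<lambda>t. u (x + t *\<^sub>R \<xi>)) has_integral seg_op ((C - l x) / l \<xi>) \<xi> u x) {0..}"
    by (rule has_integral_ray[OF l c C]) auto
  then show ?case by (simp add: ray_op_def integral_unique)
next
  case (Suc k)
  let ?F = "ray_op \<xi> u"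
  have F: "vanishes_above l ?F" by (rule vanishes_above_ray_op[OF l Suc.prems])
  from Suc.prems F obtain C1 C2 where C: "\<And>x. l x > C1 \<Longrightarrow> u x = 0" "\<And>x. l x > C2 \<Longrightarrow> ?F x = 0"
    by (auto simp: vanishes_above_def)
  have cu: "continuous_on UNIV u" by (rule vanishes_aboveD[OF Suc.prems])
  define L where "L = max 0 ((max C1 C2 - l x + 1) / l \<xi>)"
  have z: "u (x + t *\<^sub>R \<xi>) = 0" "?F (x + t *\<^sub>R \<xi>) = 0" if "t \<ge> L" for t
  proof -
    have "max C1 C2 - l x + 1 \<le> L * l \<xi>" using l by (simp add: L_def max_def field_simps)
    also have "L * l \<xi> \<le> t * l \<xi>" using that l by simp
    finally have "l (x + t *\<^sub>R \<xi>) > max C1 C2" using l by (simp add: linear_add linear_scale max_def split: if_splits)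
    then show "u (x + t *\<^sub>R \<xi>) = 0" "?F (x + t *\<^sub>R \<xi>) = 0" by (auto intro: C)
  qed
  let ?h = "\<lambda>t. t ^ Suc k / fact (Suc k) * ?F (x + t *\<^sub>R \<xi>)"
  have "((\<lambda>t. t ^ k / fact k * ?F (x + t *\<^sub>R \<xi>) - t ^ Suc k / fact (Suc k) * u (x + t *\<^sub>R \<xi>)) has_integral ?h L - ?h 0) {0..L}"
  proof (rule fundamental_theorem_of_calculus)
    fix t assume "t \<in> {0..L}"
    have d: "((\<lambda>t. ?F (x + t *\<^sub>R \<xi>)) has_real_derivative - u (x + t *\<^sub>R \<xi>)) (at t within {0..L})"
      by (rule DERIV_subset[OF dir_deriv_at[OF dir_deriv_ray_op_self[OF l Suc.prems]]]) simp
    have e: "real (Suc k) * t ^ k / fact (Suc k) = t ^ k / fact k"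
      unfolding fact_Suc by (simp del: of_nat_Suc)
    have p: "((\<lambda>t. t ^ Suc k / fact (Suc k)) has_real_derivative t ^ k / fact k) (at t within {0..L})"
      by (rule derivative_eq_intros refl | use e in simp)+
    show "(?h has_vector_derivative t ^ k / fact k * ?F (x + t *\<^sub>R \<xi>) - t ^ Suc k / fact (Suc k) * u (x + t *\<^sub>R \<xi>)) (at t within {0..L})"
      using DERIV_mult[OF p d] by (simp add: has_real_derivative_iff_has_vector_derivative algebra_simps)
  qed (simp add: L_def)
  then have 1: "((\<lambda>t. t ^ k / fact k * ?F (x + t *\<^sub>R \<xi>) - t ^ Suc k / fact (Suc k) * u (x + t *\<^sub>R \<xi>)) has_integral 0) {0..}"
    using z by (subst (asm) has_integral_spike_set_eq[where T = "{0..}"]) (auto intro!: negligible_subset[OF negligible_empty])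
  have "((\<lambda>t. t ^ k / fact k * ?F (x + t *\<^sub>R \<xi>)) has_integral (ray_op \<xi> ^^ Suc k) ?F x) {0..}"
    by (rule Suc.IH[OF F])
  from has_integral_diff[OF this 1] show ?case by (simp add: funpow_swap1)
qed

lemma nn_integral_ray_funpow:
  assumes l: "linear l" "l \<xi> > 0" and u: "vanishes_above l u" and nn: "\<And>x. 0 \<le> u x" and a: "a \<ge> 1"
  shows "(\<integral>\<^sup>+ t. ennreal (power_kernel a t) * ennreal (u (x + t *\<^sub>R \<xi>)) \<partial>lborel) = ennreal ((ray_op \<xi> ^^ a) u x)"
proof -
  define k where "k = a - 1"
  have a: "a = Suc k" using a by (simp add: k_def)
  have "(\<integral>\<^sup>+ t. ennreal (power_kernel a t) * ennreal (u (x + t *\<^sub>R \<xi>)) \<partial>lborel)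
    = (\<integral>\<^sup>+ t. ennreal (indicator {0..} t * (t ^ k / fact k * u (x + t *\<^sub>R \<xi>))) \<partial>lborel)"
    by (intro nn_integral_cong)
      (use nn in \<open>auto simp: power_kernel_def heaviside_def indicator_def a simp flip: ennreal_mult'\<close>)
  also have "\<dots> = ennreal ((ray_op \<xi> ^^ a) u x)"
    unfolding a by (rule nn_integral_has_integral_lebesgue[OF _ has_integral_ray_funpow[OF l u]]) (use nn in auto)
  finally show ?thesis .
qed

definition ray_powers :: "('i \<Rightarrow> 'a::euclidean_space) \<Rightarrow> ('i \<Rightarrow> nat) \<Rightarrow> 'i list \<Rightarrow> ('a \<Rightarrow> real) \<Rightarrow> 'a \<Rightarrow> real" where
  "ray_powers d a js \<phi> = foldr (\<lambda>i. ray_op (d i) ^^ a i) js \<phi>"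

text \<open>
  Fubini, one direction at a time.  The last direction acts on \<open>\<phi>\<close> first, so it supplies the inner
  integral.
\<close>

lemma nn_integral_ray_powers:
  fixes d :: "'i \<Rightarrow> 'a::euclidean_space"
  assumes l: "linear l" and "distinct js" "\<And>i. i \<in> set js \<Longrightarrow> l (d i) > 0 \<and> a i \<ge> 1"
    and "vanishes_above l \<phi>" "\<And>x. 0 \<le> \<phi> x"
  shows "(\<integral>\<^sup>+ t. (\<Prod>i\<in>set js. ennreal (power_kernel (a i) (t i))) * ennreal (\<phi> (x + (\<Sum>i\<in>set js. t i *\<^sub>R d i)))
     \<partial>(\<Pi>\<^sub>M i\<in>set js. lborel)) = ennreal (ray_powers d a js \<phi> x)"
  using assms(2-)
proof (induction js arbitrary: \<phi> rule: rev_induct)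
  case Nil
  then show ?case by (simp add: ray_powers_def nn_integral_empty PiM_empty nn_integral_count_space_finite)
next
  case (snoc k js)
  have k: "k \<notin> set js" "l (d k) > 0" "a k \<ge> 1" using snoc.prems by auto
  have c: "continuous_on UNIV \<phi>" using snoc.prems by (auto simp: vanishes_above_def)
  then have [measurable]: "\<phi> \<in> borel_measurable borel" by (rule borel_measurable_continuous_onI)
  let ?P = "\<lambda>I t. \<Prod>i\<in>I. ennreal (power_kernel (a i) (t i))"
  let ?S = "\<lambda>I t. \<Sum>i\<in>I. t i *\<^sub>R d i"
  let ?g = "(ray_op (d k) ^^ a k) \<phi>"
  have "(\<integral>\<^sup>+ t. ?P (set (js @ [k])) t * ennreal (\<phi> (x + ?S (set (js @ [k])) t)) \<partial>(\<Pi>\<^sub>M i\<in>set (js @ [k]). lborel))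
    = (\<integral>\<^sup>+ t. (\<integral>\<^sup>+ y. ?P (insert k (set js)) (t(k := y)) * ennreal (\<phi> (x + ?S (insert k (set js)) (t(k := y)))) \<partial>lborel) \<partial>(\<Pi>\<^sub>M i\<in>set js. lborel))"
    using k by (simp add: lborel_PiM.product_nn_integral_insert[of "set js" k])
  also have "\<dots> = (\<integral>\<^sup>+ t. ?P (set js) t * ennreal (?g (x + ?S (set js) t)) \<partial>(\<Pi>\<^sub>M i\<in>set js. lborel))"
  proof (rule nn_integral_cong)
    fix t
    have P: "?P (set js) (t(k := y)) = ?P (set js) t" for y
      using k by (intro prod.cong) auto
    have S: "?S (set js) (t(k := y)) = ?S (set js) t" for y
      using k by (intro sum.cong) auto
    have "(\<integral>\<^sup>+ y. ?P (insert k (set js)) (t(k := y)) * ennreal (\<phi> (x + ?S (insert k (set js)) (t(k := y)))) \<partial>lborel)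
      = (\<integral>\<^sup>+ y. ?P (set js) t * (ennreal (power_kernel (a k) y) * ennreal (\<phi> ((x + ?S (set js) t) + y *\<^sub>R d k))) \<partial>lborel)"
      using k by (intro nn_integral_cong) (simp add: P S mult_ac add_ac del: fun_upd_apply, simp add: mult_ac)
    also have "\<dots> = ?P (set js) t * ennreal (?g (x + ?S (set js) t))"
      using snoc.prems k by (simp add: nn_integral_cmult nn_integral_ray_funpow[OF l(1)])
    finally show "(\<integral>\<^sup>+ y. ?P (insert k (set js)) (t(k := y)) * ennreal (\<phi> (x + ?S (insert k (set js)) (t(k := y)))) \<partial>lborel)
      = ?P (set js) t * ennreal (?g (x + ?S (set js) t))" .
  qed
  also have "\<dots> = ennreal (ray_powers d a js ?g x)"
    using snoc.prems by (intro snoc.IH) (auto intro: vanishes_above_ray_funpow[OF l] ray_funpow_nonneg)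
  finally show ?case by (simp add: ray_powers_def)
qed

lemma ray_op_diff_op:
  assumes l: "linear l" "l \<xi> > 0" and u: "vanishes_above l u"
  shows "ray_op \<xi> (diff_op \<xi>' u) = diff_op \<xi>' (ray_op \<xi> u)"
proof
  fix x
  have i: "(\<lambda>t. u (y + t *\<^sub>R \<xi>)) integrable_on {0..}" for y
    using has_integral_ray_funpow[OF l u, of 0 y] by (auto simp: integrable_on_def)
  have "ray_op \<xi> (diff_op \<xi>' u) x = integral {0..} (\<lambda>t. u (x + t *\<^sub>R \<xi>) - u ((x + \<xi>') + t *\<^sub>R \<xi>))"
    by (simp add: ray_op_def diff_op_def algebra_simps)
  also have "\<dots> = diff_op \<xi>' (ray_op \<xi> u) x"
    by (subst integral_diff[OF i i]) (simp add: ray_op_def diff_op_def)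
  finally show "ray_op \<xi> (diff_op \<xi>' u) x = diff_op \<xi>' (ray_op \<xi> u) x" .
qed

text \<open>
  Two rays starting at \<open>x\<close> and \<open>x + \<xi>\<close> differ by a segment.  So if \<open>l \<xi> > 0\<close>, the operators of
  \<open>factor_op\<close> really are a difference followed by rays.
\<close>

lemma diff_op_ray_op:
  assumes l: "linear l" "l \<xi> > 0" and u: "vanishes_above l u"
  shows "diff_op \<xi> (ray_op \<xi> u) = seg_op 1 \<xi> u"
proof
  fix x
  from u obtain C where C: "\<And>x. l x > C \<Longrightarrow> u x = 0" and c: "continuous_on UNIV u"
    by (auto simp: vanishes_above_def)
  define L where "L = max 0 ((C - l (x + \<xi>)) / l \<xi>)"
  have "(C - l x) / l \<xi> = (C - l (x + \<xi>)) / l \<xi> + 1"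
    using l by (simp add: linear_add field_simps)
  then have L: "L \<ge> 0" "L \<ge> (C - l (x + \<xi>)) / l \<xi>" "L + 1 \<ge> (C - l x) / l \<xi>"
    by (auto simp: L_def)
  have c': "continuous_on A (\<lambda>t. u (x + t *\<^sub>R \<xi>))" for A
    by (intro continuous_on_compose2[OF c] continuous_intros) auto
  have "diff_op \<xi> (ray_op \<xi> u) x = seg_op (L + 1) \<xi> u x - seg_op L \<xi> u (x + \<xi>)"
    using ray_op_eq_seg_op[OF l c C L(2)] ray_op_eq_seg_op[OF l c C L(3)] by (simp add: diff_op_def)
  also have "seg_op L \<xi> u (x + \<xi>) = integral {0..L} ((\<lambda>t. u (x + t *\<^sub>R \<xi>)) \<circ> (\<lambda>t. t + 1))"
    by (simp add: seg_op_def o_def algebra_simps)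
  also have "\<dots> = integral {1..L+1} (\<lambda>t. u (x + t *\<^sub>R \<xi>))"
    by (subst integral_shift[OF c']) simp
  also have "seg_op (L + 1) \<xi> u x = integral {0..1} (\<lambda>t. u (x + t *\<^sub>R \<xi>)) + integral {1..L+1} (\<lambda>t. u (x + t *\<^sub>R \<xi>))"
    unfolding seg_op_def using L
    by (intro Henstock_Kurzweil_Integration.integral_combine[symmetric] integrable_continuous_interval c') auto
  finally show "diff_op \<xi> (ray_op \<xi> u) x = seg_op 1 \<xi> u x" by (simp add: seg_op_def)
qed

lemma factor_op_eq_diff_ray:
  assumes l: "linear l" "a > 0 \<Longrightarrow> l \<xi> > 0" and u: "vanishes_above l u"
  shows "factor_op \<xi> a u = diff_op \<xi> ((ray_op \<xi> ^^ a) u)"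
proof (cases a)
  case (Suc k)
  have lx: "l \<xi> > 0" using l Suc by simp
  have "(ray_op \<xi> ^^ k) (diff_op \<xi> v) = diff_op \<xi> ((ray_op \<xi> ^^ k) v)" if "vanishes_above l v" for v
  proof (induction k)
    case (Suc k)
    then show ?case
      using ray_op_diff_op[OF l(1) lx vanishes_above_ray_funpow[OF l(1) _ that], of k \<xi>] lx by simp
  qed simp
  from this[OF vanishes_above_ray_op[OF l(1) lx u]]
  have "(ray_op \<xi> ^^ k) (seg_op 1 \<xi> u) = diff_op \<xi> ((ray_op \<xi> ^^ k) (ray_op \<xi> u))"
    by (simp add: diff_op_ray_op[OF l(1) lx u])
  then show ?thesis by (simp add: factor_op_def Suc funpow_swap1)
qed (simp add: factor_op_def)

lemma ray_funpow_sum_mset: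
  assumes l: "linear l" "k > 0 \<Longrightarrow> l \<xi> > 0" and u: "vanishes_above l u"
  shows "vanishes_above l (\<lambda>x. \<Sum>(b, p)\<in>#S. b * u (x + p)) \<and>
    (ray_op \<xi> ^^ k) (\<lambda>x. \<Sum>(b, p)\<in>#S. b * u (x + p)) = (\<lambda>x. \<Sum>(b, p)\<in>#S. b * (ray_op \<xi> ^^ k) u (x + p))"
proof -
  have v: "vanishes_above l (\<lambda>x. \<Sum>(b, p)\<in>#S. b * u (x + p))" if u: "vanishes_above l u" for u
  proof (induction S)
    case empty then show ?case by (simp add: vanishes_above_def)
  next
    case (add z S)
    obtain b p where z: "z = (b, p)" by force
    from u obtain C where C: "\<And>x. l x > C \<Longrightarrow> u x = 0" and c: "continuous_on UNIV u"
      by (auto simp: vanishes_above_def)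
    from add obtain C' where C': "\<And>x. l x > C' \<Longrightarrow> (\<Sum>(b, p)\<in>#S. b * u (x + p)) = 0"
      and c': "continuous_on UNIV (\<lambda>x. (\<Sum>(b, p)\<in>#S. b * u (x + p)))"
      by (auto simp: vanishes_above_def)
    have "continuous_on UNIV (\<lambda>x. b * u (x + p) + (\<Sum>(b, p)\<in>#S. b * u (x + p)))"
      by (intro continuous_intros c' continuous_on_compose2[OF c]) auto
    moreover have "b * u (x + p) + (\<Sum>(b, p)\<in>#S. b * u (x + p)) = 0" if "l x > max C' (C - l p)" for x
      using that l C[of "x + p"] C'[of x] by (simp add: linear_add)
    ultimately show ?case by (auto simp: z vanishes_above_def simp del: max_less_iff_conj)
  qed
  have r: "ray_op \<xi> (\<lambda>x. \<Sum>(b, p)\<in>#S. b * u (x + p)) = (\<lambda>x. \<Sum>(b, p)\<in>#S. b * ray_op \<xi> u (x + p))"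
    if u: "vanishes_above l u" and lx: "l \<xi> > 0" for u
  proof
    fix x
    have i: "((\<lambda>t. u (y + t *\<^sub>R \<xi>)) has_integral ray_op \<xi> u y) {0..}" for y
      using has_integral_ray_funpow[OF l(1) lx u, of 0 y] by simp
    have "((\<lambda>t. \<Sum>(b, p)\<in>#S. b * u ((x + t *\<^sub>R \<xi>) + p)) has_integral (\<Sum>(b, p)\<in>#S. b * ray_op \<xi> u (x + p))) {0..}"
    proof (induction S)
      case (add z S)
      obtain b p where z: "z = (b, p)" by force
      have "((\<lambda>t. b * u ((x + t *\<^sub>R \<xi>) + p)) has_integral b * ray_op \<xi> u (x + p)) {0..}"
        using has_integral_mult_right[OF i[of "x + p"], of b] by (simp add: algebra_simps)
      from has_integral_add[OF this add] show ?case by (simp add: z)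
    qed simp
    then show "ray_op \<xi> (\<lambda>x. \<Sum>(b, p)\<in>#S. b * u (x + p)) x = (\<Sum>(b, p)\<in>#S. b * ray_op \<xi> u (x + p))"
      unfolding ray_op_def[of _ "\<lambda>x. \<Sum>(b, p)\<in>#S. b * u (x + p)"] by (rule integral_unique)
  qed
  show ?thesis
  proof (intro conjI v[OF u])
    show "(ray_op \<xi> ^^ k) (\<lambda>x. \<Sum>(b, p)\<in>#S. b * u (x + p)) = (\<lambda>x. \<Sum>(b, p)\<in>#S. b * (ray_op \<xi> ^^ k) u (x + p))"
      using l(2)
    proof (induction k)
      case (Suc k)
      then show ?case using r[OF vanishes_above_ray_funpow[OF l(1) _ u], of k] by simp
    qed simp
  qed
qed

lemma vanishes_above_ray_powers:
  assumes "linear l" "\<And>i. i \<in> set js \<Longrightarrow> a i > 0 \<Longrightarrow> l (d i) > 0" "vanishes_above l \<phi>"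
  shows "vanishes_above l (ray_powers d a js \<phi>)"
  using assms(2) unfolding ray_powers_def
  by (induction js) (auto intro!: vanishes_above_ray_funpow[OF assms(1)] assms(3))

lemma ray_powers_shift:
  "ray_powers ((!) (\<xi> # \<Xi>)) ((!) (a # \<alpha>)) [0..<Suc (length \<Xi>)] \<phi> =
   (ray_op \<xi> ^^ a) (ray_powers ((!) \<Xi>) ((!) \<alpha>) [0..<length \<Xi>] \<phi>)"
  by (simp add: ray_powers_def upt_conv_Cons map_Suc_upt[symmetric] foldr_map o_def del: upt_Suc)

lemma sum_mset_uminus: "(\<Sum>z\<in>#S. - f z) = - (\<Sum>z\<in>#S. f z :: real)"
  by (induction S) auto

text \<open>
  Once all directions with nonzero exponent lie in a half-space, the differences can be pulled out of
  the rays; their product is a signed sum of translations, enumerated by \<open>diff_mset\<close>.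
\<close>

lemma spline_op_eq_sum_ray_powers:
  assumes "linear l" "vanishes_above l \<phi>" "length \<alpha> = length \<Xi>"
    and "\<And>i. i < length \<Xi> \<Longrightarrow> \<alpha> ! i > 0 \<Longrightarrow> l (\<Xi> ! i) > 0"
  shows "spline_op \<Xi> \<alpha> \<phi> = (\<lambda>x. \<Sum>(b, p)\<in>#diff_mset \<Xi>. b * ray_powers ((!) \<Xi>) ((!) \<alpha>) [0..<length \<Xi>] \<phi> (x + p))"
  using assms(3,4)
proof (induction \<Xi> arbitrary: \<alpha>)
  case Nil
  then show ?case by (simp add: ray_powers_def)
next
  case (Cons \<xi> \<Xi>)
  then obtain a \<alpha>' where \<alpha>: "\<alpha> = a # \<alpha>'" by (cases \<alpha>) auto
  let ?H = "ray_powers ((!) \<Xi>) ((!) \<alpha>') [0..<length \<Xi>] \<phi>"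
  have pos: "i < length \<Xi> \<Longrightarrow> \<alpha>' ! i > 0 \<Longrightarrow> l (\<Xi> ! i) > 0" for i
    using Cons.prems(2)[of "Suc i"] by (simp add: \<alpha>)
  have IH: "spline_op \<Xi> \<alpha>' \<phi> = (\<lambda>x. \<Sum>(b, p)\<in>#diff_mset \<Xi>. b * ?H (x + p))"
    using Cons.prems pos by (intro Cons.IH) (auto simp: \<alpha>)
  have a: "a > 0 \<Longrightarrow> l \<xi> > 0" using Cons.prems(2)[of 0] by (simp add: \<alpha>)
  have H: "vanishes_above l ?H"
    by (rule vanishes_above_ray_powers[OF assms(1) _ assms(2)]) (use pos in auto)
  note S = ray_funpow_sum_mset[OF assms(1) a H]
  have "spline_op (\<xi> # \<Xi>) \<alpha> \<phi> = diff_op \<xi> ((ray_op \<xi> ^^ a) (\<lambda>x. \<Sum>(b, p)\<in>#diff_mset \<Xi>. b * ?H (x + p)))"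
    using S a by (simp add: \<alpha> IH factor_op_eq_diff_ray[OF assms(1)])
  also have "\<dots> = diff_op \<xi> (\<lambda>x. \<Sum>(b, p)\<in>#diff_mset \<Xi>. b * (ray_op \<xi> ^^ a) ?H (x + p))"
    using S[where S = "diff_mset \<Xi>"] by simp
  also have "\<dots> = (\<lambda>x. \<Sum>(b, p)\<in>#diff_mset (\<xi> # \<Xi>). b * (ray_op \<xi> ^^ a) ?H (x + p))"
    by (simp add: diff_op_def[abs_def] image_mset.compositionality o_def split_def add_ac sum_mset_uminus)
  finally show ?case by (simp add: \<alpha> ray_powers_shift del: upt_Suc)
qed

section \<open>Green functions of bases\<close>

lemma bij_betw_axis_index: "bij_betw axis_index (UNIV :: 's::finite set) {..<CARD('s)}"
proof -
  have "\<exists>f. bij_betw f (UNIV :: 's set) {0..<CARD('s)}"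
    by (rule ex_bij_betw_finite_nat) simp
  then show ?thesis unfolding axis_index_def lessThan_atLeast0 by (rule someI_ex)
qed

lemma axis_index_less: "axis_index (j :: 's::finite) < CARD('s)"
  using bij_betw_axis_index by (auto simp: bij_betw_def)

lemma axis_index_inv: "i < CARD('s) \<Longrightarrow> axis_index (inv_into UNIV axis_index i :: 's::finite) = i"
  using bij_betw_axis_index[where 's = 's] by (auto simp: bij_betw_def intro: f_inv_into_f)

lemma inv_axis_index: "inv_into UNIV axis_index (axis_index j) = (j :: 's::finite)"
  using bij_betw_axis_index[where 's = 's] by (auto simp: bij_betw_def)

text \<open>
  The direction that serves as column \<open>j\<close> of \<open>sub_matrix\<close>.
\<close>

definition position :: "nat list \<Rightarrow> 's::finite \<Rightarrow> nat" where
  "position \<alpha> j = nonzero_positions \<alpha> ! axis_index j"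

lemma length_nonzero_positions: "length (nonzero_positions \<alpha>) = norm0 \<alpha>"
proof -
  have "norm0 \<alpha> = length (filter (\<lambda>a. a \<noteq> 0) (map ((!) \<alpha>) [0..<length \<alpha>]))"
    by (simp only: map_nth norm0_def)
  then show ?thesis
    by (simp add: nonzero_positions_def filter_map o_def)
qed

lemma nonzero_positions_eq_map:
  assumes "norm0 \<alpha> = CARD('s)"
  obtains js :: "'s::finite list" where "distinct js" "set js = UNIV"
    "nonzero_positions \<alpha> = map (position \<alpha>) js"
proof
  let ?js = "map (inv_into UNIV axis_index) [0..<CARD('s)] :: 's list"
  have "inj_on (inv_into UNIV axis_index :: nat \<Rightarrow> 's) {..<CARD('s)}"
    by (rule inj_on_inverseI[of _ axis_index]) (auto intro: axis_index_inv)
  then show "distinct ?js" by (simp add: distinct_map atLeast0LessThan)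
  have "j \<in> set ?js" for j
    using axis_index_less[of j] by (auto intro!: image_eqI[of _ _ "axis_index j"] simp: inv_axis_index)
  then show "set ?js = UNIV" by auto
  show "nonzero_positions \<alpha> = map (position \<alpha>) ?js"
    by (rule nth_equalityI) (auto simp: length_nonzero_positions assms position_def axis_index_inv)
qed

lemma range_position:
  assumes "norm0 \<alpha> = CARD('s)"
  shows "range (position \<alpha> :: 's::finite \<Rightarrow> nat) = {i. i < length \<alpha> \<and> \<alpha> ! i \<noteq> 0}"
proof -
  obtain js :: "'s list" where "set js = UNIV" "nonzero_positions \<alpha> = map (position \<alpha>) js"
    by (rule nonzero_positions_eq_map[OF assms])
  then have "range (position \<alpha> :: 's \<Rightarrow> nat) = set (nonzero_positions \<alpha>)" by simp
  then show ?thesis by (auto simp: nonzero_positions_def)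
qed

lemma inj_position:
  assumes "norm0 \<alpha> = CARD('s)"
  shows "inj (position \<alpha> :: 's::finite \<Rightarrow> nat)"
proof -
  obtain js :: "'s list" where "set js = UNIV" "nonzero_positions \<alpha> = map (position \<alpha>) js"
    by (rule nonzero_positions_eq_map[OF assms])
  moreover have "distinct (nonzero_positions \<alpha>)" by (simp add: nonzero_positions_def)
  ultimately show ?thesis by (metis distinct_map)
qed

lemma sub_matrix_mult:
  "sub_matrix \<Xi> \<alpha> *v t = (\<Sum>j\<in>UNIV. t $ j *\<^sub>R \<Xi> ! position \<alpha> j)"
  by (simp add: Finite_Cartesian_Product.vec_eq_iff matrix_vector_mult_def sub_matrix_def position_def mult.commute)

lemma sub_matrix_axis: "sub_matrix \<Xi> \<alpha> *v axis j 1 = \<Xi> ! position \<alpha> j"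
  by (simp add: sub_matrix_mult axis_def if_distrib if_distribR cong: if_cong)

lemma ray_powers_filter: "ray_powers d a js \<phi> = ray_powers d a (filter (\<lambda>i. a i \<noteq> 0) js) \<phi>"
  by (induction js) (auto simp: ray_powers_def)

lemma ray_powers_map: "ray_powers d a (map h js) \<phi> = ray_powers (d \<circ> h) (a \<circ> h) js \<phi>"
  by (simp add: ray_powers_def foldr_map o_def)

definition green :: "(real ^ 's) list \<Rightarrow> nat list \<Rightarrow> real ^ 's \<Rightarrow> real" where
  "green \<Xi> \<alpha> y = truncated_power (matrix_inv (sub_matrix \<Xi> \<alpha>) *v y) (mu \<alpha> - 1) / \<bar>Determinants.det (sub_matrix \<Xi> \<alpha>)\<bar>"

lemma truncated_power_eq_prod_kernel:
  "truncated_power y (mu \<alpha> - 1) = (\<Prod>j\<in>UNIV. power_kernel (\<alpha> ! position \<alpha> j) (y $ j))"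
  by (simp add: truncated_power_def power_kernel_def mu_def position_def)

lemma green_nonneg: "0 \<le> green \<Xi> \<alpha> y"
  by (auto simp: green_def truncated_power_eq_prod_kernel intro!: prod_nonneg power_kernel_nonneg)

lemma measurable_vec_component [measurable]: "(\<lambda>x :: real ^ 'n. x $ i) \<in> borel_measurable borel"
  by (intro borel_measurable_continuous_onI continuous_intros)

lemma measurable_green [measurable]: "green \<Xi> \<alpha> \<in> borel_measurable borel"
  unfolding green_def[abs_def] truncated_power_eq_prod_kernel by measurable

lemma vanishes_above_if_bounded_support:
  assumes l: "linear l" and c: "continuous_on UNIV \<phi>" and r: "\<And>x. norm x > r \<Longrightarrow> \<phi> x = 0"
  shows "vanishes_above l \<phi>"
proof -
  obtain B where B: "B > 0" "\<And>x. norm (l x) \<le> B * norm x" using linear_bounded_pos[OF l] by blast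
  have "\<phi> x = 0" if "l x > B * r" for x
  proof (rule r)
    have "B * r < B * norm x" using that B(2)[of x] by simp
    then show "norm x > r" using B by simp
  qed
  then show ?thesis using c by (auto simp: vanishes_above_def)
qed

lemma matrix_inv_mult:
  assumes "Determinants.det (A :: real ^ 'n ^ 'n) \<noteq> 0"
  shows "matrix_inv A ** A = Finite_Cartesian_Product.mat 1" "A ** matrix_inv A = Finite_Cartesian_Product.mat 1"
proof -
  have "\<exists>B. A ** B = Finite_Cartesian_Product.mat 1 \<and> B ** A = Finite_Cartesian_Product.mat 1"
    using assms by (simp add: invertible_det_nz[symmetric] invertible_def)
  from someI_ex[OF this]
  show "matrix_inv A ** A = Finite_Cartesian_Product.mat 1" "A ** matrix_inv A = Finite_Cartesian_Product.mat 1"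
    unfolding matrix_inv_def by auto
qed

text \<open>
  The sum of the coordinates with respect to the basis.
\<close>

lemma linear_positive_on_columns:
  assumes det: "Determinants.det (sub_matrix \<Xi> \<alpha> :: real ^ 's ^ 's) \<noteq> 0" and n: "norm0 \<alpha> = CARD('s)"
  obtains l :: "real ^ 's \<Rightarrow> real" where "linear l" "\<And>i. i < length \<alpha> \<Longrightarrow> \<alpha> ! i > 0 \<Longrightarrow> l (\<Xi> ! i) > 0"
proof
  let ?A = "sub_matrix \<Xi> \<alpha> :: real ^ 's ^ 's"
  let ?l = "\<lambda>v. \<Sum>j\<in>UNIV. (matrix_inv ?A *v v) $ j"
  show "linear ?l"
    by (rule linearI) (simp_all add: matrix_vector_right_distrib sum.distrib matrix_vector_mult_scaleR sum_distrib_left)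
  have inv: "matrix_inv ?A ** ?A = Finite_Cartesian_Product.mat 1"
    by (rule matrix_inv_mult(1)[OF det])
  fix i assume "i < length \<alpha>" "\<alpha> ! i > 0"
  then have "i \<in> range (position \<alpha> :: 's \<Rightarrow> nat)" by (simp add: range_position[OF n])
  then obtain j :: 's where j: "i = position \<alpha> j" by blast
  have "matrix_inv ?A *v (\<Xi> ! i) = axis j 1"
    unfolding j sub_matrix_axis[symmetric] matrix_vector_mul_assoc inv by simp
  then have "?l (\<Xi> ! i) = 1" by (simp add: axis_def)
  then show "?l (\<Xi> ! i) > 0" by simp
qed

text \<open>
  The iterated ray integral runs over the coordinates of the cone spanned by the basis; substituting
  \<open>y = p + \<Xi>\<^sub>\<alpha> t\<close> produces the determinant.
\<close>

lemma has_bochner_integral_green: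
  fixes \<Xi> :: "(real ^ 's) list"
  assumes n: "norm0 \<alpha> = CARD('s)" "length \<alpha> = length \<Xi>"
    and det: "Determinants.det (sub_matrix \<Xi> \<alpha> :: real ^ 's ^ 's) \<noteq> 0"
    and c: "continuous_on UNIV \<phi>" and r: "\<And>x. norm x > r \<Longrightarrow> \<phi> x = 0" and nn: "\<And>x. 0 \<le> \<phi> x"
  shows "has_bochner_integral lborel (\<lambda>y. green \<Xi> \<alpha> (y - p) * \<phi> y)
    (ray_powers ((!) \<Xi>) ((!) \<alpha>) [0..<length \<Xi>] \<phi> p)"
proof -
  let ?A = "sub_matrix \<Xi> \<alpha> :: real ^ 's ^ 's"
  let ?d = "\<lambda>j::'s. \<Xi> ! position \<alpha> j" and ?a = "\<lambda>j::'s. \<alpha> ! position \<alpha> j"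
  have inv: "matrix_inv ?A ** ?A = Finite_Cartesian_Product.mat 1"
    by (rule matrix_inv_mult(1)[OF det])
  obtain l :: "real ^ 's \<Rightarrow> real" where l: "linear l" "\<And>i. i < length \<alpha> \<Longrightarrow> \<alpha> ! i > 0 \<Longrightarrow> l (\<Xi> ! i) > 0"
    using linear_positive_on_columns[OF det n(1)] by blast
  have v: "vanishes_above l \<phi>" by (rule vanishes_above_if_bounded_support[OF l(1) c r])
  obtain js :: "'s list" where js: "distinct js" "set js = UNIV" "nonzero_positions \<alpha> = map (position \<alpha>) js"
    by (rule nonzero_positions_eq_map[OF n(1)])
  have [measurable]: "\<phi> \<in> borel_measurable borel" by (rule borel_measurable_continuous_onI[OF c])
  have pos: "?a j > 0" "position \<alpha> j < length \<alpha>" for j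
    using range_position[OF n(1)] by auto
  have rp: "ray_powers ((!) \<Xi>) ((!) \<alpha>) [0..<length \<Xi>] \<phi> = ray_powers ?d ?a js \<phi>"
    using ray_powers_filter[of "(!) \<Xi>" "(!) \<alpha>" "[0..<length \<Xi>]" \<phi>]
    unfolding n(2)[symmetric] nonzero_positions_def[symmetric] js(3)
    by (simp only: ray_powers_map o_def)
  have "ennreal (ray_powers ?d ?a js \<phi> p) =
    (\<integral>\<^sup>+ t. (\<Prod>i\<in>UNIV. ennreal (power_kernel (?a i) (t i))) * ennreal (\<phi> (p + (\<Sum>i\<in>UNIV. t i *\<^sub>R ?d i)))
     \<partial>(\<Pi>\<^sub>M i\<in>UNIV. lborel))"
    using nn_integral_ray_powers[OF l(1) js(1) _ v nn, of ?d ?a p] l(2) pos js(2) by (simp add: Suc_le_eq)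
  also have "\<dots> = (\<integral>\<^sup>+ t. (\<lambda>t. ennreal (truncated_power t (mu \<alpha> - 1)) * ennreal (\<phi> (p + ?A *v t))) (\<chi> i. t i) \<partial>(\<Pi>\<^sub>M i\<in>UNIV. lborel))"
    by (simp add: truncated_power_eq_prod_kernel sub_matrix_mult prod_ennreal power_kernel_nonneg)
  also have "\<dots> = (\<integral>\<^sup>+ t. ennreal (truncated_power t (mu \<alpha> - 1)) * ennreal (\<phi> (p + ?A *v t)) \<partial>lborel)"
    by (rule nn_integral_lborel_vec[symmetric]) (unfold truncated_power_eq_prod_kernel, measurable)
  also have "\<dots> = (\<integral>\<^sup>+ t. ennreal (green \<Xi> \<alpha> (?A *v t) * \<phi> (p + ?A *v t)) \<partial>lborel) * ennreal \<bar>Determinants.det ?A\<bar>"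
  proof -
    have "truncated_power t (mu \<alpha> - 1) = green \<Xi> \<alpha> (?A *v t) * \<bar>Determinants.det ?A\<bar>" for t
      using det by (simp add: green_def matrix_vector_mul_assoc inv)
    then have "(\<integral>\<^sup>+ t. ennreal (truncated_power t (mu \<alpha> - 1)) * ennreal (\<phi> (p + ?A *v t)) \<partial>lborel)
      = (\<integral>\<^sup>+ t. ennreal (green \<Xi> \<alpha> (?A *v t) * \<phi> (p + ?A *v t)) * ennreal \<bar>Determinants.det ?A\<bar> \<partial>lborel)"
      by (intro nn_integral_cong) (simp add: nn green_nonneg mult_ac flip: ennreal_mult)
    also have "\<dots> = (\<integral>\<^sup>+ t. ennreal (green \<Xi> \<alpha> (?A *v t) * \<phi> (p + ?A *v t)) \<partial>lborel) * ennreal \<bar>Determinants.det ?A\<bar>"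
      by (rule nn_integral_multc) measurable
    finally show ?thesis .
  qed
  also have "\<dots> = (\<integral>\<^sup>+ y. ennreal (green \<Xi> \<alpha> y * \<phi> (p + y)) \<partial>lborel)"
  proof -
    have "(\<lambda>y. ennreal (green \<Xi> \<alpha> y * \<phi> (p + y))) \<in> borel_measurable borel" by measurable
    then show ?thesis
      using scales_volume_if_invertible[OF det] unfolding scales_volume_by_det_def by fastforce
  qed
  also have "\<dots> = (\<integral>\<^sup>+ y. ennreal (green \<Xi> \<alpha> (y - p) * \<phi> y) \<partial>distr lborel borel ((+) p))"
    by (subst nn_integral_distr) auto
  also have "\<dots> = (\<integral>\<^sup>+ y. ennreal (green \<Xi> \<alpha> (y - p) * \<phi> y) \<partial>lborel)"
    by (simp add: lborel_distr_plus)
  finally have "(\<integral>\<^sup>+ y. ennreal (green \<Xi> \<alpha> (y - p) * \<phi> y) \<partial>lborel) = ennreal (ray_powers ?d ?a js \<phi> p)" ..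
  moreover have "0 \<le> ray_powers ?d ?a js \<phi> p"
    unfolding ray_powers_def using nn
    by (induction js arbitrary: p) (auto intro: ray_funpow_nonneg)
  ultimately show ?thesis unfolding rp
    by (intro has_bochner_integral_nn_integral) (auto simp: green_nonneg nn)
qed

section \<open>Kernel matrices in echelon form\<close>

lemma lead_props:
  assumes "v \<noteq> 0\<^sub>v n" "v \<in> carrier_vec n"
  shows "lead v < n" "v $v lead v \<noteq> 0" "i < lead v \<Longrightarrow> v $v i = 0"
proof -
  let ?S = "{i. i < dim_vec v \<and> v $v i \<noteq> 0}"
  have ne: "?S \<noteq> {}" using assms by (auto simp: Matrix.vec_eq_iff)
  have fin: "finite ?S" by simp
  have "lead v \<in> ?S" unfolding lead_def by (rule Min_in[OF fin ne])
  then show *: "lead v < n" "v $v lead v \<noteq> 0" using assms by auto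
  show "v $v i = 0" if "i < lead v"
  proof (rule ccontr)
    assume "v $v i \<noteq> 0"
    then have "lead v \<le> i" unfolding lead_def using that * assms by (intro Min_le[OF fin]) auto
    then show False using that by simp
  qed
qed

lemma lead_eqI:
  assumes "q < dim_vec v" "v $v q \<noteq> 0" "\<And>i. i < q \<Longrightarrow> v $v i = 0"
  shows "lead v = q"
  unfolding lead_def using assms by (intro Min_eqI) (auto simp: not_less[symmetric])

lemma kernel_matrix_cols:
  assumes "kernel_matrix X K" "j < dim_col K"
  shows "col K j \<in> mat_kernel X" "col K j \<noteq> 0\<^sub>v (dim_col X)"
proof -
  interpret kernel "dim_row X" "dim_col X" X by standard auto
  have b: "lin_indpt (set (cols K))" "set (cols K) \<subseteq> mat_kernel X"
    using assms Ker.basis_def[of "set (cols K)"] by (auto simp: kernel_matrix_def)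
  have c: "col K j \<in> set (cols K)" using assms(2) by (simp add: cols_def)
  then show "col K j \<in> mat_kernel X" using b by auto
  have "(UNIV :: real set) \<noteq> {0}" using UNIV_I[of "1 :: real"] by (metis singletonD zero_neq_one)
  from Ker.zero_nin_lin_indpt[OF b(2,1)] this c show "col K j \<noteq> 0\<^sub>v (dim_col X)" by auto
qed

lemma kernel_matrix_span:
  assumes "kernel_matrix X K" "v \<in> mat_kernel X"
  obtains t where "t \<in> carrier_vec (dim_col K)" "v = K *\<^sub>v t"
proof -
  interpret kernel "dim_row X" "dim_col X" X by standard auto
  have b: "gen_set (set (cols K))" "set (cols K) \<subseteq> mat_kernel X" and d: "dim_row K = dim_col X"
    using assms Ker.basis_def[of "set (cols K)"] by (auto simp: kernel_matrix_def)
  have c: "set (cols K) \<subseteq> carrier_vec (dim_col X)" using cols_dim[of K] d by simp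
  have "v \<in> NC.span (set (cols K))" using assms(2) b span_same[OF b(2)] by auto
  then have "v \<in> NC.span_list (cols K)" using NC.span_list_as_span[OF c] by simp
  then obtain f where "v = NC.lincomb_list f (cols K)" by (elim NC.in_span_listE)
  also have "\<dots> = mat_of_cols (dim_col X) (cols K) *\<^sub>v Matrix.vec (length (cols K)) f"
    using c by (intro NC.lincomb_list_as_mat_mult) auto
  also have "\<dots> = K *\<^sub>v Matrix.vec (dim_col K) f" using d by (metis cols_length mat_of_cols_cols)
  finally show ?thesis using that[of "Matrix.vec (dim_col K) f"] by simp
qed

lemma kernel_matrix_mult_in_kernel:
  assumes K: "kernel_matrix X K" and t: "t \<in> carrier_vec (dim_col K)"
  shows "K *\<^sub>v t \<in> mat_kernel X"
proof (rule mat_kernelI[of _ "dim_row X" "dim_col X"])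
  have d: "dim_row K = dim_col X" using K by (simp add: kernel_matrix_def)
  then show "K *\<^sub>v t \<in> carrier_vec (dim_col X)" by (intro mult_mat_vec_carrier[OF _ t]) auto
  have "X * K = 0\<^sub>m (dim_row X) (dim_col K)"
  proof (rule eq_matI)
    fix i j assume ij: "i < dim_row (0\<^sub>m (dim_row X) (dim_col K))" "j < dim_col (0\<^sub>m (dim_row X) (dim_col K))"
    then have "X *\<^sub>v col K j = 0\<^sub>v (dim_row X)"
      using kernel_matrix_cols(1)[OF K, of j] by (simp add: mat_kernel_def)
    then have "(X *\<^sub>v col K j) $v i = 0" using ij by simp
    then show "(X * K) $$ (i, j) = 0\<^sub>m (dim_row X) (dim_col K) $$ (i, j)" using ij by simp
  qed auto
  then have "(X * K) *\<^sub>v t = 0\<^sub>v (dim_row X)" using t by auto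
  moreover have "(X * K) *\<^sub>v t = X *\<^sub>v (K *\<^sub>v t)"
    by (rule assoc_mult_mat_vec[of _ "dim_row X" "dim_col X" _ "dim_col K"]) (use d t in auto)
  ultimately show "X *\<^sub>v (K *\<^sub>v t) = 0\<^sub>v (dim_row X)" by simp
qed auto

lemma mult_mat_vec_nth:
  assumes "t \<in> carrier_vec (dim_col K)" "i < dim_row K"
  shows "(K *\<^sub>v t) $v i = (\<Sum>j<dim_col K. K $$ (i, j) * t $v j)"
  using assms by (simp add: scalar_prod_def atLeast0LessThan)

text \<open>
  The leading entry of \<open>K t\<close> is governed by the first nonzero entry of \<open>t\<close>, because later columns
  of \<open>K\<close> start strictly below.
\<close>

lemma column_echelon_mult:
  assumes K: "kernel_matrix X K" and t: "t \<in> carrier_vec (dim_col K)"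
    and l: "l < dim_col K" and z: "\<And>j. j < l \<Longrightarrow> t $v j = 0"
  shows "i < lead (col K l) \<Longrightarrow> (K *\<^sub>v t) $v i = 0"
    and "(K *\<^sub>v t) $v lead (col K l) = K $$ (lead (col K l), l) * t $v l"
proof -
  have d: "dim_row K = dim_col X" and ech: "column_echelon K" using K by (auto simp: kernel_matrix_def)
  note lp = lead_props[OF kernel_matrix_cols(2)[OF K l], unfolded d[symmetric], OF col_carrier_vec[OF l carrier_matI[OF refl refl]]]
  have zl: "K $$ (i, l) = 0" if "i < lead (col K l)" for i
    using lp(3)[OF that] lp(1) that l d by simp
  have zj: "K $$ (i, j) = 0" if "i \<le> lead (col K l)" "j > l" "j < dim_col K" for i j
    using ech that zl lp(1) unfolding column_echelon_def by (meson le_less_trans less_le_trans)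
  have "(K *\<^sub>v t) $v i = K $$ (i, l) * t $v l" if "i \<le> lead (col K l)" for i
  proof -
    have "(K *\<^sub>v t) $v i = (\<Sum>j<dim_col K. K $$ (i, j) * t $v j)"
      using that lp(1) by (intro mult_mat_vec_nth t) auto
    also have "\<dots> = (\<Sum>j\<in>{l}. K $$ (i, j) * t $v j)"
    proof (rule sum.mono_neutral_right)
      show "\<forall>j\<in>{..<dim_col K} - {l}. K $$ (i, j) * t $v j = 0"
      proof
        fix j assume "j \<in> {..<dim_col K} - {l}"
        then show "K $$ (i, j) * t $v j = 0" using z[of j] zj[OF that, of j] by (cases j l rule: linorder_cases) auto
      qed
    qed (use l in auto)
    finally show ?thesis by simp
  qed
  then show "i < lead (col K l) \<Longrightarrow> (K *\<^sub>v t) $v i = 0"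
    and "(K *\<^sub>v t) $v lead (col K l) = K $$ (lead (col K l), l) * t $v l"
    using zl by auto
qed

lemma kernel_matrix_dim_col_pos:
  assumes K: "kernel_matrix X K" and v: "v \<in> mat_kernel X" "v \<noteq> 0\<^sub>v (dim_col X)"
  shows "0 < dim_col K"
proof (rule ccontr)
  assume "\<not> 0 < dim_col K"
  moreover obtain t where "t \<in> carrier_vec (dim_col K)" "v = K *\<^sub>v t" by (rule kernel_matrix_span[OF K v(1)])
  moreover have "dim_row K = dim_col X" using K by (simp add: kernel_matrix_def)
  ultimately have "v = 0\<^sub>v (dim_col X)" by (intro eq_vecI) (auto simp: scalar_prod_def)
  then show False using v by simp
qed

lemma kernel_matrix_first_col_lead:
  assumes K: "kernel_matrix X K" and v: "v \<in> mat_kernel X" and "0 < dim_col K" "i < lead (col K 0)"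
  shows "v $v i = 0"
proof -
  obtain t where "t \<in> carrier_vec (dim_col K)" "v = K *\<^sub>v t" by (rule kernel_matrix_span[OF K v])
  then show ?thesis using column_echelon_mult(1)[OF K _ assms(3)] assms(4) by auto
qed

text \<open>
  The relations still available at \<open>\<alpha>\<close>: those among the directions with nonzero exponent.
\<close>

definition syzygies :: "(real ^ 's) list \<Rightarrow> nat list \<Rightarrow> real Matrix.vec set" where
  "syzygies \<Xi> \<alpha> = {v \<in> carrier_vec (length \<Xi>). (\<Sum>j<length \<Xi>. v $v j *\<^sub>R \<Xi> ! j) = 0 \<and>
     (\<forall>j<length \<Xi>. \<alpha> ! j = 0 \<longrightarrow> v $v j = 0)}"

lemma mat_kernel_dir_mat:
  fixes \<Xi> :: "(real ^ 's) list"
  shows "v \<in> mat_kernel (dir_mat \<Xi>) \<longleftrightarrow>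
    v \<in> carrier_vec (length \<Xi>) \<and> (\<Sum>j<length \<Xi>. v $v j *\<^sub>R \<Xi> ! j) = 0"
proof -
  let ?s = "\<Sum>j<length \<Xi>. v $v j *\<^sub>R \<Xi> ! j"
  have dims: "dim_row (dir_mat \<Xi>) = CARD('s)" "dim_col (dir_mat \<Xi>) = length \<Xi>" by (auto simp: dir_mat_def)
  have "dir_mat \<Xi> *\<^sub>v v = 0\<^sub>v CARD('s) \<longleftrightarrow> ?s = 0" if v: "v \<in> carrier_vec (length \<Xi>)"
  proof -
    have nth: "(dir_mat \<Xi> *\<^sub>v v) $v i = ?s $ inv_into UNIV axis_index i" if "i < CARD('s)" for i
      using that v mult_mat_vec_nth[of v "dir_mat \<Xi>" i] dims
      by (simp add: dir_mat_def mult.commute)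
    show ?thesis
    proof
      assume "dir_mat \<Xi> *\<^sub>v v = 0\<^sub>v CARD('s)"
      then have "?s $ inv_into UNIV axis_index i = 0" if "i < CARD('s)" for i
        using nth[OF that] that by simp
      from this[OF axis_index_less] have "?s $ j = 0" for j by (simp add: inv_axis_index)
      then show "?s = 0" by (simp add: Finite_Cartesian_Product.vec_eq_iff)
    next
      assume "?s = 0"
      show "dir_mat \<Xi> *\<^sub>v v = 0\<^sub>v CARD('s)"
      proof (rule eq_vecI)
        fix i assume "i < dim_vec (0\<^sub>v CARD('s) :: real Matrix.vec)"
        then show "(dir_mat \<Xi> *\<^sub>v v) $v i = 0\<^sub>v CARD('s) $v i"
          using nth[of i] \<open>?s = 0\<close> by (simp only: index_zero_vec zero_index)
      qed (simp add: dims)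
    qed
  qed
  then show ?thesis by (auto simp: mat_kernel_def dims)
qed

text \<open>
  The echelon forms of \<open>K\<close> and of the kernel matrix of \<open>C\<^sub>\<alpha>\<close> combine.  A relation in \<open>syzygies \<Xi> \<alpha>\<close>
  is \<open>K t\<close> with \<open>t\<close> in the null-space of \<open>C\<^sub>\<alpha>\<close>.  The first column of the inner kernel matrix has
  the least leading position among all such \<open>t\<close>, and leading positions increase along the columns of
  \<open>K\<close>.
\<close>

lemma nu_props:
  fixes \<Xi> :: "(real ^ 's) list"
  assumes ker: "\<And>X. kernel_matrix X (ker X)" and len: "length \<alpha> = length \<Xi>"
    and w0: "w0 \<in> syzygies \<Xi> \<alpha>" "w0 \<noteq> 0\<^sub>v (length \<Xi>)"
  shows "nu ker \<Xi> \<alpha> \<in> syzygies \<Xi> \<alpha>" "nu ker \<Xi> \<alpha> \<noteq> 0\<^sub>v (length \<Xi>)"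
    "w \<in> syzygies \<Xi> \<alpha> \<Longrightarrow> i < lead (nu ker \<Xi> \<alpha>) \<Longrightarrow> w $v i = 0"
proof -
  define n where "n = length \<Xi>"
  define X where "X = dir_mat \<Xi>"
  define K where "K = ker X"
  have K: "kernel_matrix X K" by (simp add: K_def ker)
  have dX: "dim_col X = n" by (simp add: X_def n_def dir_mat_def)
  have dK: "dim_row K = n" using K dX by (simp add: kernel_matrix_def)
  have W: "v \<in> syzygies \<Xi> \<alpha> \<longleftrightarrow> v \<in> mat_kernel X \<and> (\<forall>j<n. \<alpha> ! j = 0 \<longrightarrow> v $v j = 0)" for v
    unfolding syzygies_def X_def n_def mat_kernel_dir_mat by blast
  have K0: "0 < dim_col K"
    by (rule kernel_matrix_dim_col_pos[OF K]) (use w0 W dX n_def in auto)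
  have "nu ker \<Xi> \<alpha> \<in> syzygies \<Xi> \<alpha> \<and> nu ker \<Xi> \<alpha> \<noteq> 0\<^sub>v n \<and>
    (\<forall>w\<in>syzygies \<Xi> \<alpha>. \<forall>i<lead (nu ker \<Xi> \<alpha>). w $v i = 0)"
  proof (cases "norm0 \<alpha> = length \<Xi>")
    case True
    then have nu: "nu ker \<Xi> \<alpha> = col K 0" by (simp add: nu_def K_def X_def)
    have a: "\<alpha> ! j \<noteq> 0" if "j < n" for j
    proof
      assume "\<alpha> ! j = 0"
      then have "length (filter (\<lambda>a. a \<noteq> 0) \<alpha>) < length \<alpha>"
        using that len nth_mem[of j \<alpha>] by (intro length_filter_less[of "\<alpha> ! j"]) (auto simp: n_def)
      then show False using True len by (simp add: norm0_def)
    qed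
    then have "v \<in> syzygies \<Xi> \<alpha> \<longleftrightarrow> v \<in> mat_kernel X" for v using W a by blast
    then show ?thesis unfolding nu
      using kernel_matrix_cols[OF K K0] kernel_matrix_first_col_lead[OF K _ K0] dX by auto
  next
    case False
    define zs where "zs = [j \<leftarrow> [0..<n]. \<alpha> ! j = 0]"
    define C where "C = mat_of_rows (dim_col K) [row K j. j \<leftarrow> [0..<length \<Xi>], \<alpha> ! j = 0]"
    have C: "C = mat_of_rows (dim_col K) (map (row K) zs)"
    proof -
      have "[row K j. j \<leftarrow> js, \<alpha> ! j = 0] = map (row K) [j \<leftarrow> js. \<alpha> ! j = 0]" for js
        by (induction js) auto
      then show ?thesis by (simp add: C_def zs_def n_def)
    qed
    define T where "T = ker C"
    have T: "kernel_matrix C T" by (simp add: T_def ker)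
    have dC: "dim_col C = dim_col K" by (simp add: C)
    have dT: "dim_row T = dim_col K" using T dC by (simp add: kernel_matrix_def)
    have nu: "nu ker \<Xi> \<alpha> = K *\<^sub>v col T 0" using False unfolding nu_def Let_def T_def C_def K_def X_def by simp
    have kerC: "t \<in> mat_kernel C \<longleftrightarrow> t \<in> carrier_vec (dim_col K) \<and> (\<forall>j<n. \<alpha> ! j = 0 \<longrightarrow> (K *\<^sub>v t) $v j = 0)" for t
    proof -
      have "C *\<^sub>v t = 0\<^sub>v (dim_row C) \<longleftrightarrow> (\<forall>i<length zs. (K *\<^sub>v t) $v (zs ! i) = 0)" if "t \<in> carrier_vec (dim_col K)"
      proof -
        have z: "zs ! i < n" if "i < length zs" for i
          using nth_mem[OF that] by (auto simp: zs_def)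
        have "(C *\<^sub>v t) $v i = (K *\<^sub>v t) $v (zs ! i)" if "i < length zs" for i
          using that z[OF that] by (simp add: C dK mat_of_rows_row)
        then show ?thesis by (auto simp: Matrix.vec_eq_iff C)
      qed
      moreover have "(\<forall>i<length zs. (K *\<^sub>v t) $v (zs ! i) = 0) \<longleftrightarrow> (\<forall>j<n. \<alpha> ! j = 0 \<longrightarrow> (K *\<^sub>v t) $v j = 0)"
        unfolding all_set_conv_all_nth[of zs "\<lambda>j. (K *\<^sub>v t) $v j = 0", symmetric] by (auto simp: zs_def)
      ultimately show ?thesis by (auto simp: mat_kernel_def dC)
    qed
    have lift: "\<exists>t. t \<in> mat_kernel C \<and> w = K *\<^sub>v t" if "w \<in> syzygies \<Xi> \<alpha>" for w
    proof -
      from that have "w \<in> mat_kernel X" by (simp add: W)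
      then obtain t where "t \<in> carrier_vec (dim_col K)" "w = K *\<^sub>v t" by (rule kernel_matrix_span[OF K])
      then show ?thesis using that by (auto simp: kerC W)
    qed
    obtain t0 where t0: "t0 \<in> mat_kernel C" "w0 = K *\<^sub>v t0" using lift[OF w0(1)] by blast
    have "t0 \<noteq> 0\<^sub>v (dim_col C)"
    proof
      assume "t0 = 0\<^sub>v (dim_col C)"
      then have "w0 = 0\<^sub>v n" using t0(2) dK by (intro eq_vecI) (simp_all add: dC)
      then show False using w0(2) by (simp add: n_def)
    qed
    from kernel_matrix_dim_col_pos[OF T t0(1) this] have T0: "0 < dim_col T" .
    let ?t = "col T 0"
    have t: "?t \<in> mat_kernel C" "?t \<noteq> 0\<^sub>v (dim_col K)" using kernel_matrix_cols[OF T T0] dC by auto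
    have tc: "?t \<in> carrier_vec (dim_col K)" using t by (simp add: kerC)
    define l where "l = lead ?t"
    have l: "l < dim_col K" "?t $v l \<noteq> 0" "\<And>j. j < l \<Longrightarrow> ?t $v j = 0"
      using lead_props[OF t(2) tc] by (auto simp: l_def)
    define q where "q = lead (col K l)"
    have q: "q < n" "col K l $v q \<noteq> 0"
    proof -
      have c: "col K l \<noteq> 0\<^sub>v n" "col K l \<in> carrier_vec n"
        using kernel_matrix_cols(2)[OF K l(1)] col_carrier_vec[OF l(1) carrier_matI[OF dK refl]]
        unfolding dX .
      show "q < n" "col K l $v q \<noteq> 0" unfolding q_def using lead_props(1,2)[OF c] .
    qed
    have Kt: "(K *\<^sub>v ?t) $v q \<noteq> 0" "\<And>i. i < q \<Longrightarrow> (K *\<^sub>v ?t) $v i = 0"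
      using column_echelon_mult[OF K tc l(1,3)] q l by (simp_all add: q_def[symmetric] dK)
    have lead: "lead (nu ker \<Xi> \<alpha>) = q"
      unfolding nu using Kt q by (intro lead_eqI) (auto simp: dK)
    have "nu ker \<Xi> \<alpha> \<in> syzygies \<Xi> \<alpha>"
      unfolding nu W using kernel_matrix_mult_in_kernel[OF K tc] t by (auto simp: kerC)
    moreover have "nu ker \<Xi> \<alpha> \<noteq> 0\<^sub>v n" using Kt(1) q(1) unfolding nu by auto
    moreover have "w $v i = 0" if w: "w \<in> syzygies \<Xi> \<alpha>" "i < q" for w i
    proof -
      obtain t' where t': "t' \<in> mat_kernel C" "w = K *\<^sub>v t'" using lift[OF w(1)] by blast
      have "t' $v j = 0" if "j < l" for j
        using kernel_matrix_first_col_lead[OF T t'(1) T0] that by (simp add: l_def)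
      then show ?thesis
        using column_echelon_mult(1)[OF K _ l(1), of t' i] t' w(2) by (simp add: kerC q_def)
    qed
    ultimately show ?thesis unfolding lead by blast
  qed
  then show "nu ker \<Xi> \<alpha> \<in> syzygies \<Xi> \<alpha>" "nu ker \<Xi> \<alpha> \<noteq> 0\<^sub>v (length \<Xi>)"
    "w \<in> syzygies \<Xi> \<alpha> \<Longrightarrow> i < lead (nu ker \<Xi> \<alpha>) \<Longrightarrow> w $v i = 0"
    unfolding n_def by blast+
qed

section \<open>The exponent multisets\<close>

text \<open>
  Repeated directions count as dependent, hence the distinction whether \<open>(!) \<Xi>\<close> is injective on \<open>J\<close>.
\<close>

lemma exists_family_relation:
  fixes \<Xi> :: "(real ^ 's) list"
  assumes J: "J \<subseteq> {..<length \<Xi>}"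
    and dep: "\<not> inj_on ((!) \<Xi>) J \<or> Real_Vector_Spaces.dependent ((!) \<Xi> ` J)"
  obtains w :: "real Matrix.vec" where "w \<in> carrier_vec (length \<Xi>)" "w \<noteq> 0\<^sub>v (length \<Xi>)"
    "(\<Sum>j<length \<Xi>. w $v j *\<^sub>R \<Xi> ! j) = 0" "\<And>j. j < length \<Xi> \<Longrightarrow> j \<notin> J \<Longrightarrow> w $v j = 0"
proof -
  have fin: "finite J" using J finite_subset by blast
  have "\<exists>f. (\<exists>j\<in>J. f j \<noteq> 0) \<and> (\<Sum>j\<in>J. f j *\<^sub>R \<Xi> ! j) = (0 :: real ^ 's)"
  proof (cases "inj_on ((!) \<Xi>) J")
    case True
    with dep have "Real_Vector_Spaces.dependent ((!) \<Xi> ` J)" by simp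
    then obtain u v where v: "v \<in> (!) \<Xi> ` J" "u v \<noteq> (0::real)" and s: "(\<Sum>v\<in>(!) \<Xi> ` J. u v *\<^sub>R v) = 0"
      using fin by (subst (asm) real_vector.dependent_finite) auto
    from s have "(\<Sum>j\<in>J. u (\<Xi> ! j) *\<^sub>R \<Xi> ! j) = 0" by (simp add: sum.reindex[OF True])
    then show ?thesis using v by (intro exI[of _ "\<lambda>j. u (\<Xi> ! j)"]) auto
  next
    case False
    then obtain i j where ij: "i \<in> J" "j \<in> J" "i \<noteq> j" "\<Xi> ! i = \<Xi> ! j" by (auto simp: inj_on_def)
    define f where "f k = (if k = i then 1 else if k = j then -1 else 0 :: real)" for k
    have "(\<Sum>k\<in>J. f k *\<^sub>R \<Xi> ! k) = (\<Sum>k\<in>{i,j}. f k *\<^sub>R \<Xi> ! k)"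
      using fin ij by (intro sum.mono_neutral_right) (auto simp: f_def)
    also have "\<dots> = 0" using ij by (simp add: f_def)
    finally show ?thesis using ij by (intro exI[of _ f]) (auto simp: f_def)
  qed
  then obtain f j0 where f: "j0 \<in> J" "f j0 \<noteq> 0" "(\<Sum>j\<in>J. f j *\<^sub>R \<Xi> ! j) = (0 :: real ^ 's)" by blast
  define w where "w = Matrix.vec (length \<Xi>) (\<lambda>j. if j \<in> J then f j else 0)"
  have "(\<Sum>j<length \<Xi>. w $v j *\<^sub>R \<Xi> ! j) = (\<Sum>j\<in>J. f j *\<^sub>R \<Xi> ! j)"
    using J by (intro sum.mono_neutral_cong_right) (auto simp: w_def)
  moreover have "w $v j0 \<noteq> 0" "j0 < length \<Xi>" using f J by (auto simp: w_def)
  then have "w \<noteq> 0\<^sub>v (length \<Xi>)" by auto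
  ultimately show ?thesis using f by (intro that[of w]) (auto simp: w_def)
qed

lemma mem_span_list:
  fixes \<Xi> :: "(real ^ 's) list"
  assumes "x \<in> Real_Vector_Spaces.span (set \<Xi>)"
  obtains t where "x = (\<Sum>j<length \<Xi>. t j *\<^sub>R \<Xi> ! j)"
proof -
  let ?S = "range (\<lambda>t. \<Sum>j<length \<Xi>. t j *\<^sub>R \<Xi> ! j)"
  have "Real_Vector_Spaces.span (set \<Xi>) \<subseteq> ?S"
  proof (rule real_vector.span_minimal)
    show "set \<Xi> \<subseteq> ?S"
    proof
      fix v assume "v \<in> set \<Xi>"
      then obtain i where i: "i < length \<Xi>" "v = \<Xi> ! i" by (auto simp: in_set_conv_nth)
      have "v = (\<Sum>j<length \<Xi>. (if j = i then 1 else 0) *\<^sub>R \<Xi> ! j)"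
      proof -
        have "(\<Sum>j<length \<Xi>. (if j = i then 1 else 0) *\<^sub>R \<Xi> ! j) = (\<Sum>j\<in>{i}. (if j = i then 1 else 0) *\<^sub>R \<Xi> ! j)"
          using i by (intro sum.mono_neutral_right) auto
        then show ?thesis using i by simp
      qed
      then show "v \<in> ?S" by (rule range_eqI[of _ _ "\<lambda>j. if j = i then 1 else 0"])
    qed
    show "Real_Vector_Spaces.subspace ?S"
      unfolding real_vector.subspace_def
    proof (safe intro!: rangeI)
      show "0 \<in> ?S" by (intro range_eqI[of _ _ "\<lambda>_. 0"]) simp
    next
      fix s t :: "nat \<Rightarrow> real"
      show "(\<Sum>j<length \<Xi>. s j *\<^sub>R \<Xi> ! j) + (\<Sum>j<length \<Xi>. t j *\<^sub>R \<Xi> ! j) \<in> ?S"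
        by (intro range_eqI[of _ _ "\<lambda>j. s j + t j"]) (simp add: sum.distrib scaleR_add_left)
    next
      fix c :: real and t :: "nat \<Rightarrow> real"
      show "c *\<^sub>R (\<Sum>j<length \<Xi>. t j *\<^sub>R \<Xi> ! j) \<in> ?S"
        by (intro range_eqI[of _ _ "\<lambda>j. c * t j"]) (simp add: scaleR_sum_right)
    qed
  qed
  then show ?thesis using assms that by blast
qed

lemma card_le_length_if_spanning:
  fixes \<Xi> :: "(real ^ 's) list"
  assumes "Real_Vector_Spaces.dim (set \<Xi>) = CARD('s)"
  shows "CARD('s) \<le> length \<Xi>"
  using dim_le_card'[of "set \<Xi>"] card_length[of \<Xi>] assms by simp

lemma norm0_eq_card: "norm0 \<alpha> = card {i. i < length \<alpha> \<and> \<alpha> ! i \<noteq> 0}"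
  by (simp add: norm0_def length_filter_conv_card)

text \<open>
  What survives \<open>k\<close> steps of the recursion: the support has lost \<open>k\<close> positions but still spans, and
  no relation still available starts before a position whose exponent was raised.
\<close>

definition reduction_invariant :: "(real ^ 's) list \<Rightarrow> nat \<Rightarrow> nat list \<Rightarrow> bool" where
  "reduction_invariant \<Xi> k \<alpha> \<longleftrightarrow> length \<alpha> = length \<Xi> \<and> norm0 \<alpha> + k = length \<Xi> \<and>
     (\<forall>x. \<exists>t. x = (\<Sum>j<length \<Xi>. t j *\<^sub>R \<Xi> ! j) \<and> (\<forall>j<length \<Xi>. \<alpha> ! j = 0 \<longrightarrow> t j = 0)) \<and>
     (\<forall>i<length \<Xi>. 2 \<le> \<alpha> ! i \<longrightarrow> (\<forall>w\<in>syzygies \<Xi> \<alpha>. \<forall>j<i. w $v j = 0))"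

lemma reduction_invariantD:
  assumes "reduction_invariant \<Xi> k \<alpha>"
  shows "length \<alpha> = length \<Xi>" "norm0 \<alpha> + k = length \<Xi>"
    "\<exists>t. x = (\<Sum>j<length \<Xi>. t j *\<^sub>R \<Xi> ! j) \<and> (\<forall>j<length \<Xi>. \<alpha> ! j = 0 \<longrightarrow> t j = 0)"
    "i < length \<Xi> \<Longrightarrow> 2 \<le> \<alpha> ! i \<Longrightarrow> w \<in> syzygies \<Xi> \<alpha> \<Longrightarrow> j < i \<Longrightarrow> w $v j = 0"
  using assms unfolding reduction_invariant_def by blast+

lemma reduction_invariant_start:
  fixes \<Xi> :: "(real ^ 's) list"
  assumes "Real_Vector_Spaces.dim (set \<Xi>) = CARD('s)"
  shows "reduction_invariant \<Xi> 0 (replicate (length \<Xi>) 1)"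
proof -
  have "Real_Vector_Spaces.span (set \<Xi>) = UNIV" using assms by (subst dim_eq_full[symmetric]) simp
  then have "\<exists>t. x = (\<Sum>j<length \<Xi>. t j *\<^sub>R \<Xi> ! j)" for x
    using mem_span_list[of x \<Xi>] by auto
  then show ?thesis by (auto simp: reduction_invariant_def norm0_def)
qed

context
  fixes \<Xi> :: "(real ^ 's) list" and ker :: "real mat \<Rightarrow> real mat" and k :: nat and \<alpha> :: "nat list"
    and \<nu> :: "real Matrix.vec" and m :: nat
  assumes nonzero: "0 \<notin> set \<Xi>" and ker: "\<And>X. kernel_matrix X (ker X)"
    and inv: "reduction_invariant \<Xi> k \<alpha>" and k: "k + CARD('s) < length \<Xi>"
    and \<nu>: "\<nu> = nu ker \<Xi> \<alpha>" and m: "m = lead \<nu>"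
begin

lemma nu_reduction:
  "\<nu> \<in> syzygies \<Xi> \<alpha>" "\<nu> \<noteq> 0\<^sub>v (length \<Xi>)" "w \<in> syzygies \<Xi> \<alpha> \<Longrightarrow> i < m \<Longrightarrow> w $v i = 0"
proof -
  have len: "length \<alpha> = length \<Xi>" using inv by (simp add: reduction_invariant_def)
  let ?J = "{i. i < length \<alpha> \<and> \<alpha> ! i \<noteq> 0}"
  have card: "card ?J > CARD('s)" 
  proof -
    have "norm0 \<alpha> + k = length \<Xi>" using inv by (simp add: reduction_invariant_def)
    then show ?thesis using k unfolding norm0_eq_card by linarith
  qed
  have "\<not> inj_on ((!) \<Xi>) ?J \<or> Real_Vector_Spaces.dependent ((!) \<Xi> ` ?J)"
  proof (rule ccontr)
    assume "\<not> ?thesis"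
    then have "card ((!) \<Xi> ` ?J) = card ?J" "Real_Vector_Spaces.independent ((!) \<Xi> ` ?J)"
      by (auto simp: card_image)
    then show False using independent_bound[of "(!) \<Xi> ` ?J"] card by simp
  qed
  from exists_family_relation[OF _ this] len obtain w0 where
    "w0 \<in> carrier_vec (length \<Xi>)" "w0 \<noteq> 0\<^sub>v (length \<Xi>)"
    "(\<Sum>j<length \<Xi>. w0 $v j *\<^sub>R \<Xi> ! j) = 0" "\<And>j. j < length \<Xi> \<Longrightarrow> j \<notin> ?J \<Longrightarrow> w0 $v j = 0"
    by auto
  then have w0: "w0 \<in> syzygies \<Xi> \<alpha>" "w0 \<noteq> 0\<^sub>v (length \<Xi>)" by (auto simp: syzygies_def)
  from nu_props[OF ker len w0] show "\<nu> \<in> syzygies \<Xi> \<alpha>" "\<nu> \<noteq> 0\<^sub>v (length \<Xi>)"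
    "w \<in> syzygies \<Xi> \<alpha> \<Longrightarrow> i < m \<Longrightarrow> w $v i = 0" unfolding \<nu> m by blast+
qed

lemma lead_reduction: "m < length \<Xi>" "\<nu> $v m \<noteq> 0" "i < m \<Longrightarrow> \<nu> $v i = 0" "\<alpha> ! m \<noteq> 0"
proof -
  have "\<nu> \<in> carrier_vec (length \<Xi>)" using nu_reduction(1) by (simp add: syzygies_def)
  from lead_props[OF nu_reduction(2) this] show *: "m < length \<Xi>" "\<nu> $v m \<noteq> 0" "i < m \<Longrightarrow> \<nu> $v i = 0"
    by (auto simp: m)
  then show "\<alpha> ! m \<noteq> 0" using nu_reduction(1) by (auto simp: syzygies_def)
qed

text \<open>
  Otherwise the invariant would force \<open>\<nu>\<close> to vanish at its leading position \<open>m\<close>.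
\<close>

lemma exponent_ge_2_imp_le_lead: "i < length \<Xi> \<Longrightarrow> 2 \<le> \<alpha> ! i \<Longrightarrow> i \<le> m"
  using inv nu_reduction(1) lead_reduction(2) unfolding reduction_invariant_def by (meson not_le)

text \<open>
  Positions after \<open>m\<close> carry exponents at most 1, so decreasing entry \<open>j\<close> removes \<open>j\<close> from the support.
  The remaining directions still span because \<open>\<nu>\<close> expresses \<open>\<xi>\<^sub>j\<close> by them.
\<close>

lemma reduction_invariant_step:
  assumes j: "m < j" "j < length \<Xi>" "\<nu> $v j \<noteq> 0"
  shows "reduction_invariant \<Xi> (Suc k) (shift_exponent m j \<alpha>)"
proof -
  let ?\<alpha> = "shift_exponent m j \<alpha>"
  have len: "length \<alpha> = length \<Xi>" using inv by (simp add: reduction_invariant_def)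
  have "\<alpha> ! j \<noteq> 0" using nu_reduction(1) j by (auto simp: syzygies_def)
  moreover have "\<not> 2 \<le> \<alpha> ! j" using exponent_ge_2_imp_le_lead[OF j(2)] j(1) by auto
  ultimately have \<alpha>j: "\<alpha> ! j = 1" by linarith
  have nth: "?\<alpha> ! i = (if i = m then \<alpha> ! m + 1 else if i = j then 0 else \<alpha> ! i)" for i
  proof -
    have "m < length \<alpha>" "j < length \<alpha>" "m \<noteq> j" using j lead_reduction(1) len by simp_all
    then show ?thesis using \<alpha>j by (simp add: shift_exponent_def)
  qed
  have len': "length ?\<alpha> = length \<Xi>" using len by (simp add: shift_exponent_def)
  have zero: "?\<alpha> ! i = 0 \<longleftrightarrow> \<alpha> ! i = 0 \<or> i = j" for i
    unfolding nth using lead_reduction(4) j(1) by simp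
  have "{i. i < length ?\<alpha> \<and> ?\<alpha> ! i \<noteq> 0} = {i. i < length \<alpha> \<and> \<alpha> ! i \<noteq> 0} - {j}"
    unfolding len len' zero by auto
  moreover have "j \<in> {i. i < length \<alpha> \<and> \<alpha> ! i \<noteq> 0}" using j len \<alpha>j by simp
  ultimately have "norm0 ?\<alpha> = norm0 \<alpha> - 1"
    unfolding norm0_eq_card by (simp only: card_Diff_singleton)
  moreover note reduction_invariantD(2)[OF inv]
  ultimately have n0: "norm0 ?\<alpha> + Suc k = length \<Xi>" using k by simp
  have sub: "syzygies \<Xi> ?\<alpha> \<subseteq> syzygies \<Xi> \<alpha>"
    using zero unfolding syzygies_def by blast
  have span: "\<exists>t. x = (\<Sum>i<length \<Xi>. t i *\<^sub>R \<Xi> ! i) \<and> (\<forall>i<length \<Xi>. ?\<alpha> ! i = 0 \<longrightarrow> t i = 0)" for x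
  proof -
    obtain t where t: "x = (\<Sum>i<length \<Xi>. t i *\<^sub>R \<Xi> ! i)" "\<And>i. i < length \<Xi> \<Longrightarrow> \<alpha> ! i = 0 \<Longrightarrow> t i = 0"
      using reduction_invariantD(3)[OF inv, of x] by blast
    \<comment> \<open>the multiple of the relation \<open>\<nu>\<close> that cancels the coefficient of \<open>\<xi>\<^sub>j\<close>\<close>
    define t' where "t' i = t i - t j / \<nu> $v j * \<nu> $v i" for i
    have "(\<Sum>i<length \<Xi>. t' i *\<^sub>R \<Xi> ! i) = x - (t j / \<nu> $v j) *\<^sub>R (\<Sum>i<length \<Xi>. \<nu> $v i *\<^sub>R \<Xi> ! i)"
      by (simp add: t'_def t(1) scaleR_diff_left sum_subtractf scaleR_sum_right)
    also have "(\<Sum>i<length \<Xi>. \<nu> $v i *\<^sub>R \<Xi> ! i) = 0" using nu_reduction(1) by (simp add: syzygies_def)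
    finally have "x = (\<Sum>i<length \<Xi>. t' i *\<^sub>R \<Xi> ! i)" by (simp only: scaleR_zero_right diff_zero)
    moreover have "t' i = 0" if "i < length \<Xi>" "?\<alpha> ! i = 0" for i
    proof (cases "i = j")
      case True then show ?thesis using j by (simp add: t'_def)
    next
      case False
      then have "\<alpha> ! i = 0" using that zero by blast
      moreover have "\<nu> $v i = 0" using calculation that(1) nu_reduction(1) unfolding syzygies_def by blast
      ultimately show ?thesis using t(2)[OF that(1)] by (simp add: t'_def)
    qed
    ultimately show ?thesis by blast
  qed
  have "w $v i' = 0" if "i < length \<Xi>" "2 \<le> ?\<alpha> ! i" "w \<in> syzygies \<Xi> ?\<alpha>" "i' < i" for i i' w
  proof (cases "i = m")
    case True
    then show ?thesis using that nu_reduction(3) sub by blast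
  next
    case False
    then have "2 \<le> \<alpha> ! i" using that(2) unfolding nth by (simp split: if_splits)
    then show ?thesis using reduction_invariantD(4)[OF inv that(1)] that(3,4) sub by blast
  qed
  then show ?thesis
    using n0 span len' unfolding reduction_invariant_def by blast
qed

text \<open>
  A relation among the raised directions and \<open>\<xi>\<^sub>m\<close> vanishes before \<open>m\<close> by minimality of the leading
  position, and after \<open>m\<close> by \<open>exponent_ge_2_imp_le_lead\<close>.  So it involves \<open>\<xi>\<^sub>m\<close> alone and is trivial,
  as \<open>\<xi>\<^sub>m\<close> is nonzero.  These directions being independent, some linear \<open>l\<close> equals 1 on all of them.
\<close>

lemma admissible_reduction:
  obtains l where "admissible l \<Xi> (\<alpha>[m := \<alpha> ! m + 1])"
proof -
  have len: "length \<alpha> = length \<Xi>" using inv by (simp add: reduction_invariant_def)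
  define Q where "Q = {i. i < length \<Xi> \<and> (2 \<le> \<alpha> ! i \<or> i = m)}"
  have Q: "i \<le> m" if "i \<in> Q" for i using that exponent_ge_2_imp_le_lead by (auto simp: Q_def)
  have "Real_Vector_Spaces.independent ((!) \<Xi> ` Q)"
  proof (rule ccontr)
    assume "\<not> ?thesis"
    moreover have "Q \<subseteq> {..<length \<Xi>}" by (auto simp: Q_def)
    ultimately obtain w where w: "w \<in> carrier_vec (length \<Xi>)" "w \<noteq> 0\<^sub>v (length \<Xi>)"
      "(\<Sum>j<length \<Xi>. w $v j *\<^sub>R \<Xi> ! j) = 0" "\<And>j. j < length \<Xi> \<Longrightarrow> j \<notin> Q \<Longrightarrow> w $v j = 0"
      using exists_family_relation[of Q \<Xi>] by blast
    have "w \<in> syzygies \<Xi> \<alpha>"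
    proof -
      have "w $v j = 0" if "j < length \<Xi>" "\<alpha> ! j = 0" for j
        using w(4)[OF that(1)] that(2) lead_reduction(4) by (cases "j = m") (simp_all add: Q_def)
      then show ?thesis using w(1,3) unfolding syzygies_def by blast
    qed
    then have z: "w $v i = 0" if "i < length \<Xi>" "i \<noteq> m" for i
      using nu_reduction(3)[of w i] Q[of i] w(4)[of i] that by (cases "i < m") auto
    have "0 = (\<Sum>j\<in>{m}. w $v j *\<^sub>R \<Xi> ! j)"
      unfolding w(3)[symmetric] using z lead_reduction(1) by (intro sum.mono_neutral_right) auto
    then have "w $v m *\<^sub>R \<Xi> ! m = 0" by simp
    moreover have "\<Xi> ! m \<noteq> 0" using nonzero lead_reduction(1) by (metis nth_mem)
    ultimately have "w $v m = 0" by simp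
    then have "w = 0\<^sub>v (length \<Xi>)" 
    proof (intro eq_vecI)
      fix i assume "i < dim_vec (0\<^sub>v (length \<Xi>) :: real Matrix.vec)"
      then show "w $v i = 0\<^sub>v (length \<Xi>) $v i" using z[of i] \<open>w $v m = 0\<close> by (cases "i = m") auto
    qed (use w(1) in auto)
    then show False using w(2) by simp
  qed
  from linear_independent_extend[OF this, of "\<lambda>_. 1 :: real"] obtain l :: "real ^ 's \<Rightarrow> real"
    where l: "linear l" "\<And>v. v \<in> (!) \<Xi> ` Q \<Longrightarrow> l v = 1" by blast
  have "admissible l \<Xi> (\<alpha>[m := \<alpha> ! m + 1])"
    unfolding admissible_def
  proof (intro conjI allI impI)
    fix i assume "i < length \<Xi>" "2 \<le> \<alpha>[m := \<alpha> ! m + 1] ! i"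
    then have "i \<in> Q" using len by (auto simp: Q_def nth_list_update split: if_splits)
    then show "0 < l (\<Xi> ! i)" using l(2) by simp
  qed (use l len in auto)
  then show ?thesis by (rule that)
qed

lemma spline_op_reduction:
  assumes "\<And>l. linear l \<Longrightarrow> vanishes_above l \<phi>"
  shows "spline_op \<Xi> \<alpha> \<phi> x =
    (\<Sum>j | m < j \<and> j < length \<Xi> \<and> \<nu> $v j \<noteq> 0. - (\<nu> $v j / \<nu> $v m) * spline_op \<Xi> (shift_exponent m j \<alpha>) \<phi> x)"
proof -
  obtain l where l: "admissible l \<Xi> (\<alpha>[m := \<alpha> ! m + 1])" by (rule admissible_reduction)
  have "{j. j < length \<Xi> \<and> j \<noteq> m \<and> \<nu> $v j \<noteq> 0} = {j. m < j \<and> j < length \<Xi> \<and> \<nu> $v j \<noteq> 0}"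
    using lead_reduction(3) by (auto simp: neq_iff)
  then show ?thesis
    using spline_op_shift_exponent[OF l assms, of "\<lambda>j. \<nu> $v j" x] l nu_reduction(1) lead_reduction
    by (auto simp: syzygies_def admissible_def Suc_le_eq)
qed

end

lemma sum_mset_sum_mset: "(\<Sum>z\<in>#(\<Sum>y\<in>#P. g y). f z) = (\<Sum>y\<in>#P. \<Sum>z\<in>#g y. f z :: real)"
  by (induction P) auto

lemma exponent_mset_Suc_memE:
  assumes "(c', \<alpha>') \<in># exponent_mset ker \<Xi> (Suc k)"
  obtains c \<alpha> j where "(c, \<alpha>) \<in># exponent_mset ker \<Xi> k" "lead (nu ker \<Xi> \<alpha>) < j" "j < length \<Xi>"
    "nu ker \<Xi> \<alpha> $v j \<noteq> 0" "\<alpha>' = shift_exponent (lead (nu ker \<Xi> \<alpha>)) j \<alpha>"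
proof -
  from assms obtain c \<alpha> where c: "(c, \<alpha>) \<in># exponent_mset ker \<Xi> k"
    and "(c', \<alpha>') \<in># (let \<nu> = nu ker \<Xi> \<alpha>; m = lead \<nu> in
        image_mset (\<lambda>j. (- c * (\<nu> $v j / \<nu> $v m), shift_exponent m j \<alpha>))
          (mset_set {j. m < j \<and> j < length \<Xi> \<and> \<nu> $v j \<noteq> 0}))"
    unfolding exponent_mset.simps in_Union_mset_iff set_image_mset by fast
  then obtain j where "j \<in># mset_set {j. lead (nu ker \<Xi> \<alpha>) < j \<and> j < length \<Xi> \<and> nu ker \<Xi> \<alpha> $v j \<noteq> 0}"
    "\<alpha>' = shift_exponent (lead (nu ker \<Xi> \<alpha>)) j \<alpha>"
    unfolding Let_def set_image_mset by fast
  then show ?thesis using that[OF c, of j] by simp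
qed

lemma reduction_invariant_exponent_mset:
  fixes \<Xi> :: "(real ^ 's) list"
  assumes nondegenerate: "Real_Vector_Spaces.dim (set \<Xi>) = CARD('s)"
    and nonzero: "0 \<notin> set \<Xi>" and ker: "\<And>X. kernel_matrix X (ker X)"
  shows "k + CARD('s) \<le> length \<Xi> \<Longrightarrow> (c, \<alpha>) \<in># exponent_mset ker \<Xi> k \<Longrightarrow> reduction_invariant \<Xi> k \<alpha>"
proof (induction k arbitrary: c \<alpha>)
  case 0
  then show ?case using reduction_invariant_start[OF nondegenerate] by simp
next
  case (Suc k)
  obtain c' \<alpha>' j where j: "(c', \<alpha>') \<in># exponent_mset ker \<Xi> k" "lead (nu ker \<Xi> \<alpha>') < j" "j < length \<Xi>"
    "nu ker \<Xi> \<alpha>' $v j \<noteq> 0" "\<alpha> = shift_exponent (lead (nu ker \<Xi> \<alpha>')) j \<alpha>'"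
    by (rule exponent_mset_Suc_memE[OF Suc.prems(2)])
  have "reduction_invariant \<Xi> k \<alpha>'" using Suc.prems(1) by (intro Suc.IH[OF _ j(1)]) simp
  from reduction_invariant_step[OF nonzero ker this _ refl refl j(2-4)] Suc.prems(1) j(5) show ?case by simp
qed

lemma sum_exponent_mset_spline_op:
  fixes \<Xi> :: "(real ^ 's) list"
  assumes nondegenerate: "Real_Vector_Spaces.dim (set \<Xi>) = CARD('s)"
    and nonzero: "0 \<notin> set \<Xi>" and ker: "\<And>X. kernel_matrix X (ker X)"
    and v: "\<And>l. linear l \<Longrightarrow> vanishes_above l \<phi>" and k: "k + CARD('s) \<le> length \<Xi>"
  shows "(\<Sum>(c, \<alpha>)\<in>#exponent_mset ker \<Xi> k. c * spline_op \<Xi> \<alpha> \<phi> x) = spline_op \<Xi> (replicate (length \<Xi>) 1) \<phi> x"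
  using k
proof (induction k)
  case 0
  then show ?case by simp
next
  case (Suc k)
  have k': "k + CARD('s) < length \<Xi>" using Suc.prems by simp
  note inv = reduction_invariant_exponent_mset[OF nondegenerate nonzero ker less_imp_le[OF k']]
  have "(\<Sum>(c, \<alpha>)\<in>#exponent_mset ker \<Xi> (Suc k). c * spline_op \<Xi> \<alpha> \<phi> x) =
    (\<Sum>(c, \<alpha>)\<in>#exponent_mset ker \<Xi> k. c * spline_op \<Xi> \<alpha> \<phi> x)"
    unfolding exponent_mset.simps sum_mset_sum_mset
  proof (rule arg_cong[where f = sum_mset], rule image_mset_cong, clarsimp simp: Let_def image_mset.compositionality o_def)
    fix c \<alpha> assume "(c, \<alpha>) \<in># exponent_mset ker \<Xi> k"
    note r = spline_op_reduction[OF nonzero ker inv[OF this] k' refl refl v]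
    define \<nu> where "\<nu> = nu ker \<Xi> \<alpha>"
    define J where "J = {j. lead \<nu> < j \<and> j < length \<Xi> \<and> \<nu> $v j \<noteq> 0}"
    have r': "spline_op \<Xi> \<alpha> \<phi> x = (\<Sum>j\<in>J. - (\<nu> $v j / \<nu> $v lead \<nu>) * spline_op \<Xi> (shift_exponent (lead \<nu>) j \<alpha>) \<phi> x)"
      unfolding J_def \<nu>_def by (rule r)
    have "c * spline_op \<Xi> \<alpha> \<phi> x = (\<Sum>j\<in>J. c * (- (\<nu> $v j / \<nu> $v lead \<nu>) * spline_op \<Xi> (shift_exponent (lead \<nu>) j \<alpha>) \<phi> x))"
      by (subst r') (rule sum_distrib_left)
    also have "\<dots> = (\<Sum>j\<in>#mset_set J. - (c * \<nu> $v j * spline_op \<Xi> (shift_exponent (lead \<nu>) j \<alpha>) \<phi> x / \<nu> $v lead \<nu>))"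
      by (simp add: sum_unfold_sum_mset mult_ac)
    finally show "(\<Sum>j\<in>#mset_set J. - (c * \<nu> $v j * spline_op \<Xi> (shift_exponent (lead \<nu>) j \<alpha>) \<phi> x / \<nu> $v lead \<nu>)) = c * spline_op \<Xi> \<alpha> \<phi> x" ..
  qed
  also have "\<dots> = spline_op \<Xi> (replicate (length \<Xi>) 1) \<phi> x" using k' by (intro Suc.IH) simp
  finally show ?case .
qed

lemma det_sub_matrix_nonzero:
  fixes \<Xi> :: "(real ^ 's) list"
  assumes inv: "reduction_invariant \<Xi> k \<alpha>" and n: "norm0 \<alpha> = CARD('s)"
  shows "Determinants.det (sub_matrix \<Xi> \<alpha> :: real ^ 's ^ 's) \<noteq> 0"
proof -
  let ?A = "sub_matrix \<Xi> \<alpha> :: real ^ 's ^ 's"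
  have len: "length \<alpha> = length \<Xi>" using inv by (simp add: reduction_invariant_def)
  have "\<exists>y. x = ?A *v y" for x
  proof -
    obtain t where t: "x = (\<Sum>i<length \<Xi>. t i *\<^sub>R \<Xi> ! i)" "\<And>i. i < length \<Xi> \<Longrightarrow> \<alpha> ! i = 0 \<Longrightarrow> t i = 0"
      using reduction_invariantD(3)[OF inv, of x] by blast
    have "x = (\<Sum>i\<in>range (position \<alpha> :: 's \<Rightarrow> nat). t i *\<^sub>R \<Xi> ! i)"
      unfolding t(1) using t(2) by (intro sum.mono_neutral_right) (auto simp: range_position[OF n] len)
    also have "\<dots> = ?A *v (\<chi> j. t (position \<alpha> j))"
      by (simp add: sum.reindex[OF inj_position[OF n]] sub_matrix_mult)
    finally show ?thesis ..
  qed
  then have "surj ((*v) ?A)" unfolding surj_def by blast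
  then have "inj ((*v) ?A)" by (rule linear_surjective_imp_injective[OF matrix_vector_mul_linear]) simp
  then show ?thesis using det_nz_iff_inj[OF matrix_vector_mul_linear, of ?A] by (simp add: matrix_of_matrix_vector_mul)
qed

section \<open>The density of the box spline\<close>

definition spline_density :: "(real mat \<Rightarrow> real mat) \<Rightarrow> (real ^ 's) list \<Rightarrow> real ^ 's \<Rightarrow> real" where
  "spline_density ker \<Xi> x = (\<Sum>(b, p)\<in>#diff_mset \<Xi>. \<Sum>(c, \<alpha>)\<in>#exponent_mset ker \<Xi> (length \<Xi> - CARD('s)).
     b * c * green \<Xi> \<alpha> (x - p))"

lemma sum_mset_times:
  fixes c :: real
  shows "c * (\<Sum>z\<in>#S. f z) = (\<Sum>z\<in>#S. c * f z)" "(\<Sum>z\<in>#S. f z) * c = (\<Sum>z\<in>#S. f z * c)"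
  by (induction S) (auto simp: algebra_simps)

lemma has_bochner_integral_sum_mset:
  fixes f :: "'b \<Rightarrow> 'a \<Rightarrow> real"
  assumes "\<And>z. z \<in># S \<Longrightarrow> has_bochner_integral M (f z) (v z)"
  shows "has_bochner_integral M (\<lambda>x. \<Sum>z\<in>#S. f z x) (\<Sum>z\<in>#S. v z)"
  using assms by (induction S) (auto intro!: has_bochner_integral_add)

lemma has_bochner_integral_spline_density:
  fixes \<Xi> :: "(real ^ 's) list"
  assumes nondegenerate: "Real_Vector_Spaces.dim (set \<Xi>) = CARD('s)"
    and nonzero: "0 \<notin> set \<Xi>" and ker: "\<And>X. kernel_matrix X (ker X)"
    and c: "continuous_on UNIV \<phi>" and r: "\<And>x. norm x > r \<Longrightarrow> \<phi> x = 0" and nn: "\<And>x. 0 \<le> \<phi> x"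
  shows "has_bochner_integral lborel (\<lambda>y. spline_density ker \<Xi> y * \<phi> y) (\<integral>y. \<phi> y \<partial>box_spline \<Xi>)"
proof -
  let ?k = "length \<Xi> - CARD('s)"
  let ?P = "exponent_mset ker \<Xi> ?k"
  let ?H = "\<lambda>\<alpha>. ray_powers ((!) \<Xi>) ((!) \<alpha>) [0..<length \<Xi>] \<phi>"
  have v: "vanishes_above l \<phi>" if "linear l" for l
    by (rule vanishes_above_if_bounded_support[OF that c r])
  have k: "?k + CARD('s) \<le> length \<Xi>" using card_le_length_if_spanning[OF nondegenerate] by simp
  have \<alpha>: "length \<alpha> = length \<Xi>" "norm0 \<alpha> = CARD('s)" "Determinants.det (sub_matrix \<Xi> \<alpha> :: real ^ 's ^ 's) \<noteq> 0"
    if "(c, \<alpha>) \<in># ?P" for c \<alpha>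
  proof -
    note inv = reduction_invariant_exponent_mset[OF nondegenerate nonzero ker k that]
    show "length \<alpha> = length \<Xi>" by (rule reduction_invariantD(1)[OF inv])
    show n: "norm0 \<alpha> = CARD('s)" using reduction_invariantD(2)[OF inv] k by linarith
    show "Determinants.det (sub_matrix \<Xi> \<alpha> :: real ^ 's ^ 's) \<noteq> 0" by (rule det_sub_matrix_nonzero[OF inv n])
  qed
  have spl: "spline_op \<Xi> \<alpha> \<phi> 0 = (\<Sum>(b, p)\<in>#diff_mset \<Xi>. b * ?H \<alpha> p)" if P: "(c, \<alpha>) \<in># ?P" for c \<alpha>
  proof -
    obtain l :: "real ^ 's \<Rightarrow> real" where l: "linear l" "\<And>i. i < length \<alpha> \<Longrightarrow> \<alpha> ! i > 0 \<Longrightarrow> l (\<Xi> ! i) > 0"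
      using linear_positive_on_columns[OF \<alpha>(3,2)[OF P]] by blast
    show ?thesis
      using spline_op_eq_sum_ray_powers[OF l(1) v[OF l(1)] \<alpha>(1)[OF P]] l(2) \<alpha>(1)[OF P] by simp
  qed
  have "has_bochner_integral lborel
    (\<lambda>y. \<Sum>(b, p)\<in>#diff_mset \<Xi>. \<Sum>(c, \<alpha>)\<in>#?P. b * c * (green \<Xi> \<alpha> (y - p) * \<phi> y))
    (\<Sum>(b, p)\<in>#diff_mset \<Xi>. \<Sum>(c, \<alpha>)\<in>#?P. b * c * ?H \<alpha> p)"
    unfolding split_def
    by (intro has_bochner_integral_sum_mset has_bochner_integral_mult_right has_bochner_integral_green[OF _ _ _ c r nn])
      (use \<alpha> in auto)
  then have bi: "has_bochner_integral lborel (\<lambda>y. spline_density ker \<Xi> y * \<phi> y)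
    (\<Sum>(b, p)\<in>#diff_mset \<Xi>. \<Sum>(c, \<alpha>)\<in>#?P. b * c * ?H \<alpha> p)"
    unfolding spline_density_def split_def sum_mset_times by (simp add: mult_ac)
  have "(\<Sum>(b, p)\<in>#diff_mset \<Xi>. \<Sum>(c, \<alpha>)\<in>#?P. b * c * ?H \<alpha> p)
    = (\<Sum>(c, \<alpha>)\<in>#?P. \<Sum>(b, p)\<in>#diff_mset \<Xi>. b * c * ?H \<alpha> p)"
    unfolding split_def by (rule sum_mset.swap)
  also have "\<dots> = (\<Sum>(c, \<alpha>)\<in>#?P. c * spline_op \<Xi> \<alpha> \<phi> 0)"
  proof (rule arg_cong[where f = sum_mset], rule image_mset_cong, clarify)
    fix c \<alpha> assume "(c, \<alpha>) \<in># ?P"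
    then show "(\<Sum>(b, p)\<in>#diff_mset \<Xi>. b * c * ?H \<alpha> p) = c * spline_op \<Xi> \<alpha> \<phi> 0"
      unfolding spl[OF \<open>(c, \<alpha>) \<in># ?P\<close>] split_def sum_mset_times by (simp add: mult_ac)
  qed
  also have "\<dots> = spline_op \<Xi> (replicate (length \<Xi>) 1) \<phi> 0"
    by (rule sum_exponent_mset_spline_op[OF nondegenerate nonzero ker v k])
  also have "\<dots> = (\<integral>y. \<phi> y \<partial>box_spline \<Xi>)"
  proof -
    have "\<phi> \<in> borel_measurable (box_spline \<Xi>)"
      using borel_measurable_continuous_onI[OF c] by simp
    then show ?thesis
      using nn_integral_box_spline[OF c nn, where x = 0 and \<Xi> = \<Xi>] nn
      by (simp add: integral_eq_nn_integral del: One_nat_def)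
  qed
  finally show ?thesis using bi by simp
qed

lemma measurable_spline_density [measurable]: "spline_density ker \<Xi> \<in> borel_measurable borel"
proof -
  have s: "(\<lambda>x. \<Sum>z\<in>#S. f z x) \<in> borel_measurable borel"
    if "\<And>z. f z \<in> borel_measurable borel" for S and f :: "'b \<Rightarrow> real ^ 's \<Rightarrow> real"
    using that by (induction S) auto
  show ?thesis unfolding spline_density_def[abs_def] split_def by (intro s) measurable
qed

context
  fixes \<mu> :: "'a::euclidean_space measure" and f :: "'a \<Rightarrow> real"
  assumes \<mu>: "prob_space \<mu>" "sets \<mu> = sets borel" and f [measurable]: "f \<in> borel_measurable borel"
    and weak: "\<And>\<phi> r. continuous_on UNIV \<phi> \<Longrightarrow> (\<And>x. norm x > r \<Longrightarrow> \<phi> x = 0) \<Longrightarrow> (\<And>x. 0 \<le> \<phi> x) \<Longrightarrow>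
      has_bochner_integral lborel (\<lambda>y. f y * \<phi> y) (\<integral>y. \<phi> y \<partial>\<mu>)"
begin

interpretation prob_space \<mu> by (rule \<mu>(1))

declare \<mu>(2)[measurable_cong]

lemma weak_density_set_integrable_ball: "set_integrable lborel (ball 0 r) f"
proof -
  let ?\<phi> = "\<lambda>x::'a. max 0 (min 1 (r + 1 - norm x))"
  have "has_bochner_integral lborel (\<lambda>y. f y * ?\<phi> y) (\<integral>y. ?\<phi> y \<partial>\<mu>)"
    by (rule weak[where r = "r + 1"]) (auto intro!: continuous_intros)
  then have "set_integrable lborel UNIV (\<lambda>y. f y * ?\<phi> y)"
    by (auto simp: set_integrable_def has_bochner_integral_iff)
  then have "set_integrable lborel (ball 0 r) (\<lambda>y. f y * ?\<phi> y)"
    by (rule set_integrable_subset) auto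
  moreover have "(\<lambda>y. indicator (ball 0 r) y *\<^sub>R (f y * ?\<phi> y)) = (\<lambda>y. indicator (ball 0 r) y *\<^sub>R f y)"
    by (auto simp: indicator_def)
  ultimately show ?thesis unfolding set_integrable_def by (simp only:)
qed

text \<open>
  The indicator of a bounded open set is the increasing limit of continuous functions.
\<close>

lemma weak_density_open:
  assumes U: "open U" "U \<subseteq> ball 0 r"
  shows "measure \<mu> U = (LINT x:U|lborel. f x)"
proof -
  \<comment> \<open>continuous, zero off \<open>U\<close>, and increasing to 1 on \<open>U\<close> because \<open>U\<close> is open\<close>
  define \<phi> where "\<phi> k x = min 1 (real k * infdist x (- U))" for k x
  have ne: "- U \<noteq> {}"
  proof
    assume "- U = {}"
    then have "U = UNIV" by auto
    then have "bounded (UNIV :: 'a set)" using U(2) bounded_ball bounded_subset by metis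
    then show False by simp
  qed
  have zero: "infdist x (- U) = 0 \<longleftrightarrow> x \<notin> U" for x
    using in_closed_iff_infdist_zero[of "- U" x] U ne by auto
  have nn: "0 \<le> \<phi> k x" "\<phi> k x \<le> 1" for k x by (auto simp: \<phi>_def infdist_nonneg)
  have off: "\<phi> k x = 0" if "x \<notin> U" for k x using zero[of x] that by (simp add: \<phi>_def)
  have cont: "continuous_on UNIV (\<phi> k)" for k
    unfolding \<phi>_def by (intro continuous_intros)
  then have [measurable]: "\<phi> k \<in> borel_measurable borel" for k by (rule borel_measurable_continuous_onI)
  have lim: "(\<lambda>k. \<phi> k x) \<longlonglongrightarrow> indicator U x" for x
  proof (cases "x \<in> U")
    case True
    then have pos: "infdist x (- U) > 0" using zero[of x] infdist_nonneg[of x "- U"] by linarith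
    have "\<forall>\<^sub>F k in sequentially. \<phi> k x = 1"
      using eventually_ge_at_top[of "nat \<lceil>1 / infdist x (- U)\<rceil>"]
    proof eventually_elim
      case (elim k)
      then have "1 / infdist x (- U) \<le> real k" by linarith
      then show ?case using pos by (simp add: \<phi>_def field_simps)
    qed
    then show ?thesis using True by (simp add: tendsto_eventually)
  qed (simp add: off)
  have \<phi>U: "has_bochner_integral lborel (\<lambda>y. f y * \<phi> k y) (\<integral>y. \<phi> k y \<partial>\<mu>)" for k
  proof (rule weak[where r = r, OF cont _ nn(1)])
    fix x :: 'a assume "norm x > r"
    then have "x \<notin> U" using U(2) by auto
    then show "\<phi> k x = 0" by (rule off)
  qed
  have "(\<lambda>k. \<integral>y. \<phi> k y \<partial>\<mu>) \<longlonglongrightarrow> (\<integral>y. indicator U y \<partial>\<mu>)"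
    by (rule integral_dominated_convergence[where w = "\<lambda>_. 1"]) (use borel_open[OF U(1)] lim nn in auto)
  moreover have "(\<lambda>k. \<integral>y. f y * \<phi> k y \<partial>lborel) \<longlonglongrightarrow> (\<integral>y. f y * indicator U y \<partial>lborel)"
  proof (rule integral_dominated_convergence[where w = "\<lambda>y. \<bar>indicator (ball 0 r) y *\<^sub>R f y\<bar>"])
    show "integrable lborel (\<lambda>y. \<bar>indicator (ball 0 r) y *\<^sub>R f y\<bar>)"
      using weak_density_set_integrable_ball[of r] unfolding set_integrable_def by (rule integrable_abs)
    show "AE y in lborel. (\<lambda>k. f y * \<phi> k y) \<longlonglongrightarrow> f y * indicator U y"
      by (intro AE_I2 tendsto_intros lim)
    show "AE y in lborel. norm (f y * \<phi> k y) \<le> \<bar>indicator (ball 0 r) y *\<^sub>R f y\<bar>" for k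
    proof (rule AE_I2)
      fix y show "norm (f y * \<phi> k y) \<le> \<bar>indicator (ball 0 r) y *\<^sub>R f y\<bar>"
      proof (cases "y \<in> U")
        case True
        then have "y \<in> ball 0 r" using U by blast
        then show ?thesis using nn[of k y] by (simp add: abs_mult mult_left_le)
      qed (simp add: off)
    qed
  qed (use U in auto)
  moreover have "(\<integral>y. f y * \<phi> k y \<partial>lborel) = (\<integral>y. \<phi> k y \<partial>\<mu>)" for k
    using \<phi>U by (rule has_bochner_integral_integral_eq)
  ultimately have "(\<integral>y. indicator U y \<partial>\<mu>) = (\<integral>y. f y * indicator U y \<partial>lborel)"
    by (simp add: LIMSEQ_unique)
  then show ?thesis
    using U \<mu>(2) by (simp add: set_lebesgue_integral_def mult.commute sets_eq_imp_space_eq)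
qed

text \<open>
  Dynkin's argument inside a ball; \<open>f\<close> may take both signs, and restriction to a ball makes it
  integrable.
\<close>

lemma weak_density_borel:
  assumes "A \<in> sets borel" shows "measure \<mu> (A \<inter> ball 0 r) = (LINT x:A \<inter> ball 0 r|lborel. f x)"
proof -
  let ?W = "ball 0 r :: 'a set"
  have space: "space \<mu> = UNIV" using sets_eq_imp_space_eq[OF \<mu>(2)] by simp
  have int: "set_integrable lborel B f" if "B \<in> sets borel" "B \<subseteq> ?W" for B
    using that by (intro set_integrable_subset[OF weak_density_set_integrable_ball[of r]]) auto
  have "A \<in> sigma_sets UNIV {S. open S}" using assms by (simp add: sets_borel)
  show ?thesis
  proof (rule sigma_sets_induct_disjoint[where \<Omega> = UNIV and G = "{S. open S}" and A = A])
    show "Int_stable {S :: 'a set. open S}" by (auto simp: Int_stable_def)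
    show "A \<in> sigma_sets UNIV {S. open S}" by fact
  next
    fix A :: "'a set" assume "A \<in> {S. open S}"
    then show "measure \<mu> (A \<inter> ?W) = (LINT x:A \<inter> ?W|lborel. f x)" by (intro weak_density_open) auto
  next
    fix A :: "'a set" assume A: "A \<in> sigma_sets UNIV {S. open S}" and eq: "measure \<mu> (A \<inter> ?W) = (LINT x:A \<inter> ?W|lborel. f x)"
    have Ab: "A \<in> sets borel" using A by (simp add: sets_borel)
    have "measure \<mu> ((UNIV - A) \<inter> ?W) = measure \<mu> (?W - A \<inter> ?W)" by (rule arg_cong[where f = "measure \<mu>"]) auto
    also have "\<dots> = measure \<mu> ?W - measure \<mu> (A \<inter> ?W)"
      using Ab \<mu>(2) by (intro finite_measure_Diff) auto
    also have "\<dots> = (LINT x:?W|lborel. f x) - (LINT x:A \<inter> ?W|lborel. f x)"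
      using weak_density_open[of ?W r] eq by simp
    also have "\<dots> = (LINT x:(UNIV - A) \<inter> ?W|lborel. f x)"
      unfolding set_lebesgue_integral_def
    proof (subst Bochner_Integration.integral_diff[symmetric])
      show "integrable lborel (\<lambda>x. indicator ?W x *\<^sub>R f x)" "integrable lborel (\<lambda>x. indicator (A \<inter> ?W) x *\<^sub>R f x)"
        using int[of ?W] int[of "A \<inter> ?W"] Ab by (auto simp: set_integrable_def)
      show "(\<integral>x. indicator ?W x *\<^sub>R f x - indicator (A \<inter> ?W) x *\<^sub>R f x \<partial>lborel)
        = (\<integral>x. indicator ((UNIV - A) \<inter> ?W) x *\<^sub>R f x \<partial>lborel)"
        by (rule Bochner_Integration.integral_cong) (auto simp: indicator_def)
    qed
    finally show "measure \<mu> ((UNIV - A) \<inter> ?W) = (LINT x:(UNIV - A) \<inter> ?W|lborel. f x)" .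
  next
    fix A :: "nat \<Rightarrow> 'a set"
    assume d: "disjoint_family A" and A: "range A \<subseteq> sigma_sets UNIV {S. open S}"
      and eq: "\<And>i. measure \<mu> (A i \<inter> ?W) = (LINT x:A i \<inter> ?W|lborel. f x)"
    have Ab: "A i \<in> sets borel" for i using A by (auto simp: sets_borel)
    have un: "\<Union> (range A) \<inter> ?W = (\<Union>i. A i \<inter> ?W)" by auto
    have d': "disjoint_family (\<lambda>i. A i \<inter> ?W)" using d by (auto simp: disjoint_family_on_def)
    have "(\<lambda>i. measure \<mu> (A i \<inter> ?W)) sums measure \<mu> (\<Union>i. A i \<inter> ?W)"
      using Ab d' \<mu>(2) by (intro finite_measure_UNION) auto
    then have "measure \<mu> (\<Union>i. A i \<inter> ?W) = (\<Sum>i. measure \<mu> (A i \<inter> ?W))" by (simp add: sums_iff)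
    also have "\<dots> = (LINT x:(\<Union>i. A i \<inter> ?W)|lborel. f x)"
      unfolding eq
      by (rule lebesgue_integral_countable_add[symmetric]) (use Ab d' in \<open>auto simp: disjoint_family_on_def intro!: int\<close>)
    finally show "measure \<mu> (\<Union> (range A) \<inter> ?W) = (LINT x:\<Union> (range A) \<inter> ?W|lborel. f x)"
      unfolding un .
  qed (auto simp: set_lebesgue_integral_def)
qed

lemma weak_density_has_integral:
  assumes "A \<in> sets borel" "bounded A"
  shows "(f has_integral measure \<mu> A) A"
proof -
  obtain r where "A \<subseteq> ball 0 r" using assms(2) bounded_subset_ballD by blast
  then have A: "A \<inter> ball 0 r = A" by auto
  have i: "set_integrable lborel A f"
    using assms A by (intro set_integrable_subset[OF weak_density_set_integrable_ball[of r]]) auto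
  show ?thesis
    using weak_density_borel[OF assms(1), of r] set_borel_integral_eq_integral[OF i]
    unfolding A by (simp add: integrable_integral)
qed

end

section \<open>Regions\<close>

lemma support_polyhedron_Cons:
  "support_polyhedron (\<xi> # \<Xi>) = {x + y |x y. x \<in> (\<lambda>t. t *\<^sub>R \<xi>) ` {0..1} \<and> y \<in> support_polyhedron \<Xi>}"
proof (intro equalityI subsetI)
  fix v assume "v \<in> support_polyhedron (\<xi> # \<Xi>)"
  then obtain t where t: "v = (\<Sum>j<Suc (length \<Xi>). t j *\<^sub>R (\<xi> # \<Xi>) ! j)" "\<And>j. j < Suc (length \<Xi>) \<Longrightarrow> 0 \<le> t j \<and> t j \<le> (1::real)"
    by (auto simp: support_polyhedron_def)
  have "(\<Sum>j<length \<Xi>. t (Suc j) *\<^sub>R \<Xi> ! j) \<in> support_polyhedron \<Xi>"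
    using t(2) unfolding support_polyhedron_def by (intro CollectI exI[of _ "\<lambda>j. t (Suc j)"]) simp
  moreover have "t 0 *\<^sub>R \<xi> \<in> (\<lambda>t. t *\<^sub>R \<xi>) ` {0..1}" using t(2)[of 0] by auto
  ultimately show "v \<in> {x + y |x y. x \<in> (\<lambda>t. t *\<^sub>R \<xi>) ` {0..1} \<and> y \<in> support_polyhedron \<Xi>}"
    unfolding t(1) sum.lessThan_Suc_shift by auto
next
  fix v assume "v \<in> {x + y |x y. x \<in> (\<lambda>t. t *\<^sub>R \<xi>) ` {0..1} \<and> y \<in> support_polyhedron \<Xi>}"
  then obtain s t where st: "v = s *\<^sub>R \<xi> + (\<Sum>j<length \<Xi>. t j *\<^sub>R \<Xi> ! j)" "0 \<le> s" "s \<le> 1"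
    "\<And>j. j < length \<Xi> \<Longrightarrow> 0 \<le> t j \<and> t j \<le> (1::real)"
    by (auto simp: support_polyhedron_def)
  have "v = (\<Sum>j<Suc (length \<Xi>). case_nat s t j *\<^sub>R (\<xi> # \<Xi>) ! j)"
    unfolding st(1) sum.lessThan_Suc_shift by simp
  moreover have "0 \<le> case_nat s t j \<and> case_nat s t j \<le> (1::real)" if "j < Suc (length \<Xi>)" for j
    using that st by (cases j) auto
  ultimately show "v \<in> support_polyhedron (\<xi> # \<Xi>)"
    unfolding support_polyhedron_def by (intro CollectI exI[of _ "case_nat s t"]) simp
qed

lemma compact_support_polyhedron: "compact (support_polyhedron (\<Xi> :: (real ^ 's) list))"
proof (induction \<Xi>)
  case Nil
  have "support_polyhedron ([] :: (real ^ 's) list) = {0}" by (auto simp: support_polyhedron_def)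
  then show ?case by simp
next
  case (Cons \<xi> \<Xi>)
  show ?case unfolding support_polyhedron_Cons
    by (intro compact_sums Cons compact_continuous_image continuous_intros) auto
qed

lemma countable_lattice_points: "countable (lattice_points \<Xi>)"
proof (induction \<Xi>)
  case Nil
  then show ?case by (auto simp: lattice_points_def)
next
  case (Cons \<xi> \<Xi>)
  have "lattice_points (\<xi> # \<Xi>) \<subseteq> (\<lambda>(k :: int, v). real_of_int k *\<^sub>R \<xi> + v) ` (UNIV \<times> lattice_points \<Xi>)"
  proof
    fix v assume "v \<in> lattice_points (\<xi> # \<Xi>)"
    then obtain z where v: "v = (\<Sum>j<Suc (length \<Xi>). real_of_int (z j) *\<^sub>R (\<xi> # \<Xi>) ! j)"
      by (auto simp: lattice_points_def)
    have "(\<Sum>j<length \<Xi>. real_of_int (z (Suc j)) *\<^sub>R \<Xi> ! j) \<in> lattice_points \<Xi>"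
      unfolding lattice_points_def by (intro CollectI exI[of _ "\<lambda>j. z (Suc j)"]) simp
    then show "v \<in> (\<lambda>(k :: int, v). real_of_int k *\<^sub>R \<xi> + v) ` (UNIV \<times> lattice_points \<Xi>)"
      unfolding v sum.lessThan_Suc_shift by (intro image_eqI[of _ _ "(z 0, \<Sum>j<length \<Xi>. real_of_int (z (Suc j)) *\<^sub>R \<Xi> ! j)"]) auto
  qed
  then show ?case by (rule countable_subset) (intro countable_image countable_SIGMA Cons countableI_type)
qed

lemma diff_mset_subset_lattice_points: "(b, p) \<in># diff_mset \<Xi> \<Longrightarrow> p \<in> lattice_points \<Xi>"
proof (induction \<Xi> arbitrary: b p)
  case Nil
  then show ?case by (auto simp: lattice_points_def)
next
  case (Cons \<xi> \<Xi>)
  have *: "real_of_int k *\<^sub>R \<xi> + q \<in> lattice_points (\<xi> # \<Xi>)" if q: "q \<in> lattice_points \<Xi>" for k q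
  proof -
    obtain z where q: "q = (\<Sum>j<length \<Xi>. real_of_int (z j) *\<^sub>R \<Xi> ! j)"
      using q by (auto simp: lattice_points_def)
    have "real_of_int k *\<^sub>R \<xi> + q = (\<Sum>j<Suc (length \<Xi>). real_of_int (case_nat k z j) *\<^sub>R (\<xi> # \<Xi>) ! j)"
      unfolding q sum.lessThan_Suc_shift by simp
    then show ?thesis unfolding lattice_points_def by auto
  qed
  from Cons.prems obtain b' q where "(b', q) \<in># diff_mset \<Xi>" "p = q \<or> p = \<xi> + q" by auto
  then show ?case using *[OF Cons.IH, of b' q 0] *[OF Cons.IH, of b' q 1] by auto
qed

lemma mesh_in_borel: "mesh (\<Xi> :: (real ^ 's) list) \<in> sets borel"
proof -
  have eq: "mesh \<Xi> = (\<Union>H\<in>hyperplanes \<Xi>. \<Union>v\<in>lattice_points \<Xi>. (+) v ` H)"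
  proof -
    have "{h + v |h v. h \<in> H \<and> v \<in> lattice_points \<Xi>} = (\<Union>v\<in>lattice_points \<Xi>. (+) v ` H)" for H
    proof (intro equalityI subsetI)
      fix x assume "x \<in> {h + v |h v. h \<in> H \<and> v \<in> lattice_points \<Xi>}"
      then obtain h v where "x = v + h" "h \<in> H" "v \<in> lattice_points \<Xi>" by (auto simp: add.commute)
      then show "x \<in> (\<Union>v\<in>lattice_points \<Xi>. (+) v ` H)" by blast
    next
      fix x assume "x \<in> (\<Union>v\<in>lattice_points \<Xi>. (+) v ` H)"
      then obtain h v where "x = v + h" "h \<in> H" "v \<in> lattice_points \<Xi>" by blast
      then have "x = h + v" "h \<in> H" "v \<in> lattice_points \<Xi>" by (simp_all add: add.commute)
      then show "x \<in> {h + v |h v. h \<in> H \<and> v \<in> lattice_points \<Xi>}" by blast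
    qed
    then show ?thesis unfolding mesh_def by simp
  qed
  have "hyperplanes \<Xi> \<subseteq> Real_Vector_Spaces.span ` Pow (set \<Xi>)" by (auto simp: hyperplanes_def)
  then have fin: "finite (hyperplanes \<Xi>)" by (rule finite_subset) simp
  have cl: "closed ((+) v ` H)" if "H \<in> hyperplanes \<Xi>" for H v
    using that by (intro closed_translation) (auto simp: hyperplanes_def closed_span)
  show ?thesis unfolding eq
    by (intro sets.finite_UN[OF fin] sets.countable_UN''[OF countable_lattice_points] borel_closed cl)
qed

text \<open>
  A component is relatively closed, and the mesh is a countable union of hyperplanes.  When the
  columns generate a dense lattice, the mesh need not be closed.
\<close>

lemma region_in_borel:
  assumes "R \<in> regions \<Xi>" shows "R \<in> sets borel" "bounded R"
proof -
  let ?S = "support_polyhedron \<Xi> - mesh \<Xi>"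
  have R: "R \<in> components ?S" using assms by (simp add: regions_def)
  obtain T where T: "closed T" "R = ?S \<inter> T"
    using closedin_component[OF R] by (auto simp: closedin_closed)
  show "R \<in> sets borel" unfolding T(2)
    using T(1) compact_imp_closed[OF compact_support_polyhedron]
    by (intro sets.Int sets.Diff mesh_in_borel) (auto intro: borel_closed)
  show "bounded R"
    using compact_imp_bounded[OF compact_support_polyhedron[of \<Xi>]] by (rule bounded_subset) (auto simp: T(2))
qed

lemma set_integrable_bounded:
  fixes R :: "'a::euclidean_space set" and f :: "'a \<Rightarrow> 'b :: {banach, second_countable_topology}"
  assumes "R \<in> sets borel" "bounded R" "f \<in> borel_measurable borel" "\<And>x. x \<in> R \<Longrightarrow> norm (f x) \<le> K"
  shows "set_integrable lborel R f"
  unfolding set_integrable_def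
proof (rule integrableI_bounded_set_indicator)
  show "AE x in lborel. x \<in> R \<longrightarrow> norm (f x) \<le> K" using assms by auto
  show "emeasure lborel R < \<infinity>" using assms by (intro emeasure_bounded_finite)
qed (use assms in auto)

text \<open>
  The value of a linear functional at the centroid is its mean over \<open>R\<close>.
\<close>

lemma halfspace_center:
  fixes R :: "(real ^ 's) set" and h :: "real ^ 's \<Rightarrow> real"
  assumes R: "R \<in> sets borel" "bounded R" and pos: "\<not> negligible R"
    and h: "linear h" and c: "\<And>x. x \<in> R \<Longrightarrow> c < h x"
  shows "c < h (center R)"
proof -
  have bl: "bounded_linear h" using h by (simp add: linear_conv_bounded_linear)
  then have [measurable]: "h \<in> borel_measurable borel"
    by (intro borel_measurable_continuous_onI linear_continuous_on)
  have fin: "emeasure lborel R < \<infinity>" using R by (intro emeasure_bounded_finite)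
  obtain B where B: "\<And>x. x \<in> R \<Longrightarrow> norm x \<le> B" using R(2) by (auto simp: bounded_iff)
  have id: "set_integrable lborel R (\<lambda>x. x)" by (rule set_integrable_bounded[OF R, where K = B]) (use B in auto)
  have const: "set_integrable lborel R (\<lambda>x. k :: real)" for k by (rule set_integrable_bounded[OF R, where K = "\<bar>k\<bar>"]) auto
  have hi: "set_integrable lborel R h" and h_int: "(LINT x:R|lborel. h x) = h (LINT x:R|lborel. x)"
  proof -
    have "integrable lborel (\<lambda>x. h (indicator R x *\<^sub>R x))"
      using id unfolding set_integrable_def by (rule integrable_bounded_linear[OF bl])
    moreover have "(\<lambda>x. h (indicator R x *\<^sub>R x)) = (\<lambda>x. indicator R x *\<^sub>R h x)"
      using h by (auto simp: linear_scale)
    ultimately show "set_integrable lborel R h" "(LINT x:R|lborel. h x) = h (LINT x:R|lborel. x)"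
      using integral_bounded_linear[OF bl id[unfolded set_integrable_def]]
      by (auto simp: set_integrable_def set_lebesgue_integral_def)
  qed
  have meas: "measure lebesgue R = measure lborel R" using R by simp
  have pos': "measure lborel R > 0"
  proof (rule ccontr)
    assume "\<not> measure lborel R > 0"
    then have "measure lborel R = 0" using measure_nonneg[of lborel R] by linarith
    then have "emeasure lborel R = 0" using fin by (simp add: emeasure_eq_ennreal_measure)
    then have "R \<in> null_sets lebesgue" using R by (auto simp: null_sets_def)
    then show False using pos by (simp add: negligible_iff_null_sets)
  qed
  have diff: "set_integrable lborel R (\<lambda>x. h x - c)" by (rule set_integral_diff[OF hi const])
  have val: "(LINT x:R|lborel. h x - c) = h (LINT x:R|lborel. x) - c * measure lborel R"
  proof -
    have "(LINT x:R|lborel. c) = c * measure lborel R"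
      unfolding set_lebesgue_integral_def using R fin by simp
    then show ?thesis using set_integral_diff(2)[OF hi const, of c] by (simp only: h_int)
  qed
  have "0 < (LINT x:R|lborel. h x - c)"
  proof (rule ccontr)
    assume "\<not> ?thesis"
    moreover have nn: "0 \<le> indicator R x *\<^sub>R (h x - c)" for x using c by (auto simp: indicator_def less_imp_le)
    then have "0 \<le> (LINT x:R|lborel. h x - c)" unfolding set_lebesgue_integral_def by (rule Bochner_Integration.integral_nonneg)
    ultimately have "(\<integral>x. indicator R x *\<^sub>R (h x - c) \<partial>lborel) = 0" unfolding set_lebesgue_integral_def by linarith
    then have "AE x in lborel. indicator R x *\<^sub>R (h x - c) = 0"
      using diff nn unfolding set_integrable_def by (subst (asm) integral_nonneg_eq_0_iff_AE) auto
    then have "AE x in lborel. x \<notin> R"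
      by eventually_elim (use c in \<open>auto simp: indicator_def split: if_splits\<close>)
    then have "emeasure lborel R = 0" using R by (simp add: AE_iff_measurable[OF _ refl])
    then show False using pos' by (simp add: measure_def)
  qed
  then have "c * measure lborel R < h (LINT x:R|lborel. x)" using val by simp
  moreover have "h (center R) = h (LINT x:R|lborel. x) / measure lborel R"
    unfolding center_def meas using h set_borel_integral_eq_integral(2)[OF id]
    by (simp add: linear_scale divide_inverse mult.commute)
  ultimately show ?thesis using pos' by (simp add: pos_less_divide_eq)
qed

text \<open>
  Where the coordinate vanishes, \<open>x - p\<close> lies in the span of the other basis directions, which is one
  of the hyperplanes of the mesh.
\<close>

lemma coordinate_nonzero_off_mesh:
  fixes \<Xi> :: "(real ^ 's) list"
  assumes len: "length \<alpha> = length \<Xi>" and n: "norm0 \<alpha> = CARD('s)"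
    and det: "Determinants.det (sub_matrix \<Xi> \<alpha> :: real ^ 's ^ 's) \<noteq> 0"
    and p: "p \<in> lattice_points \<Xi>" and x: "x \<notin> mesh \<Xi>"
  shows "(matrix_inv (sub_matrix \<Xi> \<alpha>) *v (x - p)) $ j \<noteq> 0"
proof
  let ?A = "sub_matrix \<Xi> \<alpha> :: real ^ 's ^ 's"
  define y where "y = matrix_inv ?A *v (x - p)"
  assume "(matrix_inv (sub_matrix \<Xi> \<alpha>) *v (x - p)) $ j = 0"
  then have yj: "y $ j = 0" by (simp add: y_def)
  define B where "B = (\<lambda>i::'s. \<Xi> ! position \<alpha> i) ` (UNIV - {j})"
  have pos: "position \<alpha> (i :: 's) < length \<Xi>" for i using range_position[OF n] len by auto
  have col: "\<Xi> ! position \<alpha> i \<in> Real_Vector_Spaces.span B" if "i \<noteq> j" for i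
    using that by (intro real_vector.span_base) (auto simp: B_def)
  have "x - p = ?A *v y" by (simp add: y_def matrix_vector_mul_assoc matrix_inv_mult(2)[OF det])
  also have "\<dots> \<in> Real_Vector_Spaces.span B"
    unfolding sub_matrix_mult
  proof (rule real_vector.span_sum)
    fix i show "y $ i *\<^sub>R \<Xi> ! position \<alpha> i \<in> Real_Vector_Spaces.span B"
      using yj col[of i] by (cases "i = j") (auto intro: real_vector.span_scale real_vector.span_zero)
  qed
  finally have xp: "x - p \<in> Real_Vector_Spaces.span B" .
  have "Real_Vector_Spaces.span (insert (\<Xi> ! position \<alpha> j) B) = UNIV"
  proof -
    have "v \<in> Real_Vector_Spaces.span (insert (\<Xi> ! position \<alpha> j) B)" for v
    proof -
      have "v = ?A *v (matrix_inv ?A *v v)" by (simp add: matrix_vector_mul_assoc matrix_inv_mult(2)[OF det])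
      also have "\<dots> \<in> Real_Vector_Spaces.span (insert (\<Xi> ! position \<alpha> j) B)"
        unfolding sub_matrix_mult
        by (intro real_vector.span_sum real_vector.span_scale real_vector.span_base) (auto simp: B_def)
      finally show ?thesis .
    qed
    then show ?thesis by blast
  qed
  then have "Real_Vector_Spaces.dim (insert (\<Xi> ! position \<alpha> j) B) = CARD('s)"
    by (subst (asm) dim_eq_full[symmetric]) simp
  then have "CARD('s) \<le> Real_Vector_Spaces.dim B + 1" by (subst (asm) dim_insert) (simp split: if_splits)
  moreover have "Real_Vector_Spaces.dim B \<le> CARD('s) - 1"
  proof -
    have "Real_Vector_Spaces.dim B \<le> card B" by (rule dim_le_card') (simp add: B_def)
    also have "\<dots> \<le> card (UNIV - {j})" unfolding B_def by (rule card_image_le) simp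
    finally show ?thesis by simp
  qed
  ultimately have "Real_Vector_Spaces.dim B = CARD('s) - 1" by linarith
  moreover have "B \<subseteq> set \<Xi>" using pos by (auto simp: B_def)
  ultimately have "Real_Vector_Spaces.span B \<in> hyperplanes \<Xi>" unfolding hyperplanes_def by blast
  then have "(x - p) + p \<in> mesh \<Xi>" using xp p unfolding mesh_def by blast
  then show False using x by simp
qed

text \<open>
  On the connected set \<open>R\<close> the coordinate has no zero, so it has constant sign, and the centroid
  inherits this sign.
\<close>

lemma heaviside_center:
  fixes \<Xi> :: "(real ^ 's) list"
  assumes R: "R \<in> regions \<Xi>" "\<not> negligible R" and x: "x \<in> R"
    and len: "length \<alpha> = length \<Xi>" and n: "norm0 \<alpha> = CARD('s)"
    and det: "Determinants.det (sub_matrix \<Xi> \<alpha> :: real ^ 's ^ 's) \<noteq> 0"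
    and p: "p \<in> lattice_points \<Xi>"
  shows "heaviside ((matrix_inv (sub_matrix \<Xi> \<alpha>) *v (center R - p)) $ j) =
    heaviside ((matrix_inv (sub_matrix \<Xi> \<alpha>) *v (x - p)) $ j)"
proof -
  define h where "h y = (matrix_inv (sub_matrix \<Xi> \<alpha>) *v y) $ j" for y
  have h: "linear h" unfolding h_def
    by (rule linearI) (simp_all add: matrix_vector_right_distrib matrix_vector_mult_scaleR)
  have hd: "(matrix_inv (sub_matrix \<Xi> \<alpha>) *v (y - p)) $ j = h y - h p" for y
    by (simp add: h_def matrix_vector_mult_diff_distrib)
  have ne: "h y \<noteq> h p" if "y \<in> R" for y
  proof -
    have "y \<notin> mesh \<Xi>" using that R(1) in_components_subset unfolding regions_def by blast
    from coordinate_nonzero_off_mesh[OF len n det p this, of j] show ?thesis by (simp add: hd)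
  qed
  have conn: "connected (h ` R)"
    using R(1) h by (intro connected_continuous_image linear_continuous_on)
      (auto simp: regions_def linear_conv_bounded_linear dest: in_components_connected)
  have off: "h p \<notin> h ` R" using ne by force
  have side: "h y > h p \<longleftrightarrow> h x > h p" if y: "y \<in> R" for y
  proof (rule ccontr)
    assume "\<not> ?thesis"
    then have "h x \<le> h p \<and> h p \<le> h y \<or> h y \<le> h p \<and> h p \<le> h x" by linarith
    then have "h p \<in> h ` R" using connectedD_interval[OF conn imageI imageI] x y by blast
    with off show False ..
  qed
  note Rb = region_in_borel[OF R(1)]
  show ?thesis
  proof (cases "h x > h p")
    case True
    then have "h p < h (center R)" using side by (intro halfspace_center[OF Rb R(2) h]) auto
    then show ?thesis using True by (simp add: hd heaviside_def)
  next
    case False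
    have nh: "linear (\<lambda>y. - h y)" using h by (simp add: linear_compose_neg)
    have "- h p < - h (center R)"
    proof (rule halfspace_center[OF Rb R(2) nh])
      fix y assume y: "y \<in> R"
      show "- h p < - h y" using side[OF y] ne[OF y] False by linarith
    qed
    moreover have "h x < h p" using False ne[OF x] by linarith
    ultimately show ?thesis by (simp add: hd heaviside_def)
  qed
qed

lemma truncated_power_eq:
  "truncated_power y \<beta> = truncated_power y 0 * (vpower y \<beta> / vfact \<beta>)"
  by (simp add: truncated_power_def vpower_def vfact_def prod.distrib prod_dividef)

lemma pp_form_eq_spline_density:
  fixes \<Xi> :: "(real ^ 's) list"
  assumes nondegenerate: "Real_Vector_Spaces.dim (set \<Xi>) = CARD('s)"
    and nonzero: "0 \<notin> set \<Xi>" and ker: "\<And>X. kernel_matrix X (ker X)"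
    and R: "R \<in> regions \<Xi>" "\<not> negligible R" and x: "x \<in> R"
  shows "pp_form ker \<Xi> (center R) x = spline_density ker \<Xi> x"
proof -
  have k: "length \<Xi> - CARD('s) + CARD('s) \<le> length \<Xi>"
    using card_le_length_if_spanning[OF nondegenerate] by simp
  show ?thesis
    unfolding pp_form_def spline_density_def
  proof ((rule arg_cong[where f = sum_mset], rule image_mset_cong, clarify)+)
    fix b p c \<alpha> assume p: "(b, p) \<in># diff_mset \<Xi>" and \<alpha>: "(c, \<alpha>) \<in># exponent_mset ker \<Xi> (length \<Xi> - CARD('s))"
    note inv = reduction_invariant_exponent_mset[OF nondegenerate nonzero ker k \<alpha>]
    have n: "norm0 \<alpha> = CARD('s)" using reduction_invariantD(2)[OF inv] k by linarith
    let ?A = "sub_matrix \<Xi> \<alpha> :: real ^ 's ^ 's"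
    have "truncated_power (matrix_inv ?A *v (center R - p)) 0 = truncated_power (matrix_inv ?A *v (x - p)) 0"
      unfolding truncated_power_def
      using heaviside_center[OF R x reduction_invariantD(1)[OF inv] n det_sub_matrix_nonzero[OF inv n] diff_mset_subset_lattice_points[OF p]]
      by simp
    then show "b * c / \<bar>Determinants.det ?A\<bar> * truncated_power (matrix_inv ?A *v (center R - p)) 0 *
        (vpower (matrix_inv ?A *v (x - p)) (mu \<alpha> - 1) / vfact (mu \<alpha> - 1 :: nat ^ 's)) = b * c * green \<Xi> \<alpha> (x - p)"
      unfolding green_def truncated_power_eq[of _ "mu \<alpha> - 1"] by (simp add: mult_ac)
  qed
qed

lemma real_polynomial_function_pp_form: "real_polynomial_function (pp_form ker \<Xi> c)"
proof -
  have s: "real_polynomial_function (\<lambda>x. \<Sum>z\<in>#S. f z x)"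
    if "\<And>z. real_polynomial_function (f z)" for S and f :: "'b \<Rightarrow> real ^ 's \<Rightarrow> real"
    using that by (induction S) (auto intro: real_polynomial_function.intros)
  have p: "real_polynomial_function (\<lambda>x. \<Prod>j\<in>J. f j x)"
    if "\<And>j. real_polynomial_function (f j)" for J and f :: "'s \<Rightarrow> real ^ 's \<Rightarrow> real"
    using that by (induction J rule: infinite_finite_induct) (auto intro: real_polynomial_function.intros)
  have l: "real_polynomial_function (\<lambda>x. (A *v (x - q)) $ j)" for A :: "real ^ 's ^ 's" and q j
  proof -
    have "bounded_linear (\<lambda>x. (A *v x) $ j)"
      by (intro bounded_linear_compose[OF bounded_linear_vec_nth] matrix_vector_mul_bounded_linear)
    then show ?thesis unfolding matrix_vector_mult_diff_distrib vector_minus_component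
      by (intro real_polynomial_function_diff real_polynomial_function.intros)
  qed
  show ?thesis
    unfolding pp_form_def[abs_def] split_def vpower_def
    by (intro s p l real_polynomial_function.intros real_polynomial_function_power real_polynomial_function_divide)
qed

theorem mainTheorem2:
  fixes \<Xi> :: "(real ^ 's) list"
    and ker :: "real mat \<Rightarrow> real mat"
    and R :: "(real ^ 's) set"
  assumes nondegenerate: "Real_Vector_Spaces.dim (set \<Xi>) = CARD('s)"
    and directions_nonzero: "0 \<notin> set \<Xi>"
    and ker: "\<And>X. kernel_matrix X (ker X)"
    and region: "R \<in> regions \<Xi>"
  shows "real_polynomial_function (pp_form ker \<Xi> (center R)) \<and>
         agrees_on (box_spline \<Xi>) (pp_form ker \<Xi> (center R)) R"
proof
  show "real_polynomial_function (pp_form ker \<Xi> (center R))"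
    by (rule real_polynomial_function_pp_form)
  show "agrees_on (box_spline \<Xi>) (pp_form ker \<Xi> (center R)) R"
    unfolding agrees_on_def
  proof safe
    fix A :: "(real ^ 's) set" assume A: "A \<in> sets borel" "A \<subseteq> R"
    have "bounded A" using region_in_borel(2)[OF region] A(2) by (rule bounded_subset)
    then have density: "(spline_density ker \<Xi> has_integral measure (box_spline \<Xi>) A) A"
      by (intro weak_density_has_integral prob_space_box_spline sets_box_spline measurable_spline_density A
        has_bochner_integral_spline_density[OF nondegenerate directions_nonzero ker])
    show "(pp_form ker \<Xi> (center R) has_integral measure (box_spline \<Xi>) A) A"
    proof (cases "negligible R")
      case True
      then have "negligible A" using A(2) negligible_subset by blast
      then have zero: "(f has_integral 0) A" for f :: "real ^ 's \<Rightarrow> real" by (intro has_integral_negligible) auto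
      from has_integral_unique[OF density zero] zero show ?thesis by simp
    next
      case False
      show ?thesis
        by (rule has_integral_eq[OF _ density])
          (use pp_form_eq_spline_density[OF nondegenerate directions_nonzero ker region False] A(2) in auto)
    qed
  qed
qed

end
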